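(* Let $G$ be a countable abelian group, let $P$ be a subsemigroup of $G$ which contains the identity, and let $E$ be a product system over $P$ of finite-dimensional Hilbert spaces which admits a nontrivial (i.e. nonzero) Cuntz representation. If the dimension function $s\in P\mapsto \dim E_s$ is injective, then the $C^*$-algebra $\mathcal{O}_E$ is simple and purely infinite.
   Context: Groups and semigroups are discrete. Let $P$ be a countable semigroup with identity $e$. A product system over $P$ is a family $p:E\to P$ of nontrivial separable complex Hilbert spaces $E_t:=p^{-1}(t)$ endowed with an associative multiplication $E\times E\to E$ such that $p$ is a semigroup homomorphism and such that for all $s,t\in P$ the map $x\otimes y\in E_s\otimes E_t\mapsto xy\in E_{st}$ extends to a unitary isomorphism; one also requires $\dim E_e=1$, so that $E$ has an identity element $1\in E_e$. Inner products are linear in the first variable. A representation of $E$ in a $C^*$-algebra $B$ is a map $\phi:E\to B$ with (i) $\phi(xy)=\phi(x)\phi(y)$ for all $x,y\in E$, and (ii) $\phi(y)^*\phi(x)=(x\mid y)\phi(1)$ whenever $p(x)=p(y)$. When all fibers $E_t$ are finite-dimensional, $\phi$ is a Cuntz representation if moreover for every $t\in P$ and every orthonormal basis $\mathcal{B}_t$ of $E_t$, $\sum_{f\in\mathcal{B}_t}\phi(f)\phi(f)^*=\phi(1)$. The zero map is allowed as a (trivial) Cuntz representation. $(\mathcal{O}_E,i_E)$ denotes the universal pair (unique up to canonical isomorphism) consisting of a $C^*$-algebra $\mathcal{O}_E$ and a Cuntz representation $i_E:E\to\mathcal{O}_E$ such that $i_E(E)$ generates $\mathcal{O}_E$ as a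 $C^*$-algebra and for every Cuntz representation $\phi:E\to B$ there is a $*$-homomorphism $\phi_*:\mathcal{O}_E\to B$ with $\phi_*\circ i_E=\phi$. A simple $C^*$-algebra is purely infinite if every nonzero hereditary $C^*$-subalgebra contains an infinite projection (one Murray–von Neumann equivalent to a proper subprojection of itself).
   Formalization: Pure infiniteness is asserted only when P is not the trivial semigroup {e}; for P = {e} all hypotheses hold but O_E is the complex numbers, which is simple and not purely infinite. Simplicity is asserted for every P. *)

theory Defs
  imports "HOL-Analysis.Analysis" "HOL-Algebra.Algebraic_Closure_Type"
begin

text \<open>
  All structures are carrier-based, in the style of HOL-Algebra, since the universal property of
  the Cuntz algebra of a product system quantifies over C*-algebras. Complex vector spaces are
  modules over the field of complex numbers; a vector space without multiplication does not use
  the fields \<open>mult\<close> and \<open>one\<close> of the record \<open>module\<close>, and a C*-algebra does not use \<open>one\<close>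
  (C*-algebras are not assumed to be unital).
\<close>

abbreviation complex_field :: "complex ring" where
  "complex_field \<equiv> ring_of_type_algebra"

text \<open>The distance has a dummy value outside the carrier because the locale \<^locale>\<open>Metric_space\<close>
  requires nonnegativity and symmetry on the whole type.\<close>

definition norm_dist :: "('a, 'm) ring_scheme \<Rightarrow> ('a \<Rightarrow> real) \<Rightarrow> 'a \<Rightarrow> 'a \<Rightarrow> real" where
  "norm_dist V n x y = (if x \<in> carrier V \<and> y \<in> carrier V then n (x \<ominus>\<^bsub>V\<^esub> y) else 0)"

definition norm_topology :: "('a, 'm) ring_scheme \<Rightarrow> ('a \<Rightarrow> real) \<Rightarrow> 'a topology" where
  "norm_topology V n = Metric_space.mtopology (carrier V) (norm_dist V n)"

definition norm_complete :: "('a, 'm) ring_scheme \<Rightarrow> ('a \<Rightarrow> real) \<Rightarrow> bool" where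
  "norm_complete V n \<longleftrightarrow> Metric_space.mcomplete (carrier V) (norm_dist V n)"

definition linear_span :: "(complex, 'a, 'm) module_scheme \<Rightarrow> 'a set \<Rightarrow> 'a set" where
  "linear_span V S = \<Inter>{W. submodule W complex_field V \<and> S \<subseteq> W}"


section \<open>Hilbert spaces\<close>

record 'e hilbert = "(complex, 'e) module" +
  ip :: "'e \<Rightarrow> 'e \<Rightarrow> complex"

definition hnorm :: "'e hilbert \<Rightarrow> 'e \<Rightarrow> real" where
  "hnorm H x = sqrt (Re (ip H x x))"

locale hilbert_space = module complex_field H for H :: "'e hilbert" (structure) +
  assumes ip_add_left:
      "\<lbrakk>x \<in> carrier H; y \<in> carrier H; z \<in> carrier H\<rbrakk> \<Longrightarrow> ip H (x \<oplus> y) z = ip H x z + ip H y z"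
    and ip_smult_left:
      "\<lbrakk>x \<in> carrier H; z \<in> carrier H\<rbrakk> \<Longrightarrow> ip H (c \<odot>\<^bsub>H\<^esub> x) z = c * ip H x z"
    and ip_cnj: "\<lbrakk>x \<in> carrier H; y \<in> carrier H\<rbrakk> \<Longrightarrow> ip H y x = cnj (ip H x y)"
    and ip_nonneg: "x \<in> carrier H \<Longrightarrow> 0 \<le> Re (ip H x x)"
    and ip_definite: "\<lbrakk>x \<in> carrier H; ip H x x = 0\<rbrakk> \<Longrightarrow> x = \<zero>\<^bsub>H\<^esub>"
    and complete: "norm_complete H (hnorm H)"

definition total_in :: "'e hilbert \<Rightarrow> 'e set \<Rightarrow> bool" where
  "total_in H S \<longleftrightarrow> norm_topology H (hnorm H) closure_of linear_span H S = carrier H"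

definition orthonormal_basis :: "'e hilbert \<Rightarrow> 'e set \<Rightarrow> bool" where
  "orthonormal_basis H S \<longleftrightarrow>
     S \<subseteq> carrier H \<and> (\<forall>x\<in>S. \<forall>y\<in>S. ip H x y = (if x = y then 1 else 0)) \<and> total_in H S"

definition finite_dimensional :: "'e hilbert \<Rightarrow> bool" where
  "finite_dimensional H \<longleftrightarrow> (\<exists>S. finite S \<and> S \<subseteq> carrier H \<and> linear_span H S = carrier H)"

text \<open>All orthonormal bases have the same cardinality, so the choice does not matter. The value is
  \<open>0\<close> for infinite-dimensional spaces.\<close>

definition hdim :: "'e hilbert \<Rightarrow> nat" where
  "hdim H = card (SOME S. orthonormal_basis H S)"


section \<open>C*-algebras\<close>

record 'a cstar = "(complex, 'a) module" +
  star :: "'a \<Rightarrow> 'a"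
  nrm :: "'a \<Rightarrow> real"

locale cstar_algebra = module complex_field A for A :: "'a cstar" (structure) +
  assumes mult_closed: "\<lbrakk>x \<in> carrier A; y \<in> carrier A\<rbrakk> \<Longrightarrow> x \<otimes> y \<in> carrier A"
    and mult_assoc:
      "\<lbrakk>x \<in> carrier A; y \<in> carrier A; z \<in> carrier A\<rbrakk> \<Longrightarrow> (x \<otimes> y) \<otimes> z = x \<otimes> (y \<otimes> z)"
    and distrib_left:
      "\<lbrakk>x \<in> carrier A; y \<in> carrier A; z \<in> carrier A\<rbrakk> \<Longrightarrow> x \<otimes> (y \<oplus> z) = x \<otimes> y \<oplus> x \<otimes> z"
    and distrib_right:
      "\<lbrakk>x \<in> carrier A; y \<in> carrier A; z \<in> carrier A\<rbrakk> \<Longrightarrow> (x \<oplus> y) \<otimes> z = x \<otimes> z \<oplus> y \<otimes> z"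
    and smult_mult_left:
      "\<lbrakk>x \<in> carrier A; y \<in> carrier A\<rbrakk> \<Longrightarrow> (c \<odot>\<^bsub>A\<^esub> x) \<otimes> y = c \<odot>\<^bsub>A\<^esub> (x \<otimes> y)"
    and smult_mult_right:
      "\<lbrakk>x \<in> carrier A; y \<in> carrier A\<rbrakk> \<Longrightarrow> x \<otimes> (c \<odot>\<^bsub>A\<^esub> y) = c \<odot>\<^bsub>A\<^esub> (x \<otimes> y)"
    and star_closed: "x \<in> carrier A \<Longrightarrow> star A x \<in> carrier A"
    and star_star: "x \<in> carrier A \<Longrightarrow> star A (star A x) = x"
    and star_add:
      "\<lbrakk>x \<in> carrier A; y \<in> carrier A\<rbrakk> \<Longrightarrow> star A (x \<oplus> y) = star A x \<oplus> star A y"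
    and star_smult: "x \<in> carrier A \<Longrightarrow> star A (c \<odot>\<^bsub>A\<^esub> x) = cnj c \<odot>\<^bsub>A\<^esub> star A x"
    and star_mult:
      "\<lbrakk>x \<in> carrier A; y \<in> carrier A\<rbrakk> \<Longrightarrow> star A (x \<otimes> y) = star A y \<otimes> star A x"
    and nrm_nonneg: "x \<in> carrier A \<Longrightarrow> 0 \<le> nrm A x"
    and nrm_eq_0: "x \<in> carrier A \<Longrightarrow> nrm A x = 0 \<longleftrightarrow> x = \<zero>\<^bsub>A\<^esub>"
    and nrm_triangle:
      "\<lbrakk>x \<in> carrier A; y \<in> carrier A\<rbrakk> \<Longrightarrow> nrm A (x \<oplus> y) \<le> nrm A x + nrm A y"
    and nrm_smult: "x \<in> carrier A \<Longrightarrow> nrm A (c \<odot>\<^bsub>A\<^esub> x) = cmod c * nrm A x"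
    and nrm_mult: "\<lbrakk>x \<in> carrier A; y \<in> carrier A\<rbrakk> \<Longrightarrow> nrm A (x \<otimes> y) \<le> nrm A x * nrm A y"
    and nrm_star_mult: "x \<in> carrier A \<Longrightarrow> nrm A (star A x \<otimes> x) = (nrm A x)\<^sup>2"
    and complete: "norm_complete A (nrm A)"

definition cstar_subalgebra :: "'a set \<Rightarrow> 'a cstar \<Rightarrow> bool" where
  "cstar_subalgebra S A \<longleftrightarrow>
     submodule S complex_field A \<and>
     (\<forall>x\<in>S. \<forall>y\<in>S. x \<otimes>\<^bsub>A\<^esub> y \<in> S) \<and> (\<forall>x\<in>S. star A x \<in> S) \<and>
     closedin (norm_topology A (nrm A)) S"

definition cstar_generated :: "'a cstar \<Rightarrow> 'a set \<Rightarrow> 'a set" where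
  "cstar_generated A Y = \<Inter>{S. cstar_subalgebra S A \<and> Y \<subseteq> S}"

definition star_hom :: "'a cstar \<Rightarrow> 'b cstar \<Rightarrow> ('a \<Rightarrow> 'b) \<Rightarrow> bool" where
  "star_hom A B h \<longleftrightarrow>
     (\<forall>x\<in>carrier A. h x \<in> carrier B) \<and>
     (\<forall>x\<in>carrier A. \<forall>y\<in>carrier A. h (x \<oplus>\<^bsub>A\<^esub> y) = h x \<oplus>\<^bsub>B\<^esub> h y) \<and>
     (\<forall>c. \<forall>x\<in>carrier A. h (c \<odot>\<^bsub>A\<^esub> x) = c \<odot>\<^bsub>B\<^esub> h x) \<and>
     (\<forall>x\<in>carrier A. \<forall>y\<in>carrier A. h (x \<otimes>\<^bsub>A\<^esub> y) = h x \<otimes>\<^bsub>B\<^esub> h y) \<and>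
     (\<forall>x\<in>carrier A. h (star A x) = star B (h x))"

definition closed_ideal :: "'a set \<Rightarrow> 'a cstar \<Rightarrow> bool" where
  "closed_ideal I A \<longleftrightarrow>
     submodule I complex_field A \<and>
     (\<forall>a\<in>carrier A. \<forall>x\<in>I. a \<otimes>\<^bsub>A\<^esub> x \<in> I \<and> x \<otimes>\<^bsub>A\<^esub> a \<in> I) \<and>
     closedin (norm_topology A (nrm A)) I"

definition simple_cstar :: "'a cstar \<Rightarrow> bool" where
  "simple_cstar A \<longleftrightarrow>
     carrier A \<noteq> {\<zero>\<^bsub>A\<^esub>} \<and> (\<forall>I. closed_ideal I A \<longrightarrow> I = {\<zero>\<^bsub>A\<^esub>} \<or> I = carrier A)"

definition positive :: "'a cstar \<Rightarrow> 'a \<Rightarrow> bool" where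
  "positive A a \<longleftrightarrow> (\<exists>x\<in>carrier A. a = star A x \<otimes>\<^bsub>A\<^esub> x)"

definition cstar_le :: "'a cstar \<Rightarrow> 'a \<Rightarrow> 'a \<Rightarrow> bool" where
  "cstar_le A a b \<longleftrightarrow> a \<in> carrier A \<and> b \<in> carrier A \<and> positive A (b \<ominus>\<^bsub>A\<^esub> a)"

definition hereditary_subalgebra :: "'a set \<Rightarrow> 'a cstar \<Rightarrow> bool" where
  "hereditary_subalgebra S A \<longleftrightarrow>
     cstar_subalgebra S A \<and>
     (\<forall>a\<in>carrier A. \<forall>b\<in>S. cstar_le A \<zero>\<^bsub>A\<^esub> a \<and> cstar_le A a b \<longrightarrow> a \<in> S)"

definition projection :: "'a cstar \<Rightarrow> 'a \<Rightarrow> bool" where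
  "projection A p \<longleftrightarrow> p \<in> carrier A \<and> star A p = p \<and> p \<otimes>\<^bsub>A\<^esub> p = p"

definition mvn_equivalent :: "'a cstar \<Rightarrow> 'a \<Rightarrow> 'a \<Rightarrow> bool" where
  "mvn_equivalent A p q \<longleftrightarrow>
     (\<exists>v\<in>carrier A. star A v \<otimes>\<^bsub>A\<^esub> v = p \<and> v \<otimes>\<^bsub>A\<^esub> star A v = q)"

definition infinite_projection :: "'a cstar \<Rightarrow> 'a \<Rightarrow> bool" where
  "infinite_projection A p \<longleftrightarrow>
     projection A p \<and>
     (\<exists>q. projection A q \<and> cstar_le A q p \<and> q \<noteq> p \<and> mvn_equivalent A p q)"

definition purely_infinite :: "'a cstar \<Rightarrow> bool" where
  "purely_infinite A \<longleftrightarrow>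
     (\<forall>S. hereditary_subalgebra S A \<and> S \<noteq> {\<zero>\<^bsub>A\<^esub>} \<longrightarrow> (\<exists>p\<in>S. infinite_projection A p))"


section \<open>Product systems\<close>

record ('p, 'e) prod_system =
  total_space :: "'e set"
  pr :: "'e \<Rightarrow> 'p"
  fibre :: "'p \<Rightarrow> 'e hilbert"
  pmult :: "'e \<Rightarrow> 'e \<Rightarrow> 'e"

text \<open>The axioms \<open>pmult_add_left\<close> to \<open>pmult_total\<close> say that \<open>x \<otimes> y \<mapsto> x y\<close> extends to a unitary
  from the Hilbert space tensor product of \<open>E\<^sub>s\<close> and \<open>E\<^sub>t\<close> onto \<open>E\<^sub>s\<^sub>t\<close>: it is bilinear, it respects
  the inner product of elementary tensors,
  \<open>(x \<otimes> y | x' \<otimes> y') = (x | x') (y | y')\<close>, and it has dense linear range.\<close>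

locale product_system = monoid P for P :: "('p, 'm) monoid_scheme" (structure)
    and E :: "('p, 'e) prod_system" +
  assumes countable_base: "countable (carrier P)"
    and proj_closed: "x \<in> total_space E \<Longrightarrow> pr E x \<in> carrier P"
    and carrier_fibre: "t \<in> carrier P \<Longrightarrow> carrier (fibre E t) = {x \<in> total_space E. pr E x = t}"
    and fibre_hilbert: "t \<in> carrier P \<Longrightarrow> hilbert_space (fibre E t)"
    and fibre_separable:
      "t \<in> carrier P \<Longrightarrow> separable_space (norm_topology (fibre E t) (hnorm (fibre E t)))"
    and fibre_nontrivial: "t \<in> carrier P \<Longrightarrow> carrier (fibre E t) \<noteq> {\<zero>\<^bsub>fibre E t\<^esub>}"
    and pmult_closed: "\<lbrakk>x \<in> total_space E; y \<in> total_space E\<rbrakk> \<Longrightarrow> pmult E x y \<in> total_space E"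
    and pmult_assoc:
      "\<lbrakk>x \<in> total_space E; y \<in> total_space E; z \<in> total_space E\<rbrakk>
        \<Longrightarrow> pmult E (pmult E x y) z = pmult E x (pmult E y z)"
    and proj_pmult:
      "\<lbrakk>x \<in> total_space E; y \<in> total_space E\<rbrakk> \<Longrightarrow> pr E (pmult E x y) = pr E x \<otimes> pr E y"
    and pmult_add_left:
      "\<lbrakk>s \<in> carrier P; t \<in> carrier P; x \<in> carrier (fibre E s); x' \<in> carrier (fibre E s);
        y \<in> carrier (fibre E t)\<rbrakk>
        \<Longrightarrow> pmult E (x \<oplus>\<^bsub>fibre E s\<^esub> x') y = pmult E x y \<oplus>\<^bsub>fibre E (s \<otimes> t)\<^esub> pmult E x' y"
    and pmult_add_right:
      "\<lbrakk>s \<in> carrier P; t \<in> carrier P; x \<in> carrier (fibre E s); y \<in> carrier (fibre E t);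
        y' \<in> carrier (fibre E t)\<rbrakk>
        \<Longrightarrow> pmult E x (y \<oplus>\<^bsub>fibre E t\<^esub> y') = pmult E x y \<oplus>\<^bsub>fibre E (s \<otimes> t)\<^esub> pmult E x y'"
    and pmult_smult_left:
      "\<lbrakk>s \<in> carrier P; t \<in> carrier P; x \<in> carrier (fibre E s); y \<in> carrier (fibre E t)\<rbrakk>
        \<Longrightarrow> pmult E (c \<odot>\<^bsub>fibre E s\<^esub> x) y = c \<odot>\<^bsub>fibre E (s \<otimes> t)\<^esub> pmult E x y"
    and pmult_smult_right:
      "\<lbrakk>s \<in> carrier P; t \<in> carrier P; x \<in> carrier (fibre E s); y \<in> carrier (fibre E t)\<rbrakk>
        \<Longrightarrow> pmult E x (c \<odot>\<^bsub>fibre E t\<^esub> y) = c \<odot>\<^bsub>fibre E (s \<otimes> t)\<^esub> pmult E x y"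
    and pmult_ip:
      "\<lbrakk>s \<in> carrier P; t \<in> carrier P; x \<in> carrier (fibre E s); x' \<in> carrier (fibre E s);
        y \<in> carrier (fibre E t); y' \<in> carrier (fibre E t)\<rbrakk>
        \<Longrightarrow> ip (fibre E (s \<otimes> t)) (pmult E x y) (pmult E x' y')
            = ip (fibre E s) x x' * ip (fibre E t) y y'"
    and pmult_total:
      "\<lbrakk>s \<in> carrier P; t \<in> carrier P\<rbrakk>
        \<Longrightarrow> total_in (fibre E (s \<otimes> t))
              {pmult E x y | x y. x \<in> carrier (fibre E s) \<and> y \<in> carrier (fibre E t)}"
    and dim_fibre_one: "hdim (fibre E \<one>) = 1"

text \<open>The identity element of \<open>E\<close>; it exists in every product system because \<open>E\<^sub>e\<close> is
  one-dimensional.\<close>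

definition punit :: "('p, 'e) prod_system \<Rightarrow> 'e" where
  "punit E = (THE u. u \<in> total_space E \<and> (\<forall>x\<in>total_space E. pmult E u x = x \<and> pmult E x u = x))"

definition representation :: "('p, 'e) prod_system \<Rightarrow> 'b cstar \<Rightarrow> ('e \<Rightarrow> 'b) \<Rightarrow> bool" where
  "representation E B \<phi> \<longleftrightarrow>
     (\<forall>x\<in>total_space E. \<phi> x \<in> carrier B) \<and>
     (\<forall>x\<in>total_space E. \<forall>y\<in>total_space E. \<phi> (pmult E x y) = \<phi> x \<otimes>\<^bsub>B\<^esub> \<phi> y) \<and>
     (\<forall>x\<in>total_space E. \<forall>y\<in>total_space E. pr E x = pr E y \<longrightarrow>
        star B (\<phi> y) \<otimes>\<^bsub>B\<^esub> \<phi> x = ip (fibre E (pr E x)) x y \<odot>\<^bsub>B\<^esub> \<phi> (punit E))"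

text \<open>Meaningful only if all fibres are finite-dimensional, so that the sum is finite.\<close>

definition cuntz_representation ::
  "('p, 'm) monoid_scheme \<Rightarrow> ('p, 'e) prod_system \<Rightarrow> 'b cstar \<Rightarrow> ('e \<Rightarrow> 'b) \<Rightarrow> bool" where
  "cuntz_representation P E B \<phi> \<longleftrightarrow>
     representation E B \<phi> \<and>
     (\<forall>t\<in>carrier P. \<forall>S. orthonormal_basis (fibre E t) S \<longrightarrow>
        (\<Oplus>\<^bsub>B\<^esub> f\<in>S. \<phi> f \<otimes>\<^bsub>B\<^esub> star B (\<phi> f)) = \<phi> (punit E))"

text \<open>The universal property is tested against all C*-algebras \<open>B\<close> whose underlying set is a subset
  of the same (arbitrary) type \<open>'a\<close> as that of \<open>A\<close>, as HOL cannot quantify over all types. This is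
  no restriction: a Cuntz representation generates a separable C*-subalgebra, which has at most
  continuum many elements, whereas a type that carries a nonzero C*-algebra has at least continuum
  many. Hence, if a nonzero Cuntz representation into some C*-algebra on \<open>'a\<close> exists, each
  C*-algebra generated by a Cuntz representation has an isomorphic copy on \<open>'a\<close>.\<close>

definition cuntz_algebra ::
  "('p, 'm) monoid_scheme \<Rightarrow> ('p, 'e) prod_system \<Rightarrow> 'a cstar \<Rightarrow> ('e \<Rightarrow> 'a) \<Rightarrow> bool" where
  "cuntz_algebra P E A i \<longleftrightarrow>
     cstar_algebra A \<and> cuntz_representation P E A i \<and>
     cstar_generated A (i ` total_space E) = carrier A \<and>
     (\<forall>(B :: 'a cstar) \<phi>. cstar_algebra B \<and> cuntz_representation P E B \<phi> \<longrightarrow>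
        (\<exists>h. star_hom A B h \<and> (\<forall>x\<in>total_space E. h (i x) = \<phi> x)))"

end

theory Submission
  imports Defs
begin

text \<open>
  Fix a nonzero Cuntz representation \<open>i\<close> that generates \<open>A\<close>. The elements of \<open>i(E\<^sub>s) i(E\<^sub>t)\<^sup>*\<close>, graded by
  \<open>s t\<^sup>-\<^sup>1 \<in> G\<close>, span a dense subalgebra. If \<open>a\<close> is homogeneous with \<open>s \<noteq> t\<close>, the traces over
  orthonormal bases of \<open>E\<^sub>s\<close> and \<open>E\<^sub>t\<close> agree, \<open>\<Sum>\<^sub>k i(k)\<^sup>* a i(k) = \<Sum>\<^sub>j i(j)\<^sup>* a i(j)\<close>, although they have
  \<open>dim E\<^sub>s \<noteq> dim E\<^sub>t\<close> terms; so the average over the larger basis contracts, and a unit vector \<open>z\<close> with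
  random phases gives \<open>i(z)\<^sup>* a i(z)\<close> of strictly smaller Hilbert-Schmidt norm. Iteration compresses
  finitely many elements of nontrivial degree to almost zero. Hence every homogeneous component of a
  finite sum \<open>Y\<close> has norm at most the distance from \<open>Y\<close> to a proper closed ideal \<open>I\<close>. As \<open>G\<close> is abelian,
  \<open>(Y\<^sup>* Y)\<^sup>N\<close> has only polynomially many components, and \<open>N \<rightarrow> \<infinity>\<close> shows that \<open>Y\<close> itself satisfies this
  bound; so \<open>I = 0\<close>. For pure infiniteness, compressing \<open>x\<^sup>* x\<close> with \<open>x \<noteq> 0\<close> to a positive multiple of the
  unit yields \<open>b\<close> for which \<open>x b\<close> is an isometry.
\<close>

section \<open>Calculus in C*-algebras\<close>

text \<open>The usual route to the components of an element averages over the dual group of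
  \<open>G\<close>, but no such action is given on an algebra generated by an arbitrary nonzero
  Cuntz family, and an action need not preserve a given ideal. Compressions
  \<open>a -> z* a z\<close> by unit vectors \<open>z\<close> of the fibres take over this role:
  they fix multiples of the unit, do not increase norms, map every ideal into itself and, since
  \<open>G\<close> is abelian, preserve degrees.

  An average of compressions \<open>k* a k\<close> has these properties too. Pure infiniteness,
  however, asks for one element \<open>b\<close>, hence for a single vector \<open>z\<close>. Phases
  provide it, at the price of the off-diagonal blocks \<open>k* a l\<close>. Squared Hilbert-Schmidt
  norms are additive over these blocks, which bounds the price by a share \<open>1/d\<close> of the
  total for a fibre of dimension \<open>d\<close>.

  Everything takes place inside \<open>A\<close>: inner products of fibre vectors are multiples of
  the unit, operators between fibres are elements of \<open>A\<close>, and norms in a quotient are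
  replaced by distances to elements of the ideal.\<close>

lemma complex_field_simps [simp]:
  "carrier complex_field = UNIV"
  "a \<oplus>\<^bsub>complex_field\<^esub> b = a + b"
  "a \<otimes>\<^bsub>complex_field\<^esub> b = a * b"
  "\<one>\<^bsub>complex_field\<^esub> = 1"
  "\<zero>\<^bsub>complex_field\<^esub> = 0"
  by (simp_all add: ring_of_type_algebra_def)

lemma complex_field_minus [simp]: "\<ominus>\<^bsub>complex_field\<^esub> a = - a"
proof -
  interpret ring "complex_field"
    by (rule ring_from_type_algebra)
  have "\<ominus>\<^bsub>complex_field\<^esub> a \<oplus>\<^bsub>complex_field\<^esub> a = \<zero>\<^bsub>complex_field\<^esub>"
    by (rule l_neg) simp
  then show ?thesis
    by (simp add: eq_neg_iff_add_eq_0)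
qed

text \<open>Hilbert spaces and C*-algebras are modules over the same field, so one calculus serves
  both. The scalars range over the whole type, which removes their carrier conditions.\<close>

locale complex_space = module complex_field V for V :: "(complex, 'a, 'm) module_scheme" (structure)
begin

lemma scale_closed [simp, intro]: "x \<in> carrier V \<Longrightarrow> c \<odot> x \<in> carrier V"
  by (rule smult_closed) simp_all

lemma scale_one [simp]: "x \<in> carrier V \<Longrightarrow> 1 \<odot> x = x"
  using smult_one by simp

lemma scale_add_left: "x \<in> carrier V \<Longrightarrow> (a + b) \<odot> x = a \<odot> x \<oplus> b \<odot> x"
  using smult_l_distr[of a b x] by simp

lemma scale_add_right:
  "\<lbrakk>x \<in> carrier V; y \<in> carrier V\<rbrakk> \<Longrightarrow> a \<odot> (x \<oplus> y) = a \<odot> x \<oplus> a \<odot> y"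
  using smult_r_distr[of a x y] by simp

lemma scale_scale [simp]: "x \<in> carrier V \<Longrightarrow> a \<odot> (b \<odot> x) = (a * b) \<odot> x"
  using smult_assoc1[of a b x] by simp

lemma scale_zero_left [simp]: "x \<in> carrier V \<Longrightarrow> 0 \<odot> x = \<zero>"
  using smult_l_null by simp

lemma scale_zero_right [simp]: "c \<odot> \<zero> = \<zero>"
  using smult_r_null[of c] by simp

lemma minus_eq_scale: "x \<in> carrier V \<Longrightarrow> \<ominus> x = (-1) \<odot> x"
  using smult_l_minus[of 1 x] by simp

lemma diff_eq_scale: "x \<ominus> y = x \<oplus> (-1) \<odot> y" if "y \<in> carrier V"
  using that by (simp add: a_minus_def minus_eq_scale)

lemma diff_self [simp]: "x \<in> carrier V \<Longrightarrow> x \<ominus> x = \<zero>"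
  by (simp add: a_minus_def M.r_neg)

lemma diff_zero [simp]: "x \<in> carrier V \<Longrightarrow> x \<ominus> \<zero> = x"
  by (simp add: a_minus_def)

lemma diff_eq_zero_iff:
  "\<lbrakk>x \<in> carrier V; y \<in> carrier V\<rbrakk> \<Longrightarrow> x \<ominus> y = \<zero> \<longleftrightarrow> x = y"
  by (metis a_minus_def M.add.inv_closed M.add.inv_inv M.minus_equality M.a_comm M.r_neg)

lemma diff_add_cancel [simp]:
  "\<lbrakk>x \<in> carrier V; y \<in> carrier V\<rbrakk> \<Longrightarrow> (x \<ominus> y) \<oplus> y = x"
  by (simp add: a_minus_def M.a_assoc M.l_neg)

lemma diff_swap:
  "\<lbrakk>x \<in> carrier V; y \<in> carrier V\<rbrakk> \<Longrightarrow> y \<ominus> x = \<ominus> (x \<ominus> y)"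
  by (simp add: a_minus_def M.minus_add M.a_comm)

lemma diff_diff_split:
  "\<lbrakk>x \<in> carrier V; y \<in> carrier V; z \<in> carrier V\<rbrakk>
    \<Longrightarrow> x \<ominus> z = (x \<ominus> y) \<oplus> (y \<ominus> z)"
  by (simp add: a_minus_def M.a_assoc M.r_neg1)

lemma diff_diff_cancel [simp]:
  "\<lbrakk>x \<in> carrier V; y \<in> carrier V\<rbrakk> \<Longrightarrow> x \<ominus> (x \<ominus> y) = y"
  by (simp add: a_minus_def M.minus_add M.r_neg2)

lemma diff_add_add:
  "\<lbrakk>x \<in> carrier V; y \<in> carrier V; x' \<in> carrier V; y' \<in> carrier V\<rbrakk>
    \<Longrightarrow> (x \<oplus> y) \<ominus> (x' \<oplus> y') = (x \<ominus> x') \<oplus> (y \<ominus> y')"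
  by (simp add: a_minus_def M.a_assoc M.minus_add M.a_lcomm)

lemma scale_diff:
  "\<lbrakk>x \<in> carrier V; y \<in> carrier V\<rbrakk> \<Longrightarrow> a \<odot> (x \<ominus> y) = a \<odot> x \<ominus> a \<odot> y"
  by (simp add: diff_eq_scale scale_add_right)

lemma scale_diff_left:
  "x \<in> carrier V \<Longrightarrow> (a - b) \<odot> x = a \<odot> x \<ominus> b \<odot> x"
  by (simp add: diff_eq_scale flip: scale_add_left)

lemma sum_closed [simp, intro]:
  "(\<And>i. i \<in> I \<Longrightarrow> f i \<in> carrier V) \<Longrightarrow> finsum V f I \<in> carrier V"
  by (rule M.finsum_closed) auto

lemma sum_cong:
  "\<lbrakk>I = J; \<And>i. i \<in> J \<Longrightarrow> f i = g i; \<And>i. i \<in> J \<Longrightarrow> g i \<in> carrier V\<rbrakk>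
    \<Longrightarrow> finsum V f I = finsum V g J"
  by (rule M.finsum_cong') auto

lemma sum_insert:
  "\<lbrakk>finite I; i \<notin> I; f i \<in> carrier V; \<And>j. j \<in> I \<Longrightarrow> f j \<in> carrier V\<rbrakk>
    \<Longrightarrow> finsum V f (insert i I) = f i \<oplus> finsum V f I"
  by (rule M.finsum_insert) auto

lemma submodule_zero: "submodule W complex_field V \<Longrightarrow> \<zero> \<in> W"
  using subgroup.one_closed[OF submodule.axioms(1)] by fastforce

lemma submodule_diff:
  "\<lbrakk>submodule W complex_field V; x \<in> W; y \<in> W\<rbrakk> \<Longrightarrow> x \<ominus> y \<in> W"
  unfolding a_minus_def using submoduleE[of W] by blast

lemma submodule_scale:
  "\<lbrakk>submodule W complex_field V; x \<in> W\<rbrakk> \<Longrightarrow> c \<odot> x \<in> W"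
  using submoduleE(4)[of W c x] by simp

lemma sum_in_submodule:
  assumes "submodule W complex_field V" "\<And>i. i \<in> I \<Longrightarrow> f i \<in> W"
  shows "finsum V f I \<in> W"
  using assms(2)
proof (induction I rule: infinite_finite_induct)
  case (insert i I)
  have W: "f j \<in> carrier V" if "j \<in> insert i I" for j
    using insert.prems[OF that] submoduleE(1)[OF assms(1)] by blast
  have "finsum V f (insert i I) = f i \<oplus> finsum V f I"
    using insert.hyps W by (intro sum_insert) auto
  also have "\<dots> \<in> W"
    using insert by (intro submoduleE(5)[OF assms(1)]) auto
  finally show ?case .
qed (simp_all add: submodule_zero[OF assms(1)])

text \<open>Additivity alone is assumed, so that the conjugate linear adjoint is covered together
  with multiplication from either side; \<open>h \<zero> = \<zero>\<close> follows by cancellation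
  in the target. An infinite index set makes both sums \<open>\<zero>\<close>.\<close>

lemma sum_hom:
  assumes "complex_space W" and "\<And>x. x \<in> carrier V \<Longrightarrow> h x \<in> carrier W"
    and add: "\<And>x y. \<lbrakk>x \<in> carrier V; y \<in> carrier V\<rbrakk> \<Longrightarrow> h (x \<oplus> y) = h x \<oplus>\<^bsub>W\<^esub> h y"
    and f: "\<And>i. i \<in> I \<Longrightarrow> f i \<in> carrier V"
  shows "h (finsum V f I) = finsum W (\<lambda>i. h (f i)) I"
proof -
  interpret W: complex_space W by fact
  have "h \<zero> = h \<zero> \<oplus>\<^bsub>W\<^esub> h \<zero>"
    using add[of "\<zero>" "\<zero>"] by simp
  then have 0: "h \<zero> = \<zero>\<^bsub>W\<^esub>"
    using assms(2) by (metis M.zero_closed W.M.add.r_cancel_one')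
  show ?thesis
    using f
  proof (induction I rule: infinite_finite_induct)
    case (insert i I)
    then show ?case
      by (simp add: sum_insert W.sum_insert assms(2) add)
  qed (simp_all add: 0)
qed

lemma sum_delta:
  assumes "finite I" "k \<in> I" "\<And>i. i \<in> I \<Longrightarrow> f i \<in> carrier V"
  shows "(\<Oplus>i\<in>I. if i = k then f i else \<zero>) = f k"
  using assms by (intro M.add.finprod_singleton_swap) auto

lemma sum_swap:
  assumes "finite I" "finite J" "\<And>i j. \<lbrakk>i \<in> I; j \<in> J\<rbrakk> \<Longrightarrow> f i j \<in> carrier V"
  shows "(\<Oplus>i\<in>I. \<Oplus>j\<in>J. f i j) = (\<Oplus>j\<in>J. \<Oplus>i\<in>I. f i j)"
  using assms(1,3)
proof (induction I)
  case empty
  then show ?case by simp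
next
  case (insert i I)
  have "(\<Oplus>j\<in>J. \<Oplus>i\<in>insert i I. f i j) = (\<Oplus>j\<in>J. f i j \<oplus> (\<Oplus>i\<in>I. f i j))"
    using insert by (intro sum_cong) (auto simp: sum_insert)
  also have "\<dots> = (\<Oplus>j\<in>J. f i j) \<oplus> (\<Oplus>j\<in>J. \<Oplus>i\<in>I. f i j)"
    using insert by (intro M.finsum_addf) auto
  also have "\<dots> = (\<Oplus>i\<in>insert i I. \<Oplus>j\<in>J. f i j)"
    using insert by (subst sum_insert) auto
  finally show ?case ..
qed

lemma sum_scale_const:
  assumes "finite I" "x \<in> carrier V"
  shows "(\<Oplus>i\<in>I. g i \<odot> x) = (\<Sum>i\<in>I. g i) \<odot> x"
  using assms by (induction I) (simp_all add: sum_insert scale_add_left)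

end

sublocale hilbert_space \<subseteq> complex_space H
  by unfold_locales

sublocale cstar_algebra \<subseteq> complex_space A
  by unfold_locales

context cstar_algebra
begin

abbreviation adjoint ("_\<^sup>\<star>" [1000] 1000) where "x\<^sup>\<star> \<equiv> star A x"
abbreviation norm_of ("\<parallel>_\<parallel>") where "\<parallel>x\<parallel> \<equiv> nrm A x"

lemmas [simp, intro] = mult_closed star_closed
lemmas [simp] = star_star

lemma mult_zero_left [simp]: "x \<in> carrier A \<Longrightarrow> \<zero> \<otimes> x = \<zero>"
  using smult_mult_left[of "\<zero>" x 0] by simp

lemma mult_zero_right [simp]: "x \<in> carrier A \<Longrightarrow> x \<otimes> \<zero> = \<zero>"
  using smult_mult_right[of x "\<zero>" 0] by simp

lemma star_zero [simp]: "\<zero>\<^sup>\<star> = \<zero>"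
  using star_smult[of "\<zero>" 0] by simp

lemma star_diff:
  "\<lbrakk>x \<in> carrier A; y \<in> carrier A\<rbrakk> \<Longrightarrow> (x \<ominus> y)\<^sup>\<star> = x\<^sup>\<star> \<ominus> y\<^sup>\<star>"
  by (simp add: diff_eq_scale star_add star_smult)

lemma mult_diff_left:
  "\<lbrakk>x \<in> carrier A; y \<in> carrier A; z \<in> carrier A\<rbrakk> \<Longrightarrow> (x \<ominus> y) \<otimes> z = x \<otimes> z \<ominus> y \<otimes> z"
  by (simp add: diff_eq_scale distrib_right smult_mult_left)

lemma mult_diff_right:
  "\<lbrakk>x \<in> carrier A; y \<in> carrier A; z \<in> carrier A\<rbrakk> \<Longrightarrow> x \<otimes> (y \<ominus> z) = x \<otimes> y \<ominus> x \<otimes> z"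
  by (simp add: diff_eq_scale distrib_left smult_mult_right)

lemma nrm_zero [simp]: "\<parallel>\<zero>\<parallel> = 0"
  by (simp add: nrm_eq_0)

lemma nrm_minus [simp]: "x \<in> carrier A \<Longrightarrow> \<parallel>\<ominus> x\<parallel> = \<parallel>x\<parallel>"
  by (simp add: minus_eq_scale nrm_smult)

lemma nrm_diff_commute:
  "\<lbrakk>x \<in> carrier A; y \<in> carrier A\<rbrakk> \<Longrightarrow> \<parallel>x \<ominus> y\<parallel> = \<parallel>y \<ominus> x\<parallel>"
  by (simp add: diff_swap[of x y])

lemma nrm_diff_triangle:
  "\<lbrakk>x \<in> carrier A; y \<in> carrier A; z \<in> carrier A\<rbrakk> \<Longrightarrow> \<parallel>x \<ominus> z\<parallel> \<le> \<parallel>x \<ominus> y\<parallel> + \<parallel>y \<ominus> z\<parallel>"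
  using diff_diff_split[of x y z] nrm_triangle[of "x \<ominus> y" "y \<ominus> z"] by simp

lemma nrm_le_diff_add:
  "\<lbrakk>x \<in> carrier A; y \<in> carrier A\<rbrakk> \<Longrightarrow> \<parallel>x\<parallel> \<le> \<parallel>x \<ominus> y\<parallel> + \<parallel>y\<parallel>"
  using nrm_diff_triangle[of x y "\<zero>"] by simp

lemma nrm_star [simp]: assumes "x \<in> carrier A" shows "\<parallel>x\<^sup>\<star>\<parallel> = \<parallel>x\<parallel>"
proof -
  have *: "\<parallel>x\<parallel> \<le> \<parallel>x\<^sup>\<star>\<parallel>" if "x \<in> carrier A" for x
  proof (cases "\<parallel>x\<parallel> = 0")
    case False
    have "\<parallel>x\<parallel> * \<parallel>x\<parallel> \<le> \<parallel>x\<^sup>\<star>\<parallel> * \<parallel>x\<parallel>"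
      using nrm_star_mult[OF that] nrm_mult[of "x\<^sup>\<star>" x] that by (simp add: power2_eq_square)
    then show ?thesis
      using False nrm_nonneg[OF that] by simp
  qed (use that nrm_nonneg in simp)
  show ?thesis
    using *[of x] *[of "x\<^sup>\<star>"] assms by simp
qed

lemma sum_mult_right:
  "\<lbrakk>y \<in> carrier A; \<And>i. i \<in> I \<Longrightarrow> f i \<in> carrier A\<rbrakk> \<Longrightarrow> (\<Oplus>i\<in>I. f i) \<otimes> y = (\<Oplus>i\<in>I. f i \<otimes> y)"
  by (rule sum_hom) (auto simp: distrib_right complex_space_axioms)

lemma sum_mult_left:
  "\<lbrakk>y \<in> carrier A; \<And>i. i \<in> I \<Longrightarrow> f i \<in> carrier A\<rbrakk> \<Longrightarrow> y \<otimes> (\<Oplus>i\<in>I. f i) = (\<Oplus>i\<in>I. y \<otimes> f i)"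
  by (rule sum_hom) (auto simp: distrib_left complex_space_axioms)

lemma star_sum:
  "(\<And>i. i \<in> I \<Longrightarrow> f i \<in> carrier A) \<Longrightarrow> (\<Oplus>i\<in>I. f i)\<^sup>\<star> = (\<Oplus>i\<in>I. (f i)\<^sup>\<star>)"
  by (rule sum_hom) (auto simp: star_add complex_space_axioms)

lemma nrm_sum_le:
  "(\<And>i. i \<in> I \<Longrightarrow> f i \<in> carrier A) \<Longrightarrow> \<parallel>\<Oplus>i\<in>I. f i\<parallel> \<le> (\<Sum>i\<in>I. \<parallel>f i\<parallel>)"
proof (induction I rule: infinite_finite_induct)
  case (insert i I)
  then show ?case
    using nrm_triangle[of "f i" "finsum A f I"] by (simp add: sum_insert)
qed auto

subsection \<open>Limits\<close>

sublocale Met: Metric_space "carrier A" "norm_dist A (nrm A)"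
proof
  show "0 \<le> norm_dist A (nrm A) x y" for x y
    by (simp add: norm_dist_def nrm_nonneg)
  show "norm_dist A (nrm A) x y = norm_dist A (nrm A) y x" for x y
    by (simp add: norm_dist_def nrm_diff_commute)
  show "norm_dist A (nrm A) x y = 0 \<longleftrightarrow> x = y" if "x \<in> carrier A" "y \<in> carrier A" for x y
    using that by (simp add: norm_dist_def nrm_eq_0 diff_eq_zero_iff)
  show "norm_dist A (nrm A) x z \<le> norm_dist A (nrm A) x y + norm_dist A (nrm A) y z"
    if "x \<in> carrier A" "y \<in> carrier A" "z \<in> carrier A" for x y z
    using that by (simp add: norm_dist_def nrm_diff_triangle)
qed

lemma closedin_iff:
  "closedin (norm_topology A (nrm A)) S \<longleftrightarrow>
     S \<subseteq> carrier A \<and> (\<forall>x\<in>carrier A. (\<forall>\<epsilon>>0. \<exists>y\<in>S. \<parallel>x \<ominus> y\<parallel> < \<epsilon>) \<longrightarrow> x \<in> S)" (is "?L \<longleftrightarrow> ?R")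
proof
  assume L: ?L
  then have S: "S \<subseteq> carrier A"
    by (auto simp: norm_topology_def Met.closedin_metric)
  have "x \<in> S" if x: "x \<in> carrier A" and *: "\<forall>\<epsilon>>0. \<exists>y\<in>S. \<parallel>x \<ominus> y\<parallel> < \<epsilon>" for x
  proof (rule ccontr)
    assume "x \<notin> S"
    then obtain r where r: "r > 0" "disjnt S (Met.mball x r)"
      using L x by (auto simp: norm_topology_def Met.closedin_metric)
    then obtain y where "y \<in> S" "\<parallel>x \<ominus> y\<parallel> < r"
      using * by blast
    then have "y \<in> Met.mball x r"
      using x S by (auto simp: norm_dist_def)
    with r \<open>y \<in> S\<close> show False
      by (auto simp: disjnt_iff)
  qed
  with S show ?R by blast
next
  assume R: ?R
  have "\<exists>r>0. disjnt S (Met.mball x r)" if x: "x \<in> carrier A" "x \<notin> S" for x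
  proof -
    have "\<not> (\<forall>\<epsilon>>0. \<exists>y\<in>S. \<parallel>x \<ominus> y\<parallel> < \<epsilon>)"
      using R x by blast
    then obtain \<epsilon> where \<epsilon>: "\<epsilon> > 0" "\<And>y. y \<in> S \<Longrightarrow> \<not> \<parallel>x \<ominus> y\<parallel> < \<epsilon>"
      by blast
    then have "y \<notin> Met.mball x \<epsilon>" if "y \<in> S" for y
      using that by (auto simp: norm_dist_def)
    with \<open>\<epsilon> > 0\<close> show ?thesis
      unfolding disjnt_iff by blast
  qed
  with R show ?L
    by (auto simp: norm_topology_def Met.closedin_metric)
qed

lemma geometric_limit:
  assumes x: "\<And>n. x n \<in> carrier A"
    and step: "\<And>n. \<parallel>x (Suc n) \<ominus> x n\<parallel> \<le> C * (1/2) ^ n"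
  obtains l where "l \<in> carrier A" "\<And>\<epsilon>. \<epsilon> > 0 \<Longrightarrow> \<exists>n0. \<forall>n\<ge>n0. \<parallel>x n \<ominus> l\<parallel> < \<epsilon>"
proof -
  \<comment> \<open>The factor \<open>1 - (1/2)^k\<close> lets the induction close; the plain bound
    \<open>2 C (1/2)^n\<close> does not reproduce itself under one more step.\<close>
  have tail: "\<parallel>x (n + k) \<ominus> x n\<parallel> \<le> 2 * C * (1/2) ^ n * (1 - (1/2) ^ k)" for n k
  proof (induction k)
    case (Suc k)
    have "\<parallel>x (n + Suc k) \<ominus> x n\<parallel> \<le> \<parallel>x (Suc (n + k)) \<ominus> x (n + k)\<parallel> + \<parallel>x (n + k) \<ominus> x n\<parallel>"
      using nrm_diff_triangle x by simp
    also have "\<dots> \<le> C * (1/2) ^ (n + k) + 2 * C * (1/2) ^ n * (1 - (1/2) ^ k)"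
      using step Suc by (intro add_mono)
    also have "\<dots> = 2 * C * (1/2) ^ n * (1 - (1/2) ^ Suc k)"
      by (simp add: power_add algebra_simps)
    finally show ?case .
  qed (simp add: x)
  have "C \<ge> 0"
    using step[of 0] nrm_nonneg[of "x (Suc 0) \<ominus> x 0"] x by simp
  have tail: "\<parallel>x m \<ominus> x n\<parallel> \<le> 2 * C * (1/2) ^ n" if "n \<le> m" for m n
  proof -
    have "\<parallel>x m \<ominus> x n\<parallel> \<le> 2 * C * (1/2) ^ n * (1 - (1/2) ^ (m - n))"
      using tail[of n "m - n"] that by simp
    also have "\<dots> \<le> 2 * C * (1/2) ^ n * 1"
      using \<open>C \<ge> 0\<close> by (intro mult_left_mono) auto
    finally show ?thesis by simp
  qed
  have small: "\<exists>n0. 2 * C * (1/2) ^ n0 < \<epsilon>" if "\<epsilon> > 0" for \<epsilon> :: real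
  proof -
    have "(\<lambda>n. 2 * C * (1/2) ^ n) \<longlonglongrightarrow> 2 * C * 0"
      by (intro tendsto_intros LIMSEQ_power_zero) simp
    then have "eventually (\<lambda>n. 2 * C * (1/2) ^ n < \<epsilon>) sequentially"
      using that by (intro order_tendstoD) auto
    then show ?thesis
      by (auto simp: eventually_sequentially)
  qed
  have "Met.MCauchy x"
    unfolding Met.MCauchy_def
  proof (intro conjI allI impI)
    show "range x \<subseteq> carrier A"
      using x by auto
    fix \<epsilon> :: real assume "\<epsilon> > 0"
    then obtain n0 where n0: "2 * C * (1/2) ^ n0 < \<epsilon>"
      using small by blast
    have small': "\<parallel>x n \<ominus> x m\<parallel> < \<epsilon>" if "n0 \<le> n" "n \<le> m" for n m
    proof -
      have "\<parallel>x n \<ominus> x m\<parallel> \<le> 2 * C * (1/2) ^ n"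
        using tail[OF that(2)] nrm_diff_commute x by simp
      also have "\<dots> \<le> 2 * C * (1/2) ^ n0"
        using \<open>C \<ge> 0\<close> that by (intro mult_left_mono power_decreasing) auto
      finally show ?thesis using n0 by simp
    qed
    have "norm_dist A (nrm A) (x n) (x m) < \<epsilon>" if "n0 \<le> n" "n0 \<le> m" for n m
    proof (cases "n \<le> m")
      case True
      with that small' x show ?thesis
        by (simp add: norm_dist_def)
    next
      case False
      with that small'[of m n] x nrm_diff_commute[of "x n" "x m"] show ?thesis
        by (simp add: norm_dist_def)
    qed
    then show "\<exists>N. \<forall>n n'. N \<le> n \<longrightarrow> N \<le> n' \<longrightarrow> norm_dist A (nrm A) (x n) (x n') < \<epsilon>"
      by blast
  qed
  moreover have "Met.mcomplete"
    using complete by (simp add: norm_complete_def)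
  ultimately obtain l where "limitin Met.mtopology x l sequentially"
    unfolding Met.mcomplete_def by blast
  then have l: "l \<in> carrier A" "\<And>\<epsilon>. \<epsilon> > 0 \<Longrightarrow> \<exists>n0. \<forall>n\<ge>n0. \<parallel>x n \<ominus> l\<parallel> < \<epsilon>"
    by (auto simp: Met.limit_metric_sequentially norm_dist_def x)
  then show thesis
    using that by blast
qed

text \<open>Iterating \<open>F\<close> from \<open>x0\<close> gives geometrically decreasing steps,
  and completeness gives the limit. Square roots and inverses below are fixed points of this kind;
  there \<open>C\<close> is a ball of self-adjoint elements or the whole algebra.\<close>

lemma contraction_fixed_point:
  assumes C: "C \<subseteq> carrier A" "x0 \<in> C"
    and closed: "\<And>x. \<lbrakk>x \<in> carrier A; \<And>\<epsilon>. \<epsilon> > 0 \<Longrightarrow> \<exists>y\<in>C. \<parallel>y \<ominus> x\<parallel> < \<epsilon>\<rbrakk> \<Longrightarrow> x \<in> C"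
    and F: "\<And>x. x \<in> C \<Longrightarrow> F x \<in> C"
    and contr: "\<And>x y. \<lbrakk>x \<in> C; y \<in> C\<rbrakk> \<Longrightarrow> \<parallel>F x \<ominus> F y\<parallel> \<le> \<parallel>x \<ominus> y\<parallel> / 2"
  obtains x where "x \<in> C" "F x = x"
proof -
  define x where "x n = (F ^^ n) x0" for n
  have xC: "x n \<in> C" for n
    by (induction n) (auto simp: x_def C F)
  then have x: "x n \<in> carrier A" for n
    using C by auto
  have step: "\<parallel>x (Suc n) \<ominus> x n\<parallel> \<le> \<parallel>x 1 \<ominus> x 0\<parallel> * (1/2) ^ n" for n
  proof (induction n)
    case (Suc n)
    have "\<parallel>x (Suc (Suc n)) \<ominus> x (Suc n)\<parallel> \<le> \<parallel>x (Suc n) \<ominus> x n\<parallel> / 2"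
      using contr[OF xC[of "Suc n"] xC[of n]] by (simp add: x_def)
    also have "\<dots> \<le> \<parallel>x 1 \<ominus> x 0\<parallel> * (1/2) ^ Suc n"
      using Suc by simp
    finally show ?case .
  qed simp
  obtain l where l: "l \<in> carrier A" and lim: "\<And>\<epsilon>. \<epsilon> > 0 \<Longrightarrow> \<exists>n0. \<forall>n\<ge>n0. \<parallel>x n \<ominus> l\<parallel> < \<epsilon>"
    using geometric_limit[OF x step] by blast
  have lC: "l \<in> C"
    using lim xC by (intro closed l) blast
  then have Fl: "F l \<in> carrier A"
    using F C by auto
  have "\<parallel>F l \<ominus> l\<parallel> \<le> 0"
  proof (rule field_le_epsilon)
    fix \<epsilon> :: real assume "\<epsilon> > 0"
    then obtain n0 where n0: "\<And>n. n \<ge> n0 \<Longrightarrow> \<parallel>x n \<ominus> l\<parallel> < \<epsilon> / 2"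
      using lim[of "\<epsilon> / 2"] by auto
    have "\<parallel>F l \<ominus> l\<parallel> \<le> \<parallel>F l \<ominus> x (Suc n0)\<parallel> + \<parallel>x (Suc n0) \<ominus> l\<parallel>"
      by (rule nrm_diff_triangle[OF Fl x l])
    also have "\<parallel>F l \<ominus> x (Suc n0)\<parallel> \<le> \<parallel>l \<ominus> x n0\<parallel> / 2"
      using contr[OF lC xC[of n0]] by (simp add: x_def)
    also have "\<parallel>l \<ominus> x n0\<parallel> = \<parallel>x n0 \<ominus> l\<parallel>"
      by (rule nrm_diff_commute[OF l x])
    finally show "\<parallel>F l \<ominus> l\<parallel> \<le> 0 + \<epsilon>"
      using n0[of n0] n0[of "Suc n0"] nrm_nonneg[of "x n0 \<ominus> l"] x l by fastforce
  qed
  then have "F l = l"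
    using Fl l nrm_nonneg[of "F l \<ominus> l"] by (simp add: nrm_eq_0 diff_eq_zero_iff)
  with lC that show thesis by blast
qed

end

text \<open>If \<open>q = x / m > 1\<close>, then \<open>q^(2^k)\<close> outgrows every polynomial
  in \<open>2^k\<close>. Only powers of two occur as exponents because powers are formed by iterated
  squaring, where the C*-identity is exact. The lemma frees a norm estimate from a factor that grows
  at most polynomially in the exponent.\<close>

lemma le_if_powers_le:
  fixes x m C :: real
  assumes x: "0 \<le> x" and m: "0 \<le> m"
    and le: "\<And>k. x ^ (2 ^ k) \<le> C * (2 ^ k + 1) ^ p * m ^ (2 ^ k)"
  shows "x \<le> m"
proof (rule ccontr)
  assume "\<not> x \<le> m"
  show False
  proof (cases "m = 0")
    case True
    then show False
      using le[of 0] \<open>\<not> x \<le> m\<close> by simp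
  next
    case False
    with m have m: "m > 0" by simp
    define q where "q = x / m"
    have q: "q > 1"
      using m \<open>\<not> x \<le> m\<close> by (simp add: q_def)
    have C: "C \<ge> 0"
    proof -
      have "0 \<le> x ^ (2 ^ 0)"
        using x by simp
      also have "\<dots> \<le> C * (2 ^ 0 + 1) ^ p * m ^ (2 ^ 0)"
        by (rule le)
      finally have "0 \<le> C * (2 ^ p * m)" by (simp add: mult.assoc)
      moreover have "0 < 2 ^ p * m"
        using m by simp
      ultimately show ?thesis
        by (simp only: zero_le_mult_iff) linarith
    qed
    have "filterlim (\<lambda>k. 2 ^ k :: real) at_top sequentially"
      by (rule filterlim_at_top_mono[OF filterlim_real_sequentially])
        (auto intro!: always_eventually less_imp_le of_nat_less_two_power)
    then have "filterlim (\<lambda>k. ln q * 2 ^ k) at_top sequentially"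
      using q by (intro filterlim_tendsto_pos_mult_at_top[OF tendsto_const]) auto
    then have "((\<lambda>k. (ln q * 2 ^ k) ^ p / exp (ln q * 2 ^ k)) \<longlongrightarrow> 0) sequentially"
      by (rule filterlim_compose[OF tendsto_power_div_exp_0])
    then have "((\<lambda>k. C * (2 / ln q) ^ p * ((ln q * 2 ^ k) ^ p / exp (ln q * 2 ^ k))) \<longlongrightarrow> C * (2 / ln q) ^ p * 0) sequentially"
      by (intro tendsto_intros)
    then have "eventually (\<lambda>k. C * (2 / ln q) ^ p * ((ln q * 2 ^ k) ^ p / exp (ln q * 2 ^ k)) < 1) sequentially"
      by (intro order_tendstoD) auto
    then obtain k where k: "C * (2 / ln q) ^ p * ((ln q * 2 ^ k) ^ p / exp (ln q * 2 ^ k)) < 1"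
      by (auto simp: eventually_sequentially)
    have "exp (ln q * 2 ^ k) = q ^ (2 ^ k)"
      using q exp_of_nat_mult[of "2 ^ k" "ln q"] by (simp add: mult.commute)
    with k have "C * (2 / ln q) ^ p * (ln q * 2 ^ k) ^ p < q ^ (2 ^ k)"
      using q unfolding times_divide_eq_right by (subst (asm) pos_divide_less_eq) auto
    moreover have "(2 / ln q) ^ p * (ln q * 2 ^ k) ^ p = (2 * 2 ^ k) ^ p"
      using q unfolding power_mult_distrib[symmetric] by simp
    ultimately have "C * (2 * 2 ^ k) ^ p < q ^ (2 ^ k)"
      by (simp add: mult.assoc)
    moreover have "C * (2 ^ k + 1) ^ p \<le> C * (2 * 2 ^ k) ^ p"
      using C by (intro mult_left_mono power_mono) auto
    moreover have "q ^ (2 ^ k) \<le> C * (2 ^ k + 1) ^ p"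
      using le[of k] m by (simp add: q_def power_divide divide_le_eq)
    ultimately show False by simp
  qed
qed

section \<open>Norm estimates, subalgebras and ideals\<close>

context cstar_algebra
begin

lemma mult_diff_mult:
  assumes "x \<in> carrier A" "x' \<in> carrier A" "y \<in> carrier A" "y' \<in> carrier A"
  shows "x \<otimes> x' \<ominus> y \<otimes> y' = x \<otimes> (x' \<ominus> y') \<oplus> (x \<ominus> y) \<otimes> y'"
  using assms diff_diff_split[of "x \<otimes> x'" "x \<otimes> y'" "y \<otimes> y'"]
  by (simp add: mult_diff_left mult_diff_right)

lemma nrm_mult_diff_le:
  assumes "x \<in> carrier A" "x' \<in> carrier A" "y \<in> carrier A" "y' \<in> carrier A"
  shows "\<parallel>x \<otimes> x' \<ominus> y \<otimes> y'\<parallel> \<le> \<parallel>x\<parallel> * \<parallel>x' \<ominus> y'\<parallel> + \<parallel>x \<ominus> y\<parallel> * \<parallel>y'\<parallel>"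
proof -
  have "\<parallel>x \<otimes> x' \<ominus> y \<otimes> y'\<parallel> \<le> \<parallel>x \<otimes> (x' \<ominus> y')\<parallel> + \<parallel>(x \<ominus> y) \<otimes> y'\<parallel>"
    using assms by (simp add: mult_diff_mult nrm_triangle)
  also have "\<dots> \<le> \<parallel>x\<parallel> * \<parallel>x' \<ominus> y'\<parallel> + \<parallel>x \<ominus> y\<parallel> * \<parallel>y'\<parallel>"
    using assms by (intro add_mono nrm_mult) auto
  finally show ?thesis .
qed

lemma nrm_mult3_le:
  assumes "x \<in> carrier A" "y \<in> carrier A" "z \<in> carrier A"
  shows "\<parallel>x \<otimes> (y \<otimes> z)\<parallel> \<le> \<parallel>x\<parallel> * \<parallel>y\<parallel> * \<parallel>z\<parallel>"
proof -
  have "\<parallel>x \<otimes> (y \<otimes> z)\<parallel> \<le> \<parallel>x\<parallel> * \<parallel>y \<otimes> z\<parallel>"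
    using assms by (simp add: nrm_mult)
  also have "\<dots> \<le> \<parallel>x\<parallel> * (\<parallel>y\<parallel> * \<parallel>z\<parallel>)"
    using assms by (intro mult_left_mono nrm_mult nrm_nonneg)
  finally show ?thesis by simp
qed

text \<open>For self-adjoint \<open>y\<close> the C*-identity reads
  \<open>||y y|| = ||y||^2\<close>, so the norms of the powers \<open>x^(2^k)\<close> are known
  exactly without the spectral radius. For other elements only the inequality of the next lemma
  remains.\<close>

lemma nrm_iterated_square:
  assumes "x \<in> carrier A" "x\<^sup>\<star> = x"
  shows "((\<lambda>y. y \<otimes> y) ^^ k) x \<in> carrier A \<and> (((\<lambda>y. y \<otimes> y) ^^ k) x)\<^sup>\<star> = ((\<lambda>y. y \<otimes> y) ^^ k) x \<and>
    \<parallel>((\<lambda>y. y \<otimes> y) ^^ k) x\<parallel> = \<parallel>x\<parallel> ^ (2 ^ k)"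
proof (induction k)
  case (Suc k)
  then show ?case
    using nrm_star_mult[of "((\<lambda>y. y \<otimes> y) ^^ k) x"]
    by (simp add: star_mult power_mult mult.commute[of 2])
qed (use assms in simp)

lemma nrm_iterated_square_le:
  assumes "x \<in> carrier A"
  shows "((\<lambda>y. y \<otimes> y) ^^ k) x \<in> carrier A \<and> \<parallel>((\<lambda>y. y \<otimes> y) ^^ k) x\<parallel> \<le> \<parallel>x\<parallel> ^ (2 ^ k)"
proof (induction k)
  case (Suc k)
  let ?y = "((\<lambda>y. y \<otimes> y) ^^ k) x"
  have "\<parallel>?y \<otimes> ?y\<parallel> \<le> \<parallel>?y\<parallel> * \<parallel>?y\<parallel>"
    using Suc by (simp add: nrm_mult)
  also have "\<dots> \<le> \<parallel>x\<parallel> ^ (2 ^ k) * \<parallel>x\<parallel> ^ (2 ^ k)"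
    using Suc nrm_nonneg assms by (intro mult_mono) auto
  finally show ?case
    using Suc by (simp add: power_mult power2_eq_square mult.commute[of 2])
qed (use assms in simp)

lemma cstar_subalgebraI:
  assumes "S \<subseteq> carrier A" "\<zero> \<in> S"
    and "\<And>x y. \<lbrakk>x \<in> S; y \<in> S\<rbrakk> \<Longrightarrow> x \<oplus> y \<in> S" "\<And>c x. x \<in> S \<Longrightarrow> c \<odot> x \<in> S"
    and "\<And>x y. \<lbrakk>x \<in> S; y \<in> S\<rbrakk> \<Longrightarrow> x \<otimes> y \<in> S" "\<And>x. x \<in> S \<Longrightarrow> x\<^sup>\<star> \<in> S"
    and "\<And>x. \<lbrakk>x \<in> carrier A; \<forall>\<epsilon>>0. \<exists>y\<in>S. \<parallel>x \<ominus> y\<parallel> < \<epsilon>\<rbrakk> \<Longrightarrow> x \<in> S"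
  shows "cstar_subalgebra S A"
  unfolding cstar_subalgebra_def closedin_iff
proof (intro conjI ballI impI)
  show "submodule S complex_field A"
    using assms(1-4) by (intro submoduleI) (auto simp: minus_eq_scale subset_iff)
qed (use assms in auto)

lemma closed_idealI:
  assumes "I \<subseteq> carrier A" "\<zero> \<in> I"
    and "\<And>x y. \<lbrakk>x \<in> I; y \<in> I\<rbrakk> \<Longrightarrow> x \<oplus> y \<in> I" "\<And>c x. x \<in> I \<Longrightarrow> c \<odot> x \<in> I"
    and "\<And>a x. \<lbrakk>a \<in> carrier A; x \<in> I\<rbrakk> \<Longrightarrow> a \<otimes> x \<in> I" "\<And>a x. \<lbrakk>a \<in> carrier A; x \<in> I\<rbrakk> \<Longrightarrow> x \<otimes> a \<in> I"
    and "\<And>x. \<lbrakk>x \<in> carrier A; \<forall>\<epsilon>>0. \<exists>y\<in>I. \<parallel>x \<ominus> y\<parallel> < \<epsilon>\<rbrakk> \<Longrightarrow> x \<in> I"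
  shows "closed_ideal I A"
  unfolding closed_ideal_def closedin_iff
proof (intro conjI ballI impI)
  show "submodule I complex_field A"
    using assms(1-4) by (intro submoduleI) (auto simp: minus_eq_scale subset_iff)
qed (use assms in auto)

lemma closed_idealD:
  assumes "closed_ideal I A"
  shows "submodule I complex_field A" "I \<subseteq> carrier A"
    and "\<And>a x. \<lbrakk>a \<in> carrier A; x \<in> I\<rbrakk> \<Longrightarrow> a \<otimes> x \<in> I" "\<And>a x. \<lbrakk>a \<in> carrier A; x \<in> I\<rbrakk> \<Longrightarrow> x \<otimes> a \<in> I"
    and "\<And>x y. \<lbrakk>x \<in> I; y \<in> I\<rbrakk> \<Longrightarrow> x \<oplus> y \<in> I" "\<And>x y. \<lbrakk>x \<in> I; y \<in> I\<rbrakk> \<Longrightarrow> x \<ominus> y \<in> I" "\<And>c x. x \<in> I \<Longrightarrow> c \<odot> x \<in> I"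
    and "\<And>x. \<lbrakk>x \<in> carrier A; \<forall>\<epsilon>>0. \<exists>y\<in>I. \<parallel>x \<ominus> y\<parallel> < \<epsilon>\<rbrakk> \<Longrightarrow> x \<in> I"
proof -
  show sub: "submodule I complex_field A"
    using assms by (simp add: closed_ideal_def)
  show "x \<oplus> y \<in> I" if "x \<in> I" "y \<in> I" for x y
    using submoduleE(5)[OF sub] that by blast
  show "x \<ominus> y \<in> I" if "x \<in> I" "y \<in> I" for x y
    using submodule_diff[OF sub] that by blast
  show "c \<odot> x \<in> I" if "x \<in> I" for c x
    using submodule_scale[OF sub] that by blast
qed (use assms in \<open>auto simp: closed_ideal_def closedin_iff\<close>)

text \<open>The induction principle for generated algebras: a property that cuts out a C*-subalgebra
  and holds on the generators holds everywhere.\<close>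

lemma generated_eq_carrier:
  assumes "cstar_generated A Y = carrier A" "cstar_subalgebra S A" "Y \<subseteq> S"
  shows "S = carrier A"
proof
  show "S \<subseteq> carrier A"
    using assms(2) submoduleE(1)[of S] by (auto simp: cstar_subalgebra_def)
  show "carrier A \<subseteq> S"
    using assms by (auto simp: cstar_generated_def)
qed

end

section \<open>Unital C*-algebras: square roots, inverses and proper ideals\<close>

locale unital_cstar = cstar_algebra A for A :: "'a cstar" (structure) +
  fixes u :: 'a
  assumes unit_closed [simp, intro]: "u \<in> carrier A"
    and unit_left [simp]: "x \<in> carrier A \<Longrightarrow> u \<otimes> x = x"
    and unit_right [simp]: "x \<in> carrier A \<Longrightarrow> x \<otimes> u = x"
    and unit_nonzero: "u \<noteq> \<zero>"
begin

lemma star_unit [simp]: "u\<^sup>\<star> = u"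
proof -
  have "u\<^sup>\<star> = u\<^sup>\<star> \<otimes> u" by simp
  also have "\<dots> = (u\<^sup>\<star> \<otimes> u)\<^sup>\<star>"
    by (simp add: star_mult del: unit_right)
  also have "\<dots> = u" by simp
  finally show ?thesis .
qed

lemma nrm_unit [simp]: "\<parallel>u\<parallel> = 1"
  using nrm_star_mult[of u] nrm_eq_0[of u] unit_nonzero by (simp add: power2_eq_square)

lemma nrm_scale_unit [simp]: "\<parallel>c \<odot> u\<parallel> = cmod c"
  by (simp add: nrm_smult)

lemma scale_unit_eq_iff [simp]: "c \<odot> u = d \<odot> u \<longleftrightarrow> c = d"
proof
  assume "c \<odot> u = d \<odot> u"
  then have "(c - d) \<odot> u = \<zero>"
    by (simp add: scale_diff_left)
  then show "c = d"
    using nrm_scale_unit[of "c - d"] by simp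
qed simp

text \<open>The copy of the complex numbers in which inner products of fibre vectors take their
  values. Since its elements commute with everything, coefficients and traces can be handled inside
  \<open>A\<close>.\<close>

definition scalars :: "'a set" where "scalars = range (\<lambda>c. c \<odot> u)"

definition scalar_of :: "'a \<Rightarrow> complex" where "scalar_of x = (THE c. x = c \<odot> u)"

lemma scalar_of_scale [simp]: "scalar_of (c \<odot> u) = c"
  by (simp add: scalar_of_def)

lemma scale_scalar_of: "x \<in> scalars \<Longrightarrow> scalar_of x \<odot> u = x"
  by (auto simp: scalars_def)

lemma scale_in_scalars [simp, intro]: "c \<odot> u \<in> scalars"
  by (simp add: scalars_def)

lemma unit_in_scalars [simp]: "u \<in> scalars"
  using scale_in_scalars[of 1] by simp

lemma scalars_carrier: "x \<in> scalars \<Longrightarrow> x \<in> carrier A"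
  by (auto simp: scalars_def)

lemma submodule_scalars: "submodule scalars complex_field A"
proof (rule submoduleI)
  show "\<zero> \<in> scalars"
    using scale_in_scalars[of 0] by simp
  show "\<ominus> a \<in> scalars" if "a \<in> scalars" for a
    using that by (auto simp: scalars_def minus_eq_scale)
  show "a \<oplus> b \<in> scalars" if "a \<in> scalars" "b \<in> scalars" for a b
    using that by (auto simp: scalars_def simp flip: scale_add_left)
qed (auto simp: scalars_def)

lemma star_scalars: "x \<in> scalars \<Longrightarrow> x\<^sup>\<star> \<in> scalars"
  by (auto simp: scalars_def star_smult)

lemma scalars_mult: "\<lbrakk>x \<in> scalars; y \<in> carrier A\<rbrakk> \<Longrightarrow> x \<otimes> y = scalar_of x \<odot> y"
  by (auto simp: scalars_def smult_mult_left)

lemma mult_scalars: "\<lbrakk>x \<in> scalars; y \<in> carrier A\<rbrakk> \<Longrightarrow> y \<otimes> x = scalar_of x \<odot> y"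
  by (auto simp: scalars_def smult_mult_right)

lemma mult_in_scalars: "\<lbrakk>x \<in> scalars; y \<in> scalars\<rbrakk> \<Longrightarrow> x \<otimes> y \<in> scalars"
  by (auto simp: scalars_def smult_mult_left)

lemma scalar_of_sum:
  assumes "finite I" "\<And>i. i \<in> I \<Longrightarrow> f i \<in> scalars"
  shows "scalar_of (\<Oplus>i\<in>I. f i) = (\<Sum>i\<in>I. scalar_of (f i))"
proof -
  have "(\<Oplus>i\<in>I. f i) = (\<Oplus>i\<in>I. scalar_of (f i) \<odot> u)"
    using assms by (intro sum_cong) (auto simp: scale_scalar_of dest: scalars_carrier)
  then show ?thesis
    using assms by (simp add: sum_scale_const)
qed

lemma cmod_scalar_of: "x \<in> scalars \<Longrightarrow> cmod (scalar_of x) = \<parallel>x\<parallel>"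
  by (auto simp: scalars_def)

text \<open>The equation \<open>(u - y)^2 = u - t\<close> is equivalent to
  \<open>y = (t + y^2) / 2\<close>. On self-adjoint \<open>y\<close> of norm at most 1/2 the
  right-hand side has norm at most 3/8 and Lipschitz constant at most 1/2, so a fixed point replaces
  the functional calculus.\<close>

lemma exists_square_root:
  assumes t: "t \<in> carrier A" "t\<^sup>\<star> = t" "\<parallel>t\<parallel> \<le> 1/2"
  obtains y where "y \<in> carrier A" "y\<^sup>\<star> = y" "\<parallel>y\<parallel> \<le> 1/2" "(u \<ominus> y) \<otimes> (u \<ominus> y) = u \<ominus> t"
proof -
  define C where "C = {y \<in> carrier A. y\<^sup>\<star> = y \<and> \<parallel>y\<parallel> \<le> 1/2}"
  define F where "F y = (1/2) \<odot> (t \<oplus> y \<otimes> y)" for y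
  obtain y where y: "y \<in> C" "F y = y"
  proof (rule contraction_fixed_point[of C "\<zero>" F])
    show "x \<in> C" if x: "x \<in> carrier A" and lim: "\<And>\<epsilon>. \<epsilon> > 0 \<Longrightarrow> \<exists>y\<in>C. \<parallel>y \<ominus> x\<parallel> < \<epsilon>" for x
    proof -
      have "\<parallel>x\<parallel> \<le> 1/2 + \<epsilon>" "\<parallel>x\<^sup>\<star> \<ominus> x\<parallel> \<le> 0 + \<epsilon>" if "\<epsilon> > 0" for \<epsilon>
      proof -
        obtain y where y: "y \<in> C" "\<parallel>y \<ominus> x\<parallel> < \<epsilon> / 2"
          using lim[of "\<epsilon>/2"] \<open>\<epsilon> > 0\<close> by auto
        then have yA: "y \<in> carrier A" "y\<^sup>\<star> = y"
          by (auto simp: C_def)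
        show "\<parallel>x\<parallel> \<le> 1/2 + \<epsilon>"
          using nrm_le_diff_add[OF x yA(1)] nrm_diff_commute[OF x yA(1)] y \<open>\<epsilon> > 0\<close> by (auto simp: C_def)
        have "\<parallel>x\<^sup>\<star> \<ominus> x\<parallel> \<le> \<parallel>x\<^sup>\<star> \<ominus> y\<parallel> + \<parallel>y \<ominus> x\<parallel>"
          using x yA by (intro nrm_diff_triangle) auto
        also have "\<parallel>x\<^sup>\<star> \<ominus> y\<parallel> = \<parallel>y \<ominus> x\<parallel>"
          using nrm_star[of "y \<ominus> x"] x yA by (simp add: star_diff nrm_diff_commute)
        finally show "\<parallel>x\<^sup>\<star> \<ominus> x\<parallel> \<le> 0 + \<epsilon>"
          using y by simp
      qed
      then have "\<parallel>x\<parallel> \<le> 1/2" "\<parallel>x\<^sup>\<star> \<ominus> x\<parallel> \<le> 0"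
        by (blast intro: field_le_epsilon)+
      then show "x \<in> C"
        using x nrm_nonneg[of "x\<^sup>\<star> \<ominus> x"] by (simp add: C_def nrm_eq_0 diff_eq_zero_iff)
    qed
    show "F x \<in> C" if "x \<in> C" for x
    proof -
      have x: "x \<in> carrier A" "x\<^sup>\<star> = x" "\<parallel>x\<parallel> \<le> 1/2"
        using that by (auto simp: C_def)
      have "\<parallel>x \<otimes> x\<parallel> \<le> 1/2 * (1/2)"
        using nrm_mult[of x x] x nrm_nonneg[of x]
        by (intro order_trans[OF nrm_mult] mult_mono) auto
      then have "\<parallel>t \<oplus> x \<otimes> x\<parallel> \<le> 1"
        using nrm_triangle[of t "x \<otimes> x"] x t by simp
      then show ?thesis
        using x t by (simp add: C_def F_def star_smult star_add star_mult nrm_smult)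
    qed
    show "\<parallel>F x \<ominus> F y\<parallel> \<le> \<parallel>x \<ominus> y\<parallel> / 2" if "x \<in> C" "y \<in> C" for x y
    proof -
      have x: "x \<in> carrier A" "\<parallel>x\<parallel> \<le> 1/2" and y: "y \<in> carrier A" "\<parallel>y\<parallel> \<le> 1/2"
        using that by (auto simp: C_def)
      have "F x \<ominus> F y = (1/2) \<odot> (x \<otimes> x \<ominus> y \<otimes> y)"
        using x y t by (simp add: F_def diff_add_add flip: scale_diff)
      then have "\<parallel>F x \<ominus> F y\<parallel> = 1/2 * \<parallel>x \<otimes> x \<ominus> y \<otimes> y\<parallel>"
        using x y by (simp add: nrm_smult)
      also have "\<dots> \<le> 1/2 * (\<parallel>x\<parallel> * \<parallel>x \<ominus> y\<parallel> + \<parallel>x \<ominus> y\<parallel> * \<parallel>y\<parallel>)"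
        using x y by (intro mult_left_mono nrm_mult_diff_le) auto
      also have "\<dots> \<le> 1/2 * (1/2 * \<parallel>x \<ominus> y\<parallel> + \<parallel>x \<ominus> y\<parallel> * (1/2))"
        using x y nrm_nonneg[of "x \<ominus> y"] by (intro mult_left_mono add_mono mult_mono) auto
      finally show ?thesis by simp
    qed
  qed (auto simp: C_def)
  have yA: "y \<in> carrier A" "y\<^sup>\<star> = y" "\<parallel>y\<parallel> \<le> 1/2"
    using y by (auto simp: C_def)
  have "y \<oplus> y = 2 \<odot> F y"
    using yA y(2) scale_add_left[of y 1 1] by simp
  also have "\<dots> = t \<oplus> y \<otimes> y"
    using t yA by (simp add: F_def)
  finally have 2: "y \<oplus> y = t \<oplus> y \<otimes> y" .
  have "(u \<ominus> y) \<otimes> (u \<ominus> y) = (u \<ominus> y) \<ominus> (y \<ominus> y \<otimes> y)"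
    using yA by (simp add: mult_diff_left mult_diff_right)
  also have "\<dots> = u \<ominus> (y \<oplus> y) \<oplus> y \<otimes> y"
    using yA by (simp add: a_minus_def M.minus_add M.a_assoc)
  also have "\<dots> = u \<ominus> t"
    using yA t by (simp add: 2 a_minus_def M.minus_add M.a_assoc M.l_neg)
  finally show thesis
    using that yA by blast
qed

text \<open>The sum \<open>d\<close> of the Neumann series is found as the solution of
  \<open>d = u + y d\<close>; multiplication by \<open>y\<close> at least halves distances.\<close>

lemma exists_right_inverse:
  assumes y: "y \<in> carrier A" "\<parallel>y\<parallel> \<le> 1/2"
  obtains d where "d \<in> carrier A" "(u \<ominus> y) \<otimes> d = u"
proof -
  obtain d where d: "d \<in> carrier A" "u \<oplus> y \<otimes> d = d"
  proof (rule contraction_fixed_point[of "carrier A" u "\<lambda>d. u \<oplus> y \<otimes> d"])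
    show "\<parallel>u \<oplus> y \<otimes> a \<ominus> (u \<oplus> y \<otimes> b)\<parallel> \<le> \<parallel>a \<ominus> b\<parallel> / 2" if "a \<in> carrier A" "b \<in> carrier A" for a b
    proof -
      have "\<parallel>u \<oplus> y \<otimes> a \<ominus> (u \<oplus> y \<otimes> b)\<parallel> = \<parallel>y \<otimes> (a \<ominus> b)\<parallel>"
        using that y by (simp add: diff_add_add mult_diff_right)
      also have "\<dots> \<le> \<parallel>y\<parallel> * \<parallel>a \<ominus> b\<parallel>"
        using that y by (intro nrm_mult) auto
      also have "\<dots> \<le> 1/2 * \<parallel>a \<ominus> b\<parallel>"
        using that y by (intro mult_right_mono nrm_nonneg) auto
      finally show ?thesis by simp
    qed
  qed (use y in auto)
  have "(u \<ominus> y) \<otimes> d = (u \<oplus> y \<otimes> d) \<ominus> y \<otimes> d"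
    using d y by (simp add: mult_diff_left)
  also have "\<dots> = u"
    using d(1) y by (simp add: a_minus_def M.a_assoc M.r_neg)
  finally show thesis
    using that d by blast
qed

text \<open>If \<open>h = s s\<close> with \<open>s\<close> self-adjoint and \<open>s d = u\<close>,
  then \<open>d* s = u\<close> by taking adjoints, hence \<open>d* h d = u\<close>. The radius 1/2
  is inherited from \<open>exists_square_root\<close>; it fixes the accuracy with which a
  compression has to approach a scalar later.\<close>

lemma exists_normalizer:
  assumes h: "h \<in> carrier A" "h\<^sup>\<star> = h" "\<parallel>u \<ominus> h\<parallel> \<le> 1/2"
  obtains d where "d \<in> carrier A" "d\<^sup>\<star> \<otimes> (h \<otimes> d) = u"
proof -
  obtain y where y: "y \<in> carrier A" "y\<^sup>\<star> = y" "\<parallel>y\<parallel> \<le> 1/2" "(u \<ominus> y) \<otimes> (u \<ominus> y) = u \<ominus> (u \<ominus> h)"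
    using exists_square_root[of "u \<ominus> h"] h by (auto simp: star_diff)
  obtain d where d: "d \<in> carrier A" "(u \<ominus> y) \<otimes> d = u"
    using exists_right_inverse y by blast
  have h_eq: "h = (u \<ominus> y) \<otimes> (u \<ominus> y)"
    unfolding y(4) using h by simp
  have d': "d\<^sup>\<star> \<otimes> (u \<ominus> y) = u"
    using arg_cong[OF d(2), of "star A"] d(1) y(1,2) by (simp add: star_mult star_diff)
  have "h \<otimes> d = (u \<ominus> y) \<otimes> ((u \<ominus> y) \<otimes> d)"
    unfolding h_eq using y d by (intro mult_assoc) auto
  then have "d\<^sup>\<star> \<otimes> (h \<otimes> d) = u"
    using d(1) y(1) by (simp add: d(2) d')
  with d(1) show thesis
    using that by blast
qed

text \<open>The element \<open>a* a / K\<close> has norm at most 1/2, so \<open>u - a* a / K\<close>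
  is a square by \<open>exists_square_root\<close>. The summand 1 in \<open>K\<close> covers
  \<open>a = \<zero>\<close>.\<close>

lemma exists_dominating_scalar:
  assumes a: "a \<in> carrier A"
  obtains K c where "K > 0" "c \<in> carrier A" "complex_of_real K \<odot> u \<ominus> a\<^sup>\<star> \<otimes> a = c\<^sup>\<star> \<otimes> c"
proof -
  define K where "K = 2 * \<parallel>a\<parallel>\<^sup>2 + 1"
  have K: "K > 0"
    by (simp add: K_def add_nonneg_pos)
  define t where "t = complex_of_real (1 / K) \<odot> (a\<^sup>\<star> \<otimes> a)"
  have "\<parallel>t\<parallel> = (1 / K) * \<parallel>a\<parallel>\<^sup>2"
    unfolding t_def using a K by (subst nrm_smult) (auto simp: nrm_star_mult norm_divide)
  also have "\<dots> \<le> 1/2"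
    using K by (simp add: field_simps K_def)
  finally have t: "t \<in> carrier A" "t\<^sup>\<star> = t" "\<parallel>t\<parallel> \<le> 1/2"
    using a by (auto simp: t_def star_smult star_mult)
  then obtain y where y: "y \<in> carrier A" "y\<^sup>\<star> = y" "(u \<ominus> y) \<otimes> (u \<ominus> y) = u \<ominus> t"
    using exists_square_root by metis
  define c where "c = complex_of_real (sqrt K) \<odot> (u \<ominus> y)"
  have "c\<^sup>\<star> \<otimes> c = complex_of_real K \<odot> ((u \<ominus> y) \<otimes> (u \<ominus> y))"
    using y(1,2) K by (simp add: c_def star_smult star_diff smult_mult_left smult_mult_right flip: of_real_mult)
  also have "\<dots> = complex_of_real K \<odot> u \<ominus> a\<^sup>\<star> \<otimes> a"
    unfolding y(3) using a K t by (simp add: scale_diff) (simp add: t_def flip: of_real_mult)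
  finally show thesis
    using K that[of K c] y by (simp add: c_def)
qed

text \<open>If \<open>t = u - n\<close> had norm below 1, then \<open>t^k\<close> would tend to zero
  while \<open>u - t^k\<close> stays in \<open>I\<close>, so the closed ideal would contain
  \<open>u\<close>. In other words, the unit keeps norm 1 modulo a proper ideal.\<close>

lemma proper_ideal_dist_unit:
  assumes I: "closed_ideal I A" "u \<notin> I" and n: "n \<in> I"
  shows "1 \<le> \<parallel>u \<ominus> n\<parallel>"
proof (rule ccontr)
  assume "\<not> 1 \<le> \<parallel>u \<ominus> n\<parallel>"
  define t where "t = u \<ominus> n"
  then have nA: "n \<in> carrier A" and t: "t \<in> carrier A" "\<parallel>t\<parallel> < 1"
    using n closed_idealD(2)[OF I(1)] \<open>\<not> 1 \<le> \<parallel>u \<ominus> n\<parallel>\<close> by (auto simp: t_def)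
  have ut: "u \<ominus> t = n"
    using nA by (simp add: t_def)
  define p where "p k = ((\<lambda>x. x \<otimes> t) ^^ k) u" for k
  have p: "p k \<in> carrier A \<and> u \<ominus> p k \<in> I \<and> \<parallel>p k\<parallel> \<le> \<parallel>t\<parallel> ^ k" for k
  proof (induction k)
    case 0
    then show ?case
      using submodule_zero[OF closed_idealD(1)[OF I(1)]] by (simp add: p_def)
  next
    case (Suc k)
    have eq: "p (Suc k) = p k \<otimes> t" by (simp add: p_def)
    have "u \<ominus> p k \<otimes> t = (u \<ominus> t) \<oplus> (u \<ominus> p k) \<otimes> t"
      using Suc t diff_diff_split[of u t "p k \<otimes> t"] by (simp add: mult_diff_left)
    moreover have "\<dots> \<in> I"
      using closed_idealD[OF I(1)] Suc t n by (simp add: ut)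
    moreover have "\<parallel>p k \<otimes> t\<parallel> \<le> \<parallel>p k\<parallel> * \<parallel>t\<parallel>"
      using Suc t by (simp add: nrm_mult)
    moreover have "\<parallel>p k\<parallel> * \<parallel>t\<parallel> \<le> \<parallel>t\<parallel> ^ k * \<parallel>t\<parallel>"
      using Suc t by (intro mult_right_mono nrm_nonneg) auto
    ultimately show ?case
      using Suc t by (simp add: eq mult.commute)
  qed
  have "u \<in> I"
  proof (rule closed_idealD(8)[OF I(1)])
    show "\<forall>\<epsilon>>0. \<exists>y\<in>I. \<parallel>u \<ominus> y\<parallel> < \<epsilon>"
    proof (intro allI impI)
      fix \<epsilon> :: real assume "\<epsilon> > 0"
      then obtain k where "\<parallel>t\<parallel> ^ k < \<epsilon>"
        using real_arch_pow_inv t by blast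
      moreover have "u \<ominus> (u \<ominus> p k) = p k"
        using p by simp
      ultimately have "\<parallel>u \<ominus> (u \<ominus> p k)\<parallel> < \<epsilon>"
        using p[of k] by simp
      then show "\<exists>y\<in>I. \<parallel>u \<ominus> y\<parallel> < \<epsilon>"
        using p by blast
    qed
  qed simp
  with I show False by simp
qed

lemma proper_ideal_dist_scalar:
  assumes I: "closed_ideal I A" "u \<notin> I" and n: "n \<in> I"
  shows "cmod c \<le> \<parallel>c \<odot> u \<ominus> n\<parallel>"
proof (cases "c = 0")
  case True
  then show ?thesis
    using closed_idealD(2)[OF I(1)] n by (auto intro: nrm_nonneg)
next
  case False
  have nA: "n \<in> carrier A"
    using n closed_idealD(2)[OF I(1)] by auto
  have "c \<odot> u \<ominus> n = c \<odot> (u \<ominus> inverse c \<odot> n)"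
    using nA False by (simp add: scale_diff)
  then have "\<parallel>c \<odot> u \<ominus> n\<parallel> = cmod c * \<parallel>u \<ominus> inverse c \<odot> n\<parallel>"
    using nA by (simp add: nrm_smult)
  moreover have "1 \<le> \<parallel>u \<ominus> inverse c \<odot> n\<parallel>"
    using n closed_idealD(7)[OF I(1)] by (intro proper_ideal_dist_unit[OF I]) auto
  ultimately show ?thesis
    using mult_left_mono[of 1 "\<parallel>u \<ominus> inverse c \<odot> n\<parallel>" "cmod c"] by simp
qed

lemma closed_ideal_eq_carrier:
  assumes "closed_ideal I A" "u \<in> I"
  shows "I = carrier A"
  using closed_idealD(2)[OF assms(1)] closed_idealD(3)[OF assms(1) _ assms(2)] by auto

end

lemma (in complex_space) sum_Times:
  assumes "finite I" "finite J" "\<And>i j. \<lbrakk>i \<in> I; j \<in> J\<rbrakk> \<Longrightarrow> f i j \<in> carrier V"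
  shows "(\<Oplus>p\<in>I \<times> J. f (fst p) (snd p)) = (\<Oplus>i\<in>I. \<Oplus>j\<in>J. f i j)"
  using assms(1,3)
proof (induction I)
  case empty
  then show ?case by simp
next
  case (insert i I)
  have split: "insert i I \<times> J = Pair i ` J \<union> I \<times> J" by auto
  have "(\<Oplus>p\<in>insert i I \<times> J. f (fst p) (snd p)) =
      (\<Oplus>p\<in>Pair i ` J. f (fst p) (snd p)) \<oplus> (\<Oplus>p\<in>I \<times> J. f (fst p) (snd p))"
    unfolding split using insert assms(2) by (intro M.finsum_Un_disjoint) auto
  also have "(\<Oplus>p\<in>Pair i ` J. f (fst p) (snd p)) = (\<Oplus>j\<in>J. f i j)"
    using insert by (subst M.finsum_reindex) (auto simp: inj_on_def)
  also have "(\<Oplus>p\<in>I \<times> J. f (fst p) (snd p)) = (\<Oplus>i\<in>I. \<Oplus>j\<in>J. f i j)"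
    using insert by simp
  finally show ?case
    using insert by (simp add: sum_insert)
qed

section \<open>Cuntz families\<close>

text \<open>The set \<open>B t\<close> stands for the image of an orthonormal basis of the fibre
  over \<open>t\<close>. Given \<open>basis_complete\<close>, the condition
  \<open>basis_mult\<close> says that the product of two fibres lies in the fibre over
  \<open>s t\<close>: the coefficients of \<open>e f\<close> are scalars. Together,
  \<open>basis_inj\<close> and \<open>basis_one\<close> force at least two elements in every
  \<open>B t\<close> with \<open>t \<noteq> 1\<close>.\<close>

locale cuntz_family = unital_cstar A u + G: comm_group G
  for A :: "'a cstar" (structure) and u :: 'a and G :: "('g, 'm) monoid_scheme" +
  fixes P :: "'g set" and B :: "'g \<Rightarrow> 'a set"
  assumes submonoid: "submonoid P G"
    and basis_finite: "t \<in> P \<Longrightarrow> finite (B t)"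
    and basis_carrier: "\<lbrakk>t \<in> P; f \<in> B t\<rbrakk> \<Longrightarrow> f \<in> carrier A"
    and basis_orthonormal:
      "\<lbrakk>t \<in> P; e \<in> B t; f \<in> B t\<rbrakk> \<Longrightarrow> e\<^sup>\<star> \<otimes> f = (if e = f then u else \<zero>)"
    and basis_complete: "t \<in> P \<Longrightarrow> (\<Oplus>f\<in>B t. f \<otimes> f\<^sup>\<star>) = u"
    and basis_mult:
      "\<lbrakk>s \<in> P; t \<in> P; e \<in> B s; f \<in> B t; h \<in> B (s \<otimes>\<^bsub>G\<^esub> t)\<rbrakk> \<Longrightarrow> h\<^sup>\<star> \<otimes> (e \<otimes> f) \<in> scalars"
    and basis_inj: "inj_on (\<lambda>t. card (B t)) P"
    and basis_one: "card (B \<one>\<^bsub>G\<^esub>) = 1"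
    and generated: "cstar_generated A (\<Union>t\<in>P. B t) = carrier A"
begin

abbreviation gmult (infixl "\<cdot>" 70) where "s \<cdot> t \<equiv> s \<otimes>\<^bsub>G\<^esub> t"

lemma P_mult [simp, intro]: "\<lbrakk>s \<in> P; t \<in> P\<rbrakk> \<Longrightarrow> s \<cdot> t \<in> P"
  using submonoid by (rule submonoid.m_closed)

lemma P_one [simp, intro]: "\<one>\<^bsub>G\<^esub> \<in> P"
  using submonoid by (rule submonoid.one_closed)

lemma P_carrier [simp, intro]: "t \<in> P \<Longrightarrow> t \<in> carrier G"
  using submonoid.subset[OF submonoid] by auto

lemmas [simp, intro] = basis_carrier
lemmas [simp] = basis_finite

text \<open>For the family of a Cuntz representation \<open>i\<close> of \<open>E\<close>, the space \<open>fib t\<close> is \<open>i(E\<^sub>t)\<close> and \<open>mp s t\<close>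
  is the span of \<open>i(E\<^sub>s) i(E\<^sub>t)\<^sup>*\<close>. In this form no linear spans are needed.\<close>

definition fib :: "'g \<Rightarrow> 'a set" where
  "fib t = {x \<in> carrier A. \<forall>f\<in>B t. f\<^sup>\<star> \<otimes> x \<in> scalars}"

definition mp :: "'g \<Rightarrow> 'g \<Rightarrow> 'a set" where
  "mp s t = {a \<in> carrier A. \<forall>x\<in>fib t. a \<otimes> x \<in> fib s}"

definition deg :: "'g \<Rightarrow> 'a set" where
  "deg g = {a. \<exists>s\<in>P. \<exists>t\<in>P. s \<cdot> inv\<^bsub>G\<^esub> t = g \<and> a \<in> mp s t}"

definition sphere :: "'g \<Rightarrow> 'a set" where
  "sphere t = {x \<in> fib t. \<parallel>x\<parallel> = 1}"

text \<open>Parseval frames of a fibre. They are closed under products, whereas the products of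
  \<open>B s\<close> and \<open>B t\<close> need not form the chosen basis \<open>B (s t)\<close>;
  and the two orders of the factors give two frames of one fibre, whose comparison is used
  below.\<close>

definition frame :: "'g \<Rightarrow> 'i set \<Rightarrow> ('i \<Rightarrow> 'a) \<Rightarrow> bool" where
  "frame t I x \<longleftrightarrow> finite I \<and> (\<forall>i\<in>I. x i \<in> fib t) \<and> (\<Oplus>i\<in>I. x i \<otimes> (x i)\<^sup>\<star>) = u"

lemma frame_finite: "frame t I x \<Longrightarrow> finite I"
  by (simp add: frame_def)

lemma frame_fib: "\<lbrakk>frame t I x; i \<in> I\<rbrakk> \<Longrightarrow> x i \<in> fib t"
  by (simp add: frame_def)

lemma frame_sum: "frame t I x \<Longrightarrow> (\<Oplus>i\<in>I. x i \<otimes> (x i)\<^sup>\<star>) = u"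
  by (simp add: frame_def)

lemma frame_carrier: "\<lbrakk>frame t I x; i \<in> I\<rbrakk> \<Longrightarrow> x i \<in> carrier A"
  by (simp add: frame_def fib_def)

lemma fib_carrier [intro]: "x \<in> fib t \<Longrightarrow> x \<in> carrier A"
  by (simp add: fib_def)

lemma mp_carrier [intro]: "a \<in> mp s t \<Longrightarrow> a \<in> carrier A"
  by (simp add: mp_def)

lemma deg_carrier [intro]: "a \<in> deg g \<Longrightarrow> a \<in> carrier A"
  by (auto simp: deg_def)

lemma sphere_fib: "z \<in> sphere t \<Longrightarrow> z \<in> fib t"
  by (simp add: sphere_def)

lemma sphere_carrier [intro]: "z \<in> sphere t \<Longrightarrow> z \<in> carrier A"
  by (auto simp: sphere_def)

lemma nrm_sphere: "z \<in> sphere t \<Longrightarrow> \<parallel>z\<parallel> = 1"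
  by (simp add: sphere_def)

lemma submodule_fib: assumes "t \<in> P" shows "submodule (fib t) complex_field A"
proof (rule submoduleI)
  note S = submodule_zero[OF submodule_scalars] submoduleE(5)[OF submodule_scalars] submodule_scale[OF submodule_scalars]
  show "\<zero> \<in> fib t"
    using S assms by (simp add: fib_def)
  show "\<ominus> a \<in> fib t" if "a \<in> fib t" for a
    using S that assms by (simp add: fib_def minus_eq_scale smult_mult_right)
  show "a \<oplus> b \<in> fib t" if "a \<in> fib t" "b \<in> fib t" for a b
    using S that assms by (simp add: fib_def distrib_left)
  show "c \<odot> a \<in> fib t" if "a \<in> fib t" for a c
    using S that assms by (simp add: fib_def smult_mult_right)
qed (auto simp: fib_def)

lemma fib_mult_scalars:
  assumes "t \<in> P" "x \<in> fib t" "c \<in> scalars" shows "x \<otimes> c \<in> fib t"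
  using assms submodule_scale[OF submodule_fib[OF assms(1)] assms(2)] by (simp add: mult_scalars fib_carrier)

lemma sum_in_fib:
  "\<lbrakk>t \<in> P; \<And>i. i \<in> I \<Longrightarrow> f i \<in> fib t\<rbrakk> \<Longrightarrow> (\<Oplus>i\<in>I. f i) \<in> fib t"
  by (rule sum_in_submodule[OF submodule_fib])

lemma basis_fib: "\<lbrakk>t \<in> P; f \<in> B t\<rbrakk> \<Longrightarrow> f \<in> fib t"
  using submodule_zero[OF submodule_scalars] by (auto simp: fib_def basis_orthonormal)

lemma frame_basis: "t \<in> P \<Longrightarrow> frame t (B t) (\<lambda>f. f)"
  by (simp add: frame_def basis_fib basis_complete)

lemma frame_expand:
  assumes "frame t I x" "y \<in> carrier A"
  shows "(\<Oplus>i\<in>I. x i \<otimes> ((x i)\<^sup>\<star> \<otimes> y)) = y"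
proof -
  have x: "x i \<in> carrier A" if "i \<in> I" for i
    using assms that by (auto intro: frame_carrier)
  have "y = (\<Oplus>i\<in>I. x i \<otimes> (x i)\<^sup>\<star>) \<otimes> y"
    using assms by (simp add: frame_def)
  also have "\<dots> = (\<Oplus>i\<in>I. x i \<otimes> (x i)\<^sup>\<star> \<otimes> y)"
    using x assms by (intro sum_mult_right) auto
  also have "\<dots> = (\<Oplus>i\<in>I. x i \<otimes> ((x i)\<^sup>\<star> \<otimes> y))"
    using x assms by (intro sum_cong) (auto simp: mult_assoc)
  finally show ?thesis ..
qed

lemma frame_expand_right:
  assumes "frame t I x" "y \<in> carrier A"
  shows "(\<Oplus>i\<in>I. (y \<otimes> x i) \<otimes> (x i)\<^sup>\<star>) = y"
proof -
  have x: "x i \<in> carrier A" if "i \<in> I" for i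
    using assms that by (auto intro: frame_carrier)
  have "y = y \<otimes> (\<Oplus>i\<in>I. x i \<otimes> (x i)\<^sup>\<star>)"
    using assms by (simp add: frame_def)
  also have "\<dots> = (\<Oplus>i\<in>I. y \<otimes> (x i \<otimes> (x i)\<^sup>\<star>))"
    using x assms by (intro sum_mult_left) auto
  also have "\<dots> = (\<Oplus>i\<in>I. (y \<otimes> x i) \<otimes> (x i)\<^sup>\<star>)"
    using x assms by (intro sum_cong) (auto simp: mult_assoc)
  finally show ?thesis ..
qed

lemma frame_pairing:
  assumes "frame t I x" "y \<in> carrier A" "z \<in> carrier A"
  shows "(\<Oplus>i\<in>I. (y \<otimes> x i) \<otimes> ((x i)\<^sup>\<star> \<otimes> z)) = y \<otimes> z"
proof -
  have x: "x i \<in> carrier A" if "i \<in> I" for i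
    using assms that by (auto intro: frame_carrier)
  have "y \<otimes> z = y \<otimes> (\<Oplus>i\<in>I. x i \<otimes> ((x i)\<^sup>\<star> \<otimes> z))"
    using frame_expand[OF assms(1,3)] by simp
  also have "\<dots> = (\<Oplus>i\<in>I. y \<otimes> (x i \<otimes> ((x i)\<^sup>\<star> \<otimes> z)))"
    using x assms by (intro sum_mult_left) auto
  also have "\<dots> = (\<Oplus>i\<in>I. (y \<otimes> x i) \<otimes> ((x i)\<^sup>\<star> \<otimes> z))"
    using x assms by (intro sum_cong) (auto simp: mult_assoc)
  finally show ?thesis ..
qed

lemma inner_in_scalars:
  assumes "t \<in> P" "x \<in> fib t" "y \<in> fib t"
  shows "x\<^sup>\<star> \<otimes> y \<in> scalars"
proof -
  have xy: "x \<in> carrier A" "y \<in> carrier A"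
    using assms by auto
  have "x\<^sup>\<star> \<otimes> y = (\<Oplus>f\<in>B t. (x\<^sup>\<star> \<otimes> f) \<otimes> (f\<^sup>\<star> \<otimes> y))"
    using frame_pairing[OF frame_basis[OF assms(1)]] xy by simp
  also have "\<dots> \<in> scalars"
  proof (rule sum_in_submodule[OF submodule_scalars])
    fix f assume f: "f \<in> B t"
    have "x\<^sup>\<star> \<otimes> f = (f\<^sup>\<star> \<otimes> x)\<^sup>\<star>"
      using f assms xy by (simp add: star_mult)
    then have "x\<^sup>\<star> \<otimes> f \<in> scalars" "f\<^sup>\<star> \<otimes> y \<in> scalars"
      using f assms by (auto simp: fib_def star_scalars)
    then show "(x\<^sup>\<star> \<otimes> f) \<otimes> (f\<^sup>\<star> \<otimes> y) \<in> scalars"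
      by (rule mult_in_scalars)
  qed
  finally show ?thesis .
qed

text \<open>On a fibre the C*-norm is the Hilbert space norm: inserting the frame between
  \<open>x*\<close> and \<open>x\<close> gives a sum of squared moduli times \<open>u\<close>, and
  the C*-identity reads off its value.\<close>

lemma inner_eq_parseval:
  assumes "t \<in> P" "x \<in> fib t" "frame t I v"
  shows "x\<^sup>\<star> \<otimes> x = complex_of_real (\<parallel>x\<parallel>\<^sup>2) \<odot> u \<and> \<parallel>x\<parallel>\<^sup>2 = (\<Sum>i\<in>I. \<parallel>(v i)\<^sup>\<star> \<otimes> x\<parallel>\<^sup>2)"
proof -
  have x: "x \<in> carrier A" and v: "\<And>i. i \<in> I \<Longrightarrow> v i \<in> carrier A"
    using assms by (auto intro: frame_carrier)
  have sc: "(v i)\<^sup>\<star> \<otimes> x \<in> scalars" if "i \<in> I" for i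
    using assms that by (auto intro: inner_in_scalars frame_fib)
  have term_eq: "(x\<^sup>\<star> \<otimes> v i) \<otimes> ((v i)\<^sup>\<star> \<otimes> x) = complex_of_real (\<parallel>(v i)\<^sup>\<star> \<otimes> x\<parallel>\<^sup>2) \<odot> u" if i: "i \<in> I" for i
  proof -
    obtain c where c: "(v i)\<^sup>\<star> \<otimes> x = c \<odot> u"
      using sc[OF i] by (auto simp: scalars_def)
    have "x\<^sup>\<star> \<otimes> v i = ((v i)\<^sup>\<star> \<otimes> x)\<^sup>\<star>"
      using x v[OF i] by (simp add: star_mult)
    then show ?thesis
      by (simp add: c star_smult smult_mult_left complex_norm_square mult.commute del: of_real_power)
  qed
  have "x\<^sup>\<star> \<otimes> x = (\<Oplus>i\<in>I. (x\<^sup>\<star> \<otimes> v i) \<otimes> ((v i)\<^sup>\<star> \<otimes> x))"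
    using frame_pairing[OF assms(3)] x by simp
  also have "\<dots> = (\<Oplus>i\<in>I. complex_of_real (\<parallel>(v i)\<^sup>\<star> \<otimes> x\<parallel>\<^sup>2) \<odot> u)"
    by (intro sum_cong) (auto simp: term_eq)
  also have "\<dots> = complex_of_real (\<Sum>i\<in>I. \<parallel>(v i)\<^sup>\<star> \<otimes> x\<parallel>\<^sup>2) \<odot> u"
    using frame_finite[OF assms(3)] by (simp add: sum_scale_const)
  finally have eq: "x\<^sup>\<star> \<otimes> x = complex_of_real (\<Sum>i\<in>I. \<parallel>(v i)\<^sup>\<star> \<otimes> x\<parallel>\<^sup>2) \<odot> u" .
  then have "\<parallel>x\<parallel>\<^sup>2 = (\<Sum>i\<in>I. \<parallel>(v i)\<^sup>\<star> \<otimes> x\<parallel>\<^sup>2)"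
    using nrm_star_mult[OF x] by (simp add: sum_nonneg del: of_real_sum)
  with eq show ?thesis by simp
qed

lemma inner_self: "\<lbrakk>t \<in> P; x \<in> fib t\<rbrakk> \<Longrightarrow> x\<^sup>\<star> \<otimes> x = complex_of_real (\<parallel>x\<parallel>\<^sup>2) \<odot> u"
  using inner_eq_parseval frame_basis by blast

lemma parseval: "\<lbrakk>t \<in> P; x \<in> fib t; frame t I v\<rbrakk> \<Longrightarrow> \<parallel>x\<parallel>\<^sup>2 = (\<Sum>i\<in>I. \<parallel>(v i)\<^sup>\<star> \<otimes> x\<parallel>\<^sup>2)"
  using inner_eq_parseval by blast

lemma sphere_isometry: "\<lbrakk>t \<in> P; z \<in> sphere t\<rbrakk> \<Longrightarrow> z\<^sup>\<star> \<otimes> z = u"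
  using inner_self[of t z] by (simp add: sphere_def)

lemma sphereI: "\<lbrakk>z \<in> fib t; z\<^sup>\<star> \<otimes> z = u\<rbrakk> \<Longrightarrow> z \<in> sphere t"
  using nrm_star_mult[of z] nrm_nonneg[of z] fib_carrier[of z t] by (simp add: sphere_def power2_eq_1_iff)

lemma basis_sphere: "\<lbrakk>t \<in> P; f \<in> B t\<rbrakk> \<Longrightarrow> f \<in> sphere t"
  by (intro sphereI) (auto simp: basis_fib basis_orthonormal)

lemma basis_nonempty: assumes "t \<in> P" shows "B t \<noteq> {}"
  using basis_complete[OF assms] unit_nonzero by auto

lemma sphere_nonempty: "t \<in> P \<Longrightarrow> \<exists>z. z \<in> sphere t"
  using basis_nonempty basis_sphere by blast

text \<open>Both factors are expanded in their bases; the scalar coefficients move to the right, and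
  \<open>basis_mult\<close> settles the products of basis vectors.\<close>

lemma fib_mult:
  assumes "s \<in> P" "t \<in> P" "x \<in> fib s" "y \<in> fib t"
  shows "x \<otimes> y \<in> fib (s \<cdot> t)"
proof -
  have xy: "x \<in> carrier A" "y \<in> carrier A"
    using assms by auto
  have st: "s \<cdot> t \<in> P"
    using assms by simp
  have "x \<otimes> f \<in> fib (s \<cdot> t)" if f: "f \<in> B t" for f
  proof -
    have "x \<otimes> f = (\<Oplus>e\<in>B s. e \<otimes> (e\<^sup>\<star> \<otimes> x)) \<otimes> f"
      using frame_expand[OF frame_basis[OF assms(1)] xy(1)] by simp
    also have "\<dots> = (\<Oplus>e\<in>B s. e \<otimes> (e\<^sup>\<star> \<otimes> x) \<otimes> f)"
      using f xy assms by (intro sum_mult_right) auto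
    also have "\<dots> \<in> fib (s \<cdot> t)"
    proof (intro sum_in_fib st)
      fix e assume e: "e \<in> B s"
      have "e\<^sup>\<star> \<otimes> x \<in> scalars"
        using e assms by (auto simp: fib_def)
      then have "e \<otimes> (e\<^sup>\<star> \<otimes> x) \<otimes> f = (e \<otimes> f) \<otimes> (e\<^sup>\<star> \<otimes> x)"
        using e f assms by (simp add: mult_scalars smult_mult_left)
      moreover have "e \<otimes> f \<in> fib (s \<cdot> t)"
        using e f assms basis_mult by (auto simp: fib_def)
      ultimately show "e \<otimes> (e\<^sup>\<star> \<otimes> x) \<otimes> f \<in> fib (s \<cdot> t)"
        using fib_mult_scalars[OF st] \<open>e\<^sup>\<star> \<otimes> x \<in> scalars\<close> by simp
    qed
    finally show ?thesis .
  qed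
  note xf = this
  have "x \<otimes> y = (\<Oplus>f\<in>B t. (x \<otimes> f) \<otimes> (f\<^sup>\<star> \<otimes> y))"
    using frame_pairing[OF frame_basis[OF assms(2)]] xy by simp
  also have "\<dots> \<in> fib (s \<cdot> t)"
    using assms by (intro sum_in_fib st fib_mult_scalars xf) (auto simp: fib_def)
  finally show ?thesis .
qed

text \<open>The coefficient of \<open>z* w\<close> at \<open>e\<close> is the inner product of
  \<open>z e\<close> with \<open>w\<close> in \<open>fib (r s)\<close>. So an adjoint on the left
  removes the first tensor factor.\<close>

lemma fib_cancel:
  assumes "r \<in> P" "s \<in> P" "z \<in> fib r" "w \<in> fib (r \<cdot> s)"
  shows "z\<^sup>\<star> \<otimes> w \<in> fib s"
proof -
  have zw: "z \<in> carrier A" "w \<in> carrier A"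
    using assms by auto
  have "e\<^sup>\<star> \<otimes> (z\<^sup>\<star> \<otimes> w) \<in> scalars" if e: "e \<in> B s" for e
  proof -
    have "e\<^sup>\<star> \<otimes> (z\<^sup>\<star> \<otimes> w) = (z \<otimes> e)\<^sup>\<star> \<otimes> w"
      using e assms zw by (simp add: star_mult mult_assoc)
    then show ?thesis
      using assms e inner_in_scalars[of "r \<cdot> s"] by (auto intro: fib_mult basis_fib)
  qed
  then show ?thesis
    using zw by (simp add: fib_def)
qed

lemma sphere_mult:
  assumes "s \<in> P" "t \<in> P" "x \<in> sphere s" "y \<in> sphere t"
  shows "x \<otimes> y \<in> sphere (s \<cdot> t)"
proof (rule sphereI)
  have xy: "x \<in> carrier A" "y \<in> carrier A"
    using assms by auto
  have "(x \<otimes> y)\<^sup>\<star> \<otimes> (x \<otimes> y) = y\<^sup>\<star> \<otimes> ((x\<^sup>\<star> \<otimes> x) \<otimes> y)"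
    using xy by (simp add: star_mult mult_assoc)
  then show "(x \<otimes> y)\<^sup>\<star> \<otimes> (x \<otimes> y) = u"
    using assms xy by (simp add: sphere_isometry)
qed (use assms fib_mult sphere_fib in blast)

text \<open>Summation over the second factor collapses \<open>x y y* x*\<close> to
  \<open>x x*\<close>.\<close>

lemma frame_mult:
  assumes "s \<in> P" "t \<in> P" "frame s I x" "frame t J y"
  shows "frame (s \<cdot> t) (I \<times> J) (\<lambda>p. x (fst p) \<otimes> y (snd p))"
proof -
  have fin: "finite I" "finite J" and fib: "\<And>i. i \<in> I \<Longrightarrow> x i \<in> fib s" "\<And>j. j \<in> J \<Longrightarrow> y j \<in> fib t"
    using assms by (auto intro: frame_fib frame_finite)
  then have xy: "\<And>i. i \<in> I \<Longrightarrow> x i \<in> carrier A" "\<And>j. j \<in> J \<Longrightarrow> y j \<in> carrier A"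
    by auto
  have "(\<Oplus>p\<in>I \<times> J. (x (fst p) \<otimes> y (snd p)) \<otimes> (x (fst p) \<otimes> y (snd p))\<^sup>\<star>) =
      (\<Oplus>i\<in>I. \<Oplus>j\<in>J. (x i \<otimes> y j) \<otimes> (x i \<otimes> y j)\<^sup>\<star>)"
    using fin xy by (intro sum_Times) auto
  also have "\<dots> = (\<Oplus>i\<in>I. x i \<otimes> (x i)\<^sup>\<star>)"
  proof (intro sum_cong refl)
    fix i assume i: "i \<in> I"
    have "(\<Oplus>j\<in>J. (x i \<otimes> y j) \<otimes> (x i \<otimes> y j)\<^sup>\<star>) = (\<Oplus>j\<in>J. (x i \<otimes> y j) \<otimes> ((y j)\<^sup>\<star> \<otimes> (x i)\<^sup>\<star>))"
      using i xy by (intro sum_cong) (auto simp: star_mult)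
    also have "\<dots> = x i \<otimes> (x i)\<^sup>\<star>"
      using i xy by (intro frame_pairing[OF assms(4)]) auto
    finally show "(\<Oplus>j\<in>J. (x i \<otimes> y j) \<otimes> (x i \<otimes> y j)\<^sup>\<star>) = x i \<otimes> (x i)\<^sup>\<star>" .
  qed (use xy in auto)
  also have "\<dots> = u"
    by (rule frame_sum[OF assms(3)])
  finally show ?thesis
    unfolding frame_def using fin fib assms(1,2) by (simp add: fib_mult)
qed

section \<open>Operators between fibres\<close>

lemma mpD: "\<lbrakk>a \<in> mp s t; x \<in> fib t\<rbrakk> \<Longrightarrow> a \<otimes> x \<in> fib s"
  by (simp add: mp_def)

lemma submodule_mp: assumes "s \<in> P" shows "submodule (mp s t) complex_field A"
proof (rule submoduleI)
  note S = submodule_zero[OF submodule_fib[OF assms]] submoduleE(5)[OF submodule_fib[OF assms]] submodule_scale[OF submodule_fib[OF assms]]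
  show "\<zero> \<in> mp s t"
    using S by (auto simp: mp_def fib_carrier)
  show "\<ominus> a \<in> mp s t" if "a \<in> mp s t" for a
    using S that by (auto simp: mp_def minus_eq_scale smult_mult_left fib_carrier)
  show "a \<oplus> b \<in> mp s t" if "a \<in> mp s t" "b \<in> mp s t" for a b
    using S that by (auto simp: mp_def distrib_right fib_carrier)
  show "c \<odot> a \<in> mp s t" if "a \<in> mp s t" for a c
    using S that by (auto simp: mp_def smult_mult_left fib_carrier)
qed (auto simp: mp_def)

lemma mp_mult: "\<lbrakk>a \<in> mp r s; b \<in> mp s t\<rbrakk> \<Longrightarrow> a \<otimes> b \<in> mp r t"
  by (auto simp: mp_def mult_assoc fib_carrier)

lemma mp_star:
  assumes "s \<in> P" "t \<in> P" "a \<in> mp s t"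
  shows "a\<^sup>\<star> \<in> mp t s"
proof -
  have a: "a \<in> carrier A"
    using assms by auto
  have "f\<^sup>\<star> \<otimes> (a\<^sup>\<star> \<otimes> x) \<in> scalars" if x: "x \<in> fib s" and f: "f \<in> B t" for x f
  proof -
    have "f\<^sup>\<star> \<otimes> (a\<^sup>\<star> \<otimes> x) = (a \<otimes> f)\<^sup>\<star> \<otimes> x"
      using f assms a x by (simp add: star_mult mult_assoc fib_carrier)
    then show ?thesis
      using assms f x by (auto intro: inner_in_scalars mpD basis_fib)
  qed
  then show ?thesis
    using a by (auto simp: mp_def fib_def)
qed

text \<open>Products of \<open>B t\<close> and \<open>B r\<close> form a frame of
  \<open>fib (t r)\<close>, and \<open>a\<close> acts on their left factor; the raised operator is
  \<open>a\<close> tensor 1.\<close>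

lemma mp_raise:
  assumes "s \<in> P" "t \<in> P" "r \<in> P" "a \<in> mp s t"
  shows "a \<in> mp (s \<cdot> r) (t \<cdot> r)"
proof -
  have a: "a \<in> carrier A"
    using assms by auto
  have "a \<otimes> x \<in> fib (s \<cdot> r)" if x: "x \<in> fib (t \<cdot> r)" for x
  proof -
    have fr: "frame (t \<cdot> r) (B t \<times> B r) (\<lambda>p. fst p \<otimes> snd p)"
      using frame_mult[OF assms(2,3) frame_basis frame_basis] assms by simp
    have "a \<otimes> x = (\<Oplus>p\<in>B t \<times> B r. (a \<otimes> (fst p \<otimes> snd p)) \<otimes> ((fst p \<otimes> snd p)\<^sup>\<star> \<otimes> x))"
      using frame_pairing[OF fr] a x by (auto simp: fib_carrier)
    also have "\<dots> \<in> fib (s \<cdot> r)"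
    proof (rule sum_in_fib)
      fix p assume p: "p \<in> B t \<times> B r"
      have "a \<otimes> (fst p \<otimes> snd p) = (a \<otimes> fst p) \<otimes> snd p"
        using p a assms by (auto simp: mult_assoc)
      also have "\<dots> \<in> fib (s \<cdot> r)"
        using p assms by (intro fib_mult mpD[OF assms(4)] basis_fib) auto
      finally have "a \<otimes> (fst p \<otimes> snd p) \<in> fib (s \<cdot> r)" .
      moreover have "(fst p \<otimes> snd p)\<^sup>\<star> \<otimes> x \<in> scalars"
        using inner_in_scalars[OF P_mult[OF assms(2,3)]
            fib_mult[OF assms(2,3) basis_fib[OF assms(2)] basis_fib[OF assms(3)]] x] p by auto
      ultimately show "(a \<otimes> (fst p \<otimes> snd p)) \<otimes> ((fst p \<otimes> snd p)\<^sup>\<star> \<otimes> x) \<in> fib (s \<cdot> r)"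
        by (rule fib_mult_scalars[OF P_mult[OF assms(1,3)]])
    qed (use assms in auto)
    finally show ?thesis .
  qed
  with a show ?thesis
    by (auto simp: mp_def)
qed

text \<open>Here commutativity of \<open>G\<close> enters: \<open>fib (t r)\<close> is also
  \<open>fib (r t)\<close>. The operator remains \<open>a\<close> tensor 1 for the old order of the
  factors and need not respect the factorisation with \<open>r\<close> on the left.\<close>

lemma mp_raise_left:
  "\<lbrakk>s \<in> P; t \<in> P; r \<in> P; a \<in> mp s t\<rbrakk> \<Longrightarrow> a \<in> mp (r \<cdot> s) (r \<cdot> t)"
  using mp_raise[of s t r a] by (simp add: G.m_comm)

text \<open>By \<open>mp_raise_left\<close>, \<open>a\<close> sends \<open>z x\<close> into
  \<open>fib (r s)\<close>, from which \<open>y*\<close> returns to \<open>fib s\<close>. So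
  compressions keep the pair \<open>s\<close>, \<open>t\<close> and can be iterated with constants
  that depend on this pair only.\<close>

lemma compress_mp:
  assumes "s \<in> P" "t \<in> P" "r \<in> P" "a \<in> mp s t" "y \<in> fib r" "z \<in> fib r"
  shows "y\<^sup>\<star> \<otimes> (a \<otimes> z) \<in> mp s t"
proof -
  have A: "a \<in> carrier A" "y \<in> carrier A" "z \<in> carrier A"
    using assms by auto
  have "y\<^sup>\<star> \<otimes> (a \<otimes> z) \<otimes> x \<in> fib s" if x: "x \<in> fib t" for x
  proof -
    have "y\<^sup>\<star> \<otimes> (a \<otimes> z) \<otimes> x = y\<^sup>\<star> \<otimes> (a \<otimes> (z \<otimes> x))"
      using A x by (auto simp: mult_assoc fib_carrier)
    also have "\<dots> \<in> fib s"
      by (intro fib_cancel[OF assms(3,1,5)] mpD[OF mp_raise_left[OF assms(1-4)]] fib_mult assms x)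
    finally show ?thesis .
  qed
  then show ?thesis
    using A by (simp add: mp_def)
qed

text \<open>Insert \<open>\<Sum>\<^sub>j y\<^sub>j y\<^sub>j\<^sup>* = u\<close> to the right of \<open>a\<close>; the scalars \<open>x\<^sub>i\<^sup>* a y\<^sub>j\<close> commute with everything.\<close>

lemma frame_trace:
  assumes "s \<in> P" "t \<in> P" "frame s I x" "frame t J y" "a \<in> mp s t"
  shows "(\<Oplus>i\<in>I. (x i)\<^sup>\<star> \<otimes> (a \<otimes> x i)) = (\<Oplus>j\<in>J. (y j)\<^sup>\<star> \<otimes> (a \<otimes> y j))"
proof -
  have fin: "finite I" "finite J" and fib: "\<And>i. i \<in> I \<Longrightarrow> x i \<in> fib s" "\<And>j. j \<in> J \<Longrightarrow> y j \<in> fib t"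
    using assms by (auto intro: frame_fib frame_finite)
  have A: "\<And>i. i \<in> I \<Longrightarrow> x i \<in> carrier A" "\<And>j. j \<in> J \<Longrightarrow> y j \<in> carrier A" "a \<in> carrier A"
    using fib assms by auto
  have sc: "(x i)\<^sup>\<star> \<otimes> (a \<otimes> y j) \<in> scalars" if "i \<in> I" "j \<in> J" for i j
    using that assms fib by (intro inner_in_scalars[of s] mpD) auto
  have "(\<Oplus>i\<in>I. (x i)\<^sup>\<star> \<otimes> (a \<otimes> x i)) =
      (\<Oplus>i\<in>I. \<Oplus>j\<in>J. ((x i)\<^sup>\<star> \<otimes> (a \<otimes> y j)) \<otimes> ((y j)\<^sup>\<star> \<otimes> x i))"
  proof (intro sum_cong refl)
    fix i assume i: "i \<in> I"
    show "(x i)\<^sup>\<star> \<otimes> (a \<otimes> x i) = (\<Oplus>j\<in>J. ((x i)\<^sup>\<star> \<otimes> (a \<otimes> y j)) \<otimes> ((y j)\<^sup>\<star> \<otimes> x i))"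
      using frame_pairing[OF assms(4), of "(x i)\<^sup>\<star> \<otimes> a" "x i"] i A
      by (simp add: mult_assoc cong: sum_cong)
  qed (use A in auto)
  also have "\<dots> = (\<Oplus>i\<in>I. \<Oplus>j\<in>J. ((y j)\<^sup>\<star> \<otimes> x i) \<otimes> ((x i)\<^sup>\<star> \<otimes> (a \<otimes> y j)))"
    using A sc by (intro sum_cong refl) (auto simp: scalars_mult mult_scalars)
  also have "\<dots> = (\<Oplus>j\<in>J. \<Oplus>i\<in>I. ((y j)\<^sup>\<star> \<otimes> x i) \<otimes> ((x i)\<^sup>\<star> \<otimes> (a \<otimes> y j)))"
    using fin A by (intro sum_swap) auto
  also have "\<dots> = (\<Oplus>j\<in>J. (y j)\<^sup>\<star> \<otimes> (a \<otimes> y j))"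
    using A by (intro sum_cong refl frame_pairing[OF assms(3)]) auto
  finally show ?thesis .
qed

subsection \<open>The grading\<close>

lemma deg_memI: "\<lbrakk>s \<in> P; t \<in> P; a \<in> mp s t; s \<cdot> inv\<^bsub>G\<^esub> t = g\<rbrakk> \<Longrightarrow> a \<in> deg g"
  by (auto simp: deg_def)

lemma quotient_eqD:
  assumes "s \<in> P" "t \<in> P" "s' \<in> P" "t' \<in> P" "s \<cdot> inv\<^bsub>G\<^esub> t = s' \<cdot> inv\<^bsub>G\<^esub> t'"
  shows "s \<cdot> t' = s' \<cdot> t"
proof -
  have *: "(s \<cdot> inv\<^bsub>G\<^esub> t) \<cdot> (t \<cdot> t') = s \<cdot> t'"
    if "s \<in> P" "t \<in> P" "t' \<in> P" for s t t'
  proof -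
    have "(s \<cdot> inv\<^bsub>G\<^esub> t) \<cdot> (t \<cdot> t') = s \<cdot> (inv\<^bsub>G\<^esub> t \<cdot> t) \<cdot> t'"
      using that by (simp only: G.m_assoc G.m_closed G.inv_closed P_carrier)
    then show ?thesis
      using that by (simp only: G.l_inv G.r_one P_carrier)
  qed
  show ?thesis
    using *[OF assms(1,2,4)] *[OF assms(3,4,2)] assms(5) G.m_comm[OF P_carrier P_carrier, OF assms(2,4)]
    by simp
qed

lemma fib_deg:
  assumes "t \<in> P" "x \<in> fib t" shows "x \<in> deg t"
proof (rule deg_memI[of t "\<one>\<^bsub>G\<^esub>"])
  show "x \<in> mp t \<one>\<^bsub>G\<^esub>"
    using assms fib_mult[of t "\<one>\<^bsub>G\<^esub>" x] by (auto simp: mp_def)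
qed (use assms in auto)

lemma deg_in_carrier: "a \<in> deg g \<Longrightarrow> g \<in> carrier G"
  by (auto simp: deg_def)

lemma deg_star: assumes "a \<in> deg g" shows "a\<^sup>\<star> \<in> deg (inv\<^bsub>G\<^esub> g)"
proof -
  obtain s t where st: "s \<in> P" "t \<in> P" "s \<cdot> inv\<^bsub>G\<^esub> t = g" "a \<in> mp s t"
    using assms by (auto simp: deg_def)
  have "t \<cdot> inv\<^bsub>G\<^esub> s = inv\<^bsub>G\<^esub> g"
    using st by (simp add: G.inv_mult_group flip: st(3))
  then show ?thesis
    using st mp_star by (intro deg_memI[of t s]) auto
qed

lemma deg_mult:
  assumes "a \<in> deg g" "b \<in> deg h" shows "a \<otimes> b \<in> deg (g \<cdot> h)"
proof -
  obtain s t where st: "s \<in> P" "t \<in> P" "s \<cdot> inv\<^bsub>G\<^esub> t = g" "a \<in> mp s t"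
    using assms by (auto simp: deg_def)
  obtain s' t' where st': "s' \<in> P" "t' \<in> P" "s' \<cdot> inv\<^bsub>G\<^esub> t' = h" "b \<in> mp s' t'"
    using assms by (auto simp: deg_def)
  \<comment> \<open>The middle fibre \<open>t s'\<close> becomes common by raising \<open>a\<close>
    on the right and \<open>b\<close> on the left.\<close>
  have "a \<in> mp (s \<cdot> s') (t \<cdot> s')" "b \<in> mp (t \<cdot> s') (t \<cdot> t')"
    using st st' mp_raise mp_raise_left by auto
  then have ab: "a \<otimes> b \<in> mp (s \<cdot> s') (t \<cdot> t')"
    by (rule mp_mult)
  have "s \<cdot> s' \<cdot> inv\<^bsub>G\<^esub> (t \<cdot> t') = (s \<cdot> inv\<^bsub>G\<^esub> t) \<cdot> (s' \<cdot> inv\<^bsub>G\<^esub> t')"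
    using st(1,2) st'(1,2) by (simp add: G.inv_mult_group G.m_ac)
  then show ?thesis
    using st st' ab by (intro deg_memI[of "s \<cdot> s'" "t \<cdot> t'"]) auto
qed

lemma deg_add:
  assumes "a \<in> deg g" "b \<in> deg g" shows "a \<oplus> b \<in> deg g"
proof -
  obtain s t where st: "s \<in> P" "t \<in> P" "s \<cdot> inv\<^bsub>G\<^esub> t = g" "a \<in> mp s t"
    using assms by (auto simp: deg_def)
  obtain s' t' where st': "s' \<in> P" "t' \<in> P" "s' \<cdot> inv\<^bsub>G\<^esub> t' = g" "b \<in> mp s' t'"
    using assms by (auto simp: deg_def)
  \<comment> \<open>Equal quotients make the two pairs of indices agree after multiplication by
    \<open>t'\<close> and \<open>t\<close>, like fractions brought to a common denominator.\<close>
  have eq: "s' \<cdot> t = s \<cdot> t'"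
    using quotient_eqD[OF st'(1,2) st(1,2)] st(3) st'(3) by simp
  have "b \<in> mp (s' \<cdot> t) (t' \<cdot> t)" "a \<in> mp (s \<cdot> t') (t \<cdot> t')"
    using st st' by (auto intro: mp_raise)
  then have "b \<in> mp (s \<cdot> t') (t \<cdot> t')" "a \<in> mp (s \<cdot> t') (t \<cdot> t')"
    using st st' eq by (simp_all add: G.m_comm)
  then have ab: "a \<oplus> b \<in> mp (s \<cdot> t') (t \<cdot> t')"
    using st st' by (intro submoduleE(5)[OF submodule_mp]) auto
  have "s \<cdot> t' \<cdot> inv\<^bsub>G\<^esub> (t \<cdot> t') = (s \<cdot> inv\<^bsub>G\<^esub> t) \<cdot> (t' \<cdot> inv\<^bsub>G\<^esub> t')"
    using st(1,2) st'(1,2)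
    by (simp only: G.inv_mult_group G.m_ac G.m_closed G.inv_closed P_carrier)
  also have "\<dots> = g"
    using st st'(1,2) by auto
  finally show ?thesis
    using st st' ab by (intro deg_memI[of "s \<cdot> t'" "t \<cdot> t'"]) auto
qed

lemma deg_scale: "a \<in> deg g \<Longrightarrow> c \<odot> a \<in> deg g"
  unfolding deg_def using submodule_scale[OF submodule_mp] by blast

lemma compress_deg:
  assumes "a \<in> deg g" "r \<in> P" "y \<in> fib r" "z \<in> fib r" shows "y\<^sup>\<star> \<otimes> (a \<otimes> z) \<in> deg g"
  using assms compress_mp unfolding deg_def by blast

end

subsection \<open>Random phases\<close>

text \<open>Fourth roots of unity: \<open>w\<close> and \<open>w^2\<close> both have mean zero over
  them, which makes 1, \<open>w\<close> and \<open>cnj w\<close> orthogonal. Signs alone would not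
  separate \<open>w\<close> from \<open>cnj w\<close>.\<close>

definition phases :: "complex set" where "phases = {1, -1, \<i>, -\<i>}"

lemma sum_phases: "(\<Sum>w\<in>phases. F w) = F 1 + F (-1) + F \<i> + F (-\<i>)"
proof -
  have "(1::complex) \<noteq> -1" "\<i> \<noteq> -\<i>" "\<i> \<noteq> -1" "\<i> \<noteq> 1" "-\<i> \<noteq> 1" "-\<i> \<noteq> -1"
    by (simp_all add: complex_eq_iff)
  then show ?thesis
    by (simp add: phases_def add.assoc)
qed

lemma phases_finite [simp]: "finite phases"
  by (simp add: phases_def)

lemma card_phases [simp]: "card phases = 4"
  by (simp add: phases_def complex_eq_iff card_insert_if)

lemma card_PiE_phases: "finite S \<Longrightarrow> card (PiE S (\<lambda>_. phases)) = 4 ^ card S"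
  by (simp add: card_PiE prod_constant)

lemma sum_phases_square:
  "(\<Sum>w\<in>phases. (cmod (x + w * p + cnj w * q))\<^sup>2) = 4 * ((cmod x)\<^sup>2 + (cmod p)\<^sup>2 + (cmod q)\<^sup>2)"
  unfolding sum_phases cmod_power2 by (simp add: power2_eq_square algebra_simps)

lemma sum_PiE_insert:
  assumes "b \<notin> S"
  shows "(\<Sum>\<zeta>\<in>PiE (insert b S) (\<lambda>_. T). F \<zeta>) = (\<Sum>\<zeta>\<in>PiE S (\<lambda>_. T). \<Sum>w\<in>T. F (\<zeta>(b := w)))"
proof -
  have "(\<Sum>\<zeta>\<in>PiE (insert b S) (\<lambda>_. T). F \<zeta>) = (\<Sum>(w, \<zeta>)\<in>T \<times> PiE S (\<lambda>_. T). F (\<zeta>(b := w)))"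
    unfolding PiE_insert_eq using inj_combinator[OF assms, of "\<lambda>_. T"]
    by (subst sum.reindex) (auto simp: case_prod_unfold)
  also have "\<dots> = (\<Sum>w\<in>T. \<Sum>\<zeta>\<in>PiE S (\<lambda>_. T). F (\<zeta>(b := w)))"
    by (simp add: sum.cartesian_product)
  also have "\<dots> = (\<Sum>\<zeta>\<in>PiE S (\<lambda>_. T). \<Sum>w\<in>T. F (\<zeta>(b := w)))"
    by (rule sum.swap)
  finally show ?thesis .
qed

lemma sum_phases_linear:
  assumes "finite S"
  shows "(\<Sum>\<zeta>\<in>PiE S (\<lambda>_. phases). (cmod (\<Sum>k\<in>S. \<zeta> k * c k))\<^sup>2) = 4 ^ card S * (\<Sum>k\<in>S. (cmod (c k))\<^sup>2)"
  using assms
proof (induction S)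
  case (insert b S)
  \<comment> \<open>The vanishing last summand brings the expression into the form of
    \<open>sum_phases_square\<close>.\<close>
  have eq: "(\<Sum>k\<in>insert b S. (\<zeta>(b := w)) k * c k) = (\<Sum>k\<in>S. \<zeta> k * c k) + w * c b + cnj w * 0" for \<zeta> w
  proof -
    have "(\<Sum>k\<in>S. (\<zeta>(b := w)) k * c k) = (\<Sum>k\<in>S. \<zeta> k * c k)"
      using insert by (intro sum.cong) auto
    with insert show ?thesis by simp
  qed
  show ?case
    unfolding sum_PiE_insert[OF insert(2)] eq sum_phases_square
    using insert by (simp add: card_PiE_phases sum.distrib algebra_simps flip: sum_distrib_left)
qed simp

text \<open>Diagonal terms are constant because \<open>cnj w * w = 1\<close>, and distinct
  off-diagonal terms are uncorrelated. The offset \<open>x\<close> serves the induction: for fixed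
  earlier phases, the new one adds \<open>c b b\<close> to the offset and contributes one term in
  \<open>w\<close> and one in \<open>cnj w\<close>.\<close>

lemma sum_phases_quadratic:
  assumes "finite S"
  shows "(\<Sum>\<zeta>\<in>PiE S (\<lambda>_. phases). (cmod (x + (\<Sum>k\<in>S. \<Sum>l\<in>S. cnj (\<zeta> k) * \<zeta> l * c k l)))\<^sup>2) =
    4 ^ card S * ((cmod (x + (\<Sum>k\<in>S. c k k)))\<^sup>2 + (\<Sum>k\<in>S. \<Sum>l\<in>S - {k}. (cmod (c k l))\<^sup>2))"
  using assms
proof (induction S arbitrary: x)
  case (insert b S)
  let ?Q = "\<lambda>\<zeta>. \<Sum>k\<in>S. \<Sum>l\<in>S. cnj (\<zeta> k) * \<zeta> l * c k l"
  let ?p = "\<lambda>\<zeta>. \<Sum>k\<in>S. cnj (\<zeta> k) * c k b"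
  let ?q = "\<lambda>\<zeta>. \<Sum>l\<in>S. \<zeta> l * c b l"
  have eq: "x + (\<Sum>k\<in>insert b S. \<Sum>l\<in>insert b S. cnj ((\<zeta>(b := w)) k) * (\<zeta>(b := w)) l * c k l) =
      (x + c b b + ?Q \<zeta>) + w * ?p \<zeta> + cnj w * ?q \<zeta>" if w: "w \<in> phases" for \<zeta> w
  proof -
    have ww: "cnj w * w = 1"
      using w by (auto simp: phases_def)
    have upd: "(\<zeta>(b := w)) k = \<zeta> k" if "k \<in> S" for k
      using that insert by auto
    have split: "(\<Sum>l\<in>insert b S. cnj ((\<zeta>(b := w)) k) * (\<zeta>(b := w)) l * c k l) =
        cnj ((\<zeta>(b := w)) k) * w * c k b + cnj ((\<zeta>(b := w)) k) * (\<Sum>l\<in>S. \<zeta> l * c k l)" for k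
    proof -
      have "(\<Sum>l\<in>S. cnj ((\<zeta>(b := w)) k) * (\<zeta>(b := w)) l * c k l) =
          cnj ((\<zeta>(b := w)) k) * (\<Sum>l\<in>S. \<zeta> l * c k l)"
        unfolding sum_distrib_left by (intro sum.cong refl) (simp only: upd mult.assoc)
      with insert show ?thesis by simp
    qed
    have row: "(\<Sum>l\<in>insert b S. cnj ((\<zeta>(b := w)) k) * (\<zeta>(b := w)) l * c k l) =
        (\<Sum>l\<in>S. cnj (\<zeta> k) * \<zeta> l * c k l) + w * (cnj (\<zeta> k) * c k b)" if "k \<in> S" for k
      by (subst split) (simp only: upd[OF that] sum_distrib_left mult_ac add_ac)
    have "(\<Sum>l\<in>insert b S. cnj ((\<zeta>(b := w)) b) * (\<zeta>(b := w)) l * c b l) = c b b + cnj w * ?q \<zeta>"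
      unfolding split using ww by simp
    moreover have "(\<Sum>k\<in>S. \<Sum>l\<in>insert b S. cnj ((\<zeta>(b := w)) k) * (\<zeta>(b := w)) l * c k l) = ?Q \<zeta> + w * ?p \<zeta>"
      by (simp only: row sum.distrib sum_distrib_left cong: sum.cong)
    ultimately show ?thesis
      by (simp only: sum.insert[OF insert(1,2), of "\<lambda>k. \<Sum>l\<in>insert b S. cnj ((\<zeta>(b := w)) k) * (\<zeta>(b := w)) l * c k l"] add_ac)
  qed
  have p: "(\<Sum>\<zeta>\<in>PiE S (\<lambda>_. phases). (cmod (?p \<zeta>))\<^sup>2) = 4 ^ card S * (\<Sum>k\<in>S. (cmod (c k b))\<^sup>2)"
  proof -
    have "cmod (?p \<zeta>) = cmod (\<Sum>k\<in>S. \<zeta> k * cnj (c k b))" for \<zeta>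
      by (subst complex_mod_cnj[symmetric]) simp
    then show ?thesis
      using sum_phases_linear[OF insert(1), of "\<lambda>k. cnj (c k b)"] by simp
  qed
  have q: "(\<Sum>\<zeta>\<in>PiE S (\<lambda>_. phases). (cmod (?q \<zeta>))\<^sup>2) = 4 ^ card S * (\<Sum>l\<in>S. (cmod (c b l))\<^sup>2)"
    using sum_phases_linear[OF insert(1)] .
  have rows: "(\<Sum>k\<in>insert b S. \<Sum>l\<in>insert b S - {k}. (cmod (c k l))\<^sup>2) =
      (\<Sum>l\<in>S. (cmod (c b l))\<^sup>2) + ((\<Sum>k\<in>S. (cmod (c k b))\<^sup>2) + (\<Sum>k\<in>S. \<Sum>l\<in>S - {k}. (cmod (c k l))\<^sup>2))"
  proof -
    have "insert b S - {b} = S" using insert by auto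
    moreover have "(\<Sum>l\<in>insert b S - {k}. (cmod (c k l))\<^sup>2) = (cmod (c k b))\<^sup>2 + (\<Sum>l\<in>S - {k}. (cmod (c k l))\<^sup>2)"
      if "k \<in> S" for k
    proof -
      have "insert b S - {k} = insert b (S - {k})" using insert that by auto
      then show ?thesis using insert by simp
    qed
    ultimately show ?thesis
      using insert by (simp add: sum.distrib cong: sum.cong)
  qed
  have "(\<Sum>\<zeta>\<in>PiE (insert b S) (\<lambda>_. phases).
      (cmod (x + (\<Sum>k\<in>insert b S. \<Sum>l\<in>insert b S. cnj (\<zeta> k) * \<zeta> l * c k l)))\<^sup>2) =
    (\<Sum>\<zeta>\<in>PiE S (\<lambda>_. phases). \<Sum>w\<in>phases. (cmod ((x + c b b + ?Q \<zeta>) + w * ?p \<zeta> + cnj w * ?q \<zeta>))\<^sup>2)"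
    unfolding sum_PiE_insert[OF insert(2)] by (intro sum.cong refl) (simp only: eq)
  also have "\<dots> = (\<Sum>\<zeta>\<in>PiE S (\<lambda>_. phases). 4 * ((cmod (x + c b b + ?Q \<zeta>))\<^sup>2 + (cmod (?p \<zeta>))\<^sup>2 + (cmod (?q \<zeta>))\<^sup>2))"
    by (simp only: sum_phases_square)
  also have "\<dots> = 4 * ((\<Sum>\<zeta>\<in>PiE S (\<lambda>_. phases). (cmod (x + c b b + ?Q \<zeta>))\<^sup>2)
      + (\<Sum>\<zeta>\<in>PiE S (\<lambda>_. phases). (cmod (?p \<zeta>))\<^sup>2) + (\<Sum>\<zeta>\<in>PiE S (\<lambda>_. phases). (cmod (?q \<zeta>))\<^sup>2))"
    by (simp only: sum.distrib flip: sum_distrib_left)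
  also have "\<dots> = 4 * 4 ^ card S * ((cmod (x + (\<Sum>k\<in>insert b S. c k k)))\<^sup>2 +
      (\<Sum>k\<in>insert b S. \<Sum>l\<in>insert b S - {k}. (cmod (c k l))\<^sup>2))"
    unfolding insert.IH p q rows using insert by (simp add: algebra_simps)
  finally show ?case
    using insert by simp
qed simp

lemma sum_rotate:
  "(\<Sum>i\<in>I. \<Sum>j\<in>J. \<Sum>k\<in>K. h i j k) = (\<Sum>k\<in>K. \<Sum>i\<in>I. \<Sum>j\<in>J. h i j k)"
proof -
  have "(\<Sum>i\<in>I. \<Sum>j\<in>J. \<Sum>k\<in>K. h i j k) = (\<Sum>i\<in>I. \<Sum>k\<in>K. \<Sum>j\<in>J. h i j k)"
    by (rule sum.cong[OF refl], rule sum.swap)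
  also have "\<dots> = (\<Sum>k\<in>K. \<Sum>i\<in>I. \<Sum>j\<in>J. h i j k)"
    by (rule sum.swap)
  finally show ?thesis .
qed

section \<open>Hilbert-Schmidt norms and contracting compressions\<close>

context cuntz_family
begin

lemma coeff_in_scalars:
  "\<lbrakk>s \<in> P; t \<in> P; a \<in> mp s t; e \<in> B s; f \<in> B t\<rbrakk> \<Longrightarrow> e\<^sup>\<star> \<otimes> (a \<otimes> f) \<in> scalars"
  using mpD[of a s t f] basis_fib[of t f] by (auto simp: fib_def)

text \<open>Matrix entries of \<open>a\<close> as an operator from \<open>fib t\<close> to
  \<open>fib s\<close>. They make the phase identities for complex numbers available in
  \<open>A\<close>.\<close>

definition coeff :: "'a \<Rightarrow> 'a \<Rightarrow> 'a \<Rightarrow> complex" where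
  "coeff e f a = scalar_of (e\<^sup>\<star> \<otimes> (a \<otimes> f))"

lemma coeff_scale:
  assumes "s \<in> P" "t \<in> P" "a \<in> mp s t" "e \<in> B s" "f \<in> B t"
  shows "coeff e f (c \<odot> a) = c * coeff e f a"
proof -
  have "e\<^sup>\<star> \<otimes> (c \<odot> a \<otimes> f) = c \<odot> (e\<^sup>\<star> \<otimes> (a \<otimes> f))"
    using assms by (simp add: smult_mult_left smult_mult_right mp_carrier)
  moreover obtain d where "e\<^sup>\<star> \<otimes> (a \<otimes> f) = d \<odot> u"
    using coeff_in_scalars[OF assms] by (auto simp: scalars_def)
  ultimately show ?thesis
    by (simp add: coeff_def)
qed

lemma coeff_sum:
  assumes "finite I" "s \<in> P" "t \<in> P" "\<And>i. i \<in> I \<Longrightarrow> a i \<in> mp s t" "e \<in> B s" "f \<in> B t"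
  shows "coeff e f (\<Oplus>i\<in>I. a i) = (\<Sum>i\<in>I. coeff e f (a i))"
proof -
  have a: "a i \<in> carrier A" if "i \<in> I" for i
    using assms that by auto
  have "e\<^sup>\<star> \<otimes> ((\<Oplus>i\<in>I. a i) \<otimes> f) = (\<Oplus>i\<in>I. e\<^sup>\<star> \<otimes> (a i \<otimes> f))"
    using a assms by (simp add: sum_mult_left sum_mult_right)
  then show ?thesis
    using assms by (simp add: coeff_def scalar_of_sum coeff_in_scalars)
qed

text \<open>The square of the Hilbert-Schmidt norm of \<open>a\<close> on \<open>fib t\<close>.
  Unlike the C*-norm it is a sum of squared moduli of coefficients, for which averages over phases
  can be computed exactly.\<close>

definition hs :: "'g \<Rightarrow> 'a \<Rightarrow> real" where
  "hs t a = (\<Sum>f\<in>B t. \<parallel>a \<otimes> f\<parallel>\<^sup>2)"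

lemma hs_nonneg: "0 \<le> hs t a"
  by (simp add: hs_def sum_nonneg)

lemma hs_eq_coeff:
  assumes "s \<in> P" "t \<in> P" "a \<in> mp s t"
  shows "hs t a = (\<Sum>f\<in>B t. \<Sum>e\<in>B s. (cmod (coeff e f a))\<^sup>2)"
  unfolding hs_def
proof (intro sum.cong refl)
  fix f assume f: "f \<in> B t"
  have "\<parallel>a \<otimes> f\<parallel>\<^sup>2 = (\<Sum>e\<in>B s. \<parallel>e\<^sup>\<star> \<otimes> (a \<otimes> f)\<parallel>\<^sup>2)"
    by (rule parseval[OF assms(1) mpD[OF assms(3) basis_fib[OF assms(2) f]] frame_basis[OF assms(1)]])
  also have "\<dots> = (\<Sum>e\<in>B s. (cmod (coeff e f a))\<^sup>2)"
    using assms f by (intro sum.cong refl) (simp add: coeff_def cmod_scalar_of coeff_in_scalars)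
  finally show "\<parallel>a \<otimes> f\<parallel>\<^sup>2 = (\<Sum>e\<in>B s. (cmod (coeff e f a))\<^sup>2)" .
qed

lemma hs_sum_le:
  assumes "finite I" "s \<in> P" "t \<in> P" "\<And>i. i \<in> I \<Longrightarrow> a i \<in> mp s t"
  shows "hs t (\<Oplus>i\<in>I. a i) \<le> card I * (\<Sum>i\<in>I. hs t (a i))"
proof -
  have sum_mp: "(\<Oplus>i\<in>I. a i) \<in> mp s t"
    using assms by (intro sum_in_submodule[OF submodule_mp])
  have "(cmod (\<Sum>i\<in>I. coeff e f (a i)))\<^sup>2 \<le> card I * (\<Sum>i\<in>I. (cmod (coeff e f (a i)))\<^sup>2)" for e f
  proof -
    have "(cmod (\<Sum>i\<in>I. coeff e f (a i)))\<^sup>2 \<le> (\<Sum>i\<in>I. cmod (coeff e f (a i)))\<^sup>2"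
      by (intro power_mono norm_sum) auto
    also have "\<dots> \<le> (\<Sum>i\<in>I. (cmod (coeff e f (a i)))\<^sup>2) * card I"
      by (rule sum_squared_le_sum_of_squares)
    finally show ?thesis by (simp add: mult.commute)
  qed
  then have "hs t (\<Oplus>i\<in>I. a i) \<le> (\<Sum>f\<in>B t. \<Sum>e\<in>B s. card I * (\<Sum>i\<in>I. (cmod (coeff e f (a i)))\<^sup>2))"
    unfolding hs_eq_coeff[OF assms(2,3) sum_mp] using assms
    by (intro sum_mono) (simp add: coeff_sum)
  also have "\<dots> = card I * (\<Sum>f\<in>B t. \<Sum>e\<in>B s. \<Sum>i\<in>I. (cmod (coeff e f (a i)))\<^sup>2)"
    by (simp add: sum_distrib_left)
  also have "(\<Sum>f\<in>B t. \<Sum>e\<in>B s. \<Sum>i\<in>I. (cmod (coeff e f (a i)))\<^sup>2) =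
      (\<Sum>i\<in>I. \<Sum>f\<in>B t. \<Sum>e\<in>B s. (cmod (coeff e f (a i)))\<^sup>2)"
    by (rule sum_rotate)
  also have "\<dots> = (\<Sum>i\<in>I. hs t (a i))"
    using assms by (simp add: hs_eq_coeff)
  finally show ?thesis .
qed

text \<open>Both sums are traces of \<open>a* a\<close>, which maps \<open>fib t\<close> to itself;
  \<open>frame_trace\<close> with both fibres equal to \<open>fib t\<close> shows that such a trace
  does not depend on the frame.\<close>

lemma hs_frame:
  assumes "s \<in> P" "t \<in> P" "a \<in> mp s t" "frame t I x" "frame t J y"
  shows "(\<Sum>i\<in>I. \<parallel>a \<otimes> x i\<parallel>\<^sup>2) = (\<Sum>j\<in>J. \<parallel>a \<otimes> y j\<parallel>\<^sup>2)"
proof -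
  have a: "a \<in> carrier A"
    using assms by auto
  have *: "(\<Oplus>i\<in>I. (x i)\<^sup>\<star> \<otimes> ((a\<^sup>\<star> \<otimes> a) \<otimes> x i)) = complex_of_real (\<Sum>i\<in>I. \<parallel>a \<otimes> x i\<parallel>\<^sup>2) \<odot> u"
    if fr: "frame t I x" for I and x :: "'z \<Rightarrow> 'a"
  proof -
    have "(\<Oplus>i\<in>I. (x i)\<^sup>\<star> \<otimes> ((a\<^sup>\<star> \<otimes> a) \<otimes> x i)) = (\<Oplus>i\<in>I. complex_of_real (\<parallel>a \<otimes> x i\<parallel>\<^sup>2) \<odot> u)"
    proof (intro sum_cong refl)
      fix i assume i: "i \<in> I"
      have "(x i)\<^sup>\<star> \<otimes> ((a\<^sup>\<star> \<otimes> a) \<otimes> x i) = (a \<otimes> x i)\<^sup>\<star> \<otimes> (a \<otimes> x i)"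
        using i a fr by (simp add: star_mult mult_assoc frame_carrier)
      then show "(x i)\<^sup>\<star> \<otimes> ((a\<^sup>\<star> \<otimes> a) \<otimes> x i) = complex_of_real (\<parallel>a \<otimes> x i\<parallel>\<^sup>2) \<odot> u"
        using inner_self[OF assms(1) mpD[OF assms(3) frame_fib[OF fr i]]] by simp
    qed auto
    then show ?thesis
      using frame_finite[OF fr] by (simp add: sum_scale_const)
  qed
  have "a\<^sup>\<star> \<otimes> a \<in> mp t t"
    by (rule mp_mult[OF mp_star[OF assms(1-3)] assms(3)])
  from frame_trace[OF assms(2,2,4,5) this] show ?thesis
    unfolding *[OF assms(4)] *[OF assms(5)] by (simp only: scale_unit_eq_iff of_real_eq_iff)
qed

text \<open>Only the first tensor factor is expanded, so the coefficients \<open>k* y\<close> are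
  vectors of \<open>fib s\<close> instead of scalars.\<close>

lemma partial_parseval:
  assumes "r \<in> P" "s \<in> P" "y \<in> fib (r \<cdot> s)"
  shows "(\<Sum>k\<in>B r. \<parallel>k\<^sup>\<star> \<otimes> y\<parallel>\<^sup>2) = \<parallel>y\<parallel>\<^sup>2"
proof -
  have y: "y \<in> carrier A"
    using assms by auto
  have "y\<^sup>\<star> \<otimes> y = (\<Oplus>k\<in>B r. (y\<^sup>\<star> \<otimes> k) \<otimes> (k\<^sup>\<star> \<otimes> y))"
    using frame_pairing[OF frame_basis[OF assms(1)]] y by simp
  also have "\<dots> = (\<Oplus>k\<in>B r. complex_of_real (\<parallel>k\<^sup>\<star> \<otimes> y\<parallel>\<^sup>2) \<odot> u)"
  proof (intro sum_cong refl)
    fix k assume k: "k \<in> B r"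
    have "(y\<^sup>\<star> \<otimes> k) \<otimes> (k\<^sup>\<star> \<otimes> y) = (k\<^sup>\<star> \<otimes> y)\<^sup>\<star> \<otimes> (k\<^sup>\<star> \<otimes> y)"
      using k y assms by (simp add: star_mult)
    then show "(y\<^sup>\<star> \<otimes> k) \<otimes> (k\<^sup>\<star> \<otimes> y) = complex_of_real (\<parallel>k\<^sup>\<star> \<otimes> y\<parallel>\<^sup>2) \<odot> u"
      using inner_self[OF assms(2) fib_cancel[OF assms(1,2) basis_fib[OF assms(1) k] assms(3)]] by simp
  qed auto
  also have "\<dots> = complex_of_real (\<Sum>k\<in>B r. \<parallel>k\<^sup>\<star> \<otimes> y\<parallel>\<^sup>2) \<odot> u"
    using assms by (simp add: sum_scale_const)
  finally have "complex_of_real (\<parallel>y\<parallel>\<^sup>2) \<odot> u = complex_of_real (\<Sum>k\<in>B r. \<parallel>k\<^sup>\<star> \<otimes> y\<parallel>\<^sup>2) \<odot> u"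
    using inner_self[OF P_mult[OF assms(1,2)] assms(3)] by simp
  then show ?thesis
    by (simp only: scale_unit_eq_iff of_real_eq_iff)
qed

lemma nrm_fib_basis:
  assumes "s \<in> P" "r \<in> P" "x \<in> fib s" "l \<in> sphere r"
  shows "\<parallel>x \<otimes> l\<parallel> = \<parallel>x\<parallel>"
proof -
  have A: "x \<in> carrier A" "l \<in> carrier A"
    using assms by auto
  have "(x \<otimes> l)\<^sup>\<star> \<otimes> (x \<otimes> l) = l\<^sup>\<star> \<otimes> ((x\<^sup>\<star> \<otimes> x) \<otimes> l)"
    using A by (simp add: star_mult mult_assoc)
  also have "\<dots> = complex_of_real (\<parallel>x\<parallel>\<^sup>2) \<odot> u"
    unfolding inner_self[OF assms(1,3)] using A assms
    by (simp add: smult_mult_left smult_mult_right sphere_isometry)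
  finally have "\<parallel>x \<otimes> l\<parallel>\<^sup>2 = \<parallel>x\<parallel>\<^sup>2"
    using nrm_star_mult[of "x \<otimes> l"] A by (simp add: norm_power)
  then show ?thesis
    using nrm_nonneg A by (simp add: power2_eq_iff_nonneg)
qed

text \<open>Both sides are the squared Hilbert-Schmidt norm of \<open>a\<close> as an operator from
  \<open>fib (r t)\<close> to \<open>fib (r s)\<close>. In the frame of products \<open>l f\<close>
  it splits into the blocks \<open>k* a l\<close>; in the frame of products \<open>f l\<close> the
  right factor \<open>l\<close> is isometric, which gives \<open>card (B r)\<close> copies of
  \<open>hs t a\<close>. Both are frames of one fibre because \<open>G\<close> is abelian.\<close>

lemma hs_split:
  assumes "s \<in> P" "t \<in> P" "r \<in> P" "a \<in> mp s t"
  shows "(\<Sum>k\<in>B r. \<Sum>l\<in>B r. hs t (k\<^sup>\<star> \<otimes> (a \<otimes> l))) = card (B r) * hs t a"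
proof -
  have a: "a \<in> carrier A"
    using assms by auto
  have rst: "a \<in> mp (r \<cdot> s) (r \<cdot> t)"
    using assms by (intro mp_raise_left)
  have "(\<Sum>k\<in>B r. \<Sum>l\<in>B r. hs t (k\<^sup>\<star> \<otimes> (a \<otimes> l))) = (\<Sum>l\<in>B r. \<Sum>f\<in>B t. \<Sum>k\<in>B r. \<parallel>k\<^sup>\<star> \<otimes> (a \<otimes> l) \<otimes> f\<parallel>\<^sup>2)"
    unfolding hs_def by (rule sum_rotate[symmetric])
  also have "\<dots> = (\<Sum>l\<in>B r. \<Sum>f\<in>B t. \<parallel>a \<otimes> (l \<otimes> f)\<parallel>\<^sup>2)"
  proof (intro sum.cong refl)
    fix l f assume lf: "l \<in> B r" "f \<in> B t"
    have "(\<Sum>k\<in>B r. \<parallel>k\<^sup>\<star> \<otimes> (a \<otimes> l) \<otimes> f\<parallel>\<^sup>2) = (\<Sum>k\<in>B r. \<parallel>k\<^sup>\<star> \<otimes> (a \<otimes> (l \<otimes> f))\<parallel>\<^sup>2)"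
      using lf assms a by (intro sum.cong refl) (simp add: mult_assoc)
    also have "\<dots> = \<parallel>a \<otimes> (l \<otimes> f)\<parallel>\<^sup>2"
      using assms lf by (intro partial_parseval[of r s] mpD[OF rst] fib_mult basis_fib)
    finally show "(\<Sum>k\<in>B r. \<parallel>k\<^sup>\<star> \<otimes> (a \<otimes> l) \<otimes> f\<parallel>\<^sup>2) = \<parallel>a \<otimes> (l \<otimes> f)\<parallel>\<^sup>2" .
  qed
  also have "\<dots> = (\<Sum>p\<in>B r \<times> B t. \<parallel>a \<otimes> (fst p \<otimes> snd p)\<parallel>\<^sup>2)"
    by (simp add: sum.cartesian_product case_prod_unfold)
  also have "\<dots> = (\<Sum>p\<in>B t \<times> B r. \<parallel>a \<otimes> (fst p \<otimes> snd p)\<parallel>\<^sup>2)"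
  proof (rule hs_frame[OF _ _ rst])
    show "frame (r \<cdot> t) (B r \<times> B t) (\<lambda>p. fst p \<otimes> snd p)"
      using frame_mult[OF assms(3,2) frame_basis frame_basis] assms by simp
    show "frame (r \<cdot> t) (B t \<times> B r) (\<lambda>p. fst p \<otimes> snd p)"
      using frame_mult[OF assms(2,3) frame_basis frame_basis] assms by (simp add: G.m_comm)
  qed (use assms in auto)
  also have "\<dots> = (\<Sum>f\<in>B t. \<Sum>l\<in>B r. \<parallel>a \<otimes> (f \<otimes> l)\<parallel>\<^sup>2)"
    by (simp add: sum.cartesian_product case_prod_unfold)
  also have "\<dots> = (\<Sum>f\<in>B t. \<Sum>l\<in>B r. \<parallel>a \<otimes> f\<parallel>\<^sup>2)"
  proof (intro sum.cong refl)
    fix f l assume fl: "f \<in> B t" "l \<in> B r"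
    have "a \<otimes> (f \<otimes> l) = (a \<otimes> f) \<otimes> l"
      using fl assms a by (simp add: mult_assoc)
    then show "\<parallel>a \<otimes> (f \<otimes> l)\<parallel>\<^sup>2 = \<parallel>a \<otimes> f\<parallel>\<^sup>2"
      using nrm_fib_basis[OF assms(1,3) mpD[OF assms(4) basis_fib] basis_sphere] fl assms by simp
  qed
  also have "\<dots> = card (B r) * hs t a"
    by (simp add: hs_def sum_distrib_left)
  finally show ?thesis .
qed

lemma hs_diagonal_le:
  assumes "s \<in> P" "t \<in> P" "r \<in> P" "a \<in> mp s t"
  shows "(\<Sum>k\<in>B r. hs t (k\<^sup>\<star> \<otimes> (a \<otimes> k))) \<le> card (B r) * hs t a"
  unfolding hs_split[OF assms, symmetric]
  using assms by (intro sum_mono member_le_sum) (auto simp: hs_nonneg)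

definition phase_vector :: "'g \<Rightarrow> ('a \<Rightarrow> complex) \<Rightarrow> 'a" where
  "phase_vector r \<zeta> = complex_of_real (1 / sqrt (card (B r))) \<odot> (\<Oplus>k\<in>B r. \<zeta> k \<odot> k)"

lemma compress_phase_vector:
  assumes r: "r \<in> P" and a: "a \<in> carrier A"
  shows "(phase_vector r \<zeta>)\<^sup>\<star> \<otimes> (a \<otimes> phase_vector r \<zeta>) =
    complex_of_real (1 / card (B r)) \<odot> (\<Oplus>k\<in>B r. \<Oplus>l\<in>B r. (cnj (\<zeta> k) * \<zeta> l) \<odot> (k\<^sup>\<star> \<otimes> (a \<otimes> l)))"
proof -
  let ?v = "\<Oplus>k\<in>B r. \<zeta> k \<odot> k"
  have v: "?v \<in> carrier A"
    using r by auto
  have av: "a \<otimes> ?v = (\<Oplus>l\<in>B r. \<zeta> l \<odot> (a \<otimes> l))"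
  proof -
    have "a \<otimes> ?v = (\<Oplus>l\<in>B r. a \<otimes> (\<zeta> l \<odot> l))"
      using r a by (intro sum_mult_left) auto
    also have "\<dots> = (\<Oplus>l\<in>B r. \<zeta> l \<odot> (a \<otimes> l))"
      using r a by (intro sum_cong refl) (auto simp: smult_mult_right)
    finally show ?thesis .
  qed
  have "?v\<^sup>\<star> = (\<Oplus>k\<in>B r. (\<zeta> k \<odot> k)\<^sup>\<star>)"
    using r by (intro star_sum) auto
  then have "?v\<^sup>\<star> \<otimes> (a \<otimes> ?v) = (\<Oplus>k\<in>B r. (\<zeta> k \<odot> k)\<^sup>\<star> \<otimes> (a \<otimes> ?v))"
    using r a v by (simp add: sum_mult_right)
  also have "\<dots> = (\<Oplus>k\<in>B r. \<Oplus>l\<in>B r. (cnj (\<zeta> k) * \<zeta> l) \<odot> (k\<^sup>\<star> \<otimes> (a \<otimes> l)))"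
  proof (intro sum_cong refl)
    fix k assume k: "k \<in> B r"
    have "(\<zeta> k \<odot> k)\<^sup>\<star> \<otimes> (a \<otimes> ?v) = (\<Oplus>l\<in>B r. (\<zeta> k \<odot> k)\<^sup>\<star> \<otimes> (\<zeta> l \<odot> (a \<otimes> l)))"
      unfolding av using k r a by (intro sum_mult_left) auto
    also have "\<dots> = (\<Oplus>l\<in>B r. (cnj (\<zeta> k) * \<zeta> l) \<odot> (k\<^sup>\<star> \<otimes> (a \<otimes> l)))"
      using k r a by (intro sum_cong refl) (auto simp: star_smult smult_mult_left smult_mult_right mult.commute)
    finally show "(\<zeta> k \<odot> k)\<^sup>\<star> \<otimes> (a \<otimes> ?v) = (\<Oplus>l\<in>B r. (cnj (\<zeta> k) * \<zeta> l) \<odot> (k\<^sup>\<star> \<otimes> (a \<otimes> l)))" .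
  qed (use r a in auto)
  finally have main: "?v\<^sup>\<star> \<otimes> (a \<otimes> ?v) = (\<Oplus>k\<in>B r. \<Oplus>l\<in>B r. (cnj (\<zeta> k) * \<zeta> l) \<odot> (k\<^sup>\<star> \<otimes> (a \<otimes> l)))" .
  define c where "c = complex_of_real (1 / sqrt (card (B r)))"
  have c: "cnj c = c" "c * c = complex_of_real (1 / card (B r))"
    by (simp_all add: c_def del: of_real_divide flip: of_real_mult)
  have "(phase_vector r \<zeta>)\<^sup>\<star> \<otimes> (a \<otimes> phase_vector r \<zeta>) = (c * c) \<odot> (?v\<^sup>\<star> \<otimes> (a \<otimes> ?v))"
    unfolding phase_vector_def c_def[symmetric]
    using a v c(1) by (simp add: star_smult smult_mult_left smult_mult_right)
  then show ?thesis
    unfolding main c(2) .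
qed

lemma phase_vector_sphere:
  assumes r: "r \<in> P" and \<zeta>: "\<zeta> \<in> PiE (B r) (\<lambda>_. phases)"
  shows "phase_vector r \<zeta> \<in> sphere r"
proof (rule sphereI)
  have d: "card (B r) > 0"
    using r basis_nonempty by (simp add: card_gt_0_iff)
  have pv: "phase_vector r \<zeta> \<in> fib r"
    unfolding phase_vector_def using r
    by (intro submodule_scale[OF submodule_fib] sum_in_fib) (auto intro: basis_fib)
  then show "phase_vector r \<zeta> \<in> fib r" .
  have "(phase_vector r \<zeta>)\<^sup>\<star> \<otimes> phase_vector r \<zeta> = (phase_vector r \<zeta>)\<^sup>\<star> \<otimes> (u \<otimes> phase_vector r \<zeta>)"
    using pv by (simp add: fib_carrier)
  also have "\<dots> = complex_of_real (1 / card (B r)) \<odot> (\<Oplus>k\<in>B r. \<Oplus>l\<in>B r. (cnj (\<zeta> k) * \<zeta> l) \<odot> (k\<^sup>\<star> \<otimes> (u \<otimes> l)))"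
    using r by (rule compress_phase_vector) simp
  also have "(\<Oplus>k\<in>B r. \<Oplus>l\<in>B r. (cnj (\<zeta> k) * \<zeta> l) \<odot> (k\<^sup>\<star> \<otimes> (u \<otimes> l))) = (\<Oplus>k\<in>B r. 1 \<odot> u)"
  proof (intro sum_cong refl)
    fix k assume k: "k \<in> B r"
    have "(\<Oplus>l\<in>B r. (cnj (\<zeta> k) * \<zeta> l) \<odot> (k\<^sup>\<star> \<otimes> (u \<otimes> l))) =
        (\<Oplus>l\<in>B r. if l = k then (cnj (\<zeta> k) * \<zeta> l) \<odot> u else \<zero>)"
      using r k by (intro sum_cong refl) (auto simp: basis_orthonormal)
    also have "\<dots> = (cnj (\<zeta> k) * \<zeta> k) \<odot> u"
      using r k by (intro sum_delta) auto
    also have "cnj (\<zeta> k) * \<zeta> k = 1"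
      using \<zeta> k PiE_mem[OF \<zeta> k] by (auto simp: phases_def)
    finally show "(\<Oplus>l\<in>B r. (cnj (\<zeta> k) * \<zeta> l) \<odot> (k\<^sup>\<star> \<otimes> (u \<otimes> l))) = 1 \<odot> u" .
  qed auto
  also have "complex_of_real (1 / card (B r)) \<odot> (\<Oplus>k\<in>B r. 1 \<odot> u) = u"
    unfolding sum_scale_const[OF basis_finite[OF r] unit_closed] using d by simp
  finally show "(phase_vector r \<zeta>)\<^sup>\<star> \<otimes> phase_vector r \<zeta> = u" .
qed

text \<open>Averaging over the phases annihilates the cross terms.\<close>

lemma sum_hs_phase_vector:
  assumes "s \<in> P" "t \<in> P" "r \<in> P" "a \<in> mp s t"
  shows "(\<Sum>\<zeta>\<in>PiE (B r) (\<lambda>_. phases). hs t ((phase_vector r \<zeta>)\<^sup>\<star> \<otimes> (a \<otimes> phase_vector r \<zeta>))) =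
    4 ^ card (B r) / (real (card (B r)))\<^sup>2 * (hs t (\<Oplus>k\<in>B r. k\<^sup>\<star> \<otimes> (a \<otimes> k)) +
      (\<Sum>k\<in>B r. \<Sum>l\<in>B r - {k}. hs t (k\<^sup>\<star> \<otimes> (a \<otimes> l))))"
proof -
  let ?d = "real (card (B r))" and ?Z = "PiE (B r) (\<lambda>_. phases)"
  let ?c = "\<lambda>e f k l. coeff e f (k\<^sup>\<star> \<otimes> (a \<otimes> l))"
  have a: "a \<in> carrier A"
    using assms by auto
  have kl: "k\<^sup>\<star> \<otimes> (a \<otimes> l) \<in> mp s t" if "k \<in> B r" "l \<in> B r" for k l
    using that assms by (intro compress_mp[of s t r] basis_fib) auto
  note sc = submodule_scale[OF submodule_mp[OF assms(1)]]
  have hs_z: "hs t ((phase_vector r \<zeta>)\<^sup>\<star> \<otimes> (a \<otimes> phase_vector r \<zeta>)) =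
      (\<Sum>f\<in>B t. \<Sum>e\<in>B s. (1 / ?d)\<^sup>2 * (cmod (\<Sum>k\<in>B r. \<Sum>l\<in>B r. cnj (\<zeta> k) * \<zeta> l * ?c e f k l))\<^sup>2)"
    if "\<zeta> \<in> ?Z" for \<zeta>
  proof -
    have z: "phase_vector r \<zeta> \<in> fib r"
      using phase_vector_sphere[OF assms(3) that] by (rule sphere_fib)
    have zaz: "(phase_vector r \<zeta>)\<^sup>\<star> \<otimes> (a \<otimes> phase_vector r \<zeta>) \<in> mp s t"
      using assms z by (intro compress_mp[of s t r]) auto
    have "coeff e f ((phase_vector r \<zeta>)\<^sup>\<star> \<otimes> (a \<otimes> phase_vector r \<zeta>)) =
        complex_of_real (1 / ?d) * (\<Sum>k\<in>B r. \<Sum>l\<in>B r. cnj (\<zeta> k) * \<zeta> l * ?c e f k l)"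
      if ef: "e \<in> B s" "f \<in> B t" for e f
    proof -
      have row: "(\<Oplus>l\<in>B r. (cnj (\<zeta> k) * \<zeta> l) \<odot> (k\<^sup>\<star> \<otimes> (a \<otimes> l))) \<in> mp s t" if "k \<in> B r" for k
        using that by (intro sum_in_submodule[OF submodule_mp[OF assms(1)]] sc kl)
      have "coeff e f (\<Oplus>k\<in>B r. \<Oplus>l\<in>B r. (cnj (\<zeta> k) * \<zeta> l) \<odot> (k\<^sup>\<star> \<otimes> (a \<otimes> l))) =
          (\<Sum>k\<in>B r. coeff e f (\<Oplus>l\<in>B r. (cnj (\<zeta> k) * \<zeta> l) \<odot> (k\<^sup>\<star> \<otimes> (a \<otimes> l))))"
        using assms ef row by (intro coeff_sum) auto
      also have "\<dots> = (\<Sum>k\<in>B r. \<Sum>l\<in>B r. coeff e f ((cnj (\<zeta> k) * \<zeta> l) \<odot> (k\<^sup>\<star> \<otimes> (a \<otimes> l))))"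
        using assms ef by (intro sum.cong refl coeff_sum) (auto intro: sc kl)
      also have "\<dots> = (\<Sum>k\<in>B r. \<Sum>l\<in>B r. cnj (\<zeta> k) * \<zeta> l * ?c e f k l)"
        using assms ef by (intro sum.cong refl coeff_scale[OF assms(1,2)] kl)
      finally have *: "coeff e f (\<Oplus>k\<in>B r. \<Oplus>l\<in>B r. (cnj (\<zeta> k) * \<zeta> l) \<odot> (k\<^sup>\<star> \<otimes> (a \<otimes> l))) =
          (\<Sum>k\<in>B r. \<Sum>l\<in>B r. cnj (\<zeta> k) * \<zeta> l * ?c e f k l)" .
      have "(\<Oplus>k\<in>B r. \<Oplus>l\<in>B r. (cnj (\<zeta> k) * \<zeta> l) \<odot> (k\<^sup>\<star> \<otimes> (a \<otimes> l))) \<in> mp s t"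
        by (intro sum_in_submodule[OF submodule_mp[OF assms(1)]] row)
      from coeff_scale[OF assms(1,2) this ef] show ?thesis
        unfolding compress_phase_vector[OF assms(3) a] * .
    qed
    then show ?thesis
      unfolding hs_eq_coeff[OF assms(1,2) zaz]
      by (intro sum.cong refl) (simp add: norm_mult power_mult_distrib power_divide norm_divide)
  qed
  have "(\<Sum>\<zeta>\<in>?Z. hs t ((phase_vector r \<zeta>)\<^sup>\<star> \<otimes> (a \<otimes> phase_vector r \<zeta>))) =
      (\<Sum>\<zeta>\<in>?Z. \<Sum>f\<in>B t. \<Sum>e\<in>B s. (1 / ?d)\<^sup>2 * (cmod (\<Sum>k\<in>B r. \<Sum>l\<in>B r. cnj (\<zeta> k) * \<zeta> l * ?c e f k l))\<^sup>2)"
    by (intro sum.cong refl hs_z)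
  also have "\<dots> = (\<Sum>f\<in>B t. \<Sum>e\<in>B s. \<Sum>\<zeta>\<in>?Z. (1 / ?d)\<^sup>2 * (cmod (\<Sum>k\<in>B r. \<Sum>l\<in>B r. cnj (\<zeta> k) * \<zeta> l * ?c e f k l))\<^sup>2)"
    by (rule sum_rotate[symmetric])
  also have "\<dots> = (\<Sum>f\<in>B t. \<Sum>e\<in>B s. (1 / ?d)\<^sup>2 * (4 ^ card (B r) * ((cmod (\<Sum>k\<in>B r. ?c e f k k))\<^sup>2 +
      (\<Sum>k\<in>B r. \<Sum>l\<in>B r - {k}. (cmod (?c e f k l))\<^sup>2))))"
  proof (intro sum.cong refl)
    fix f e
    show "(\<Sum>\<zeta>\<in>?Z. (1 / ?d)\<^sup>2 * (cmod (\<Sum>k\<in>B r. \<Sum>l\<in>B r. cnj (\<zeta> k) * \<zeta> l * ?c e f k l))\<^sup>2) =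
      (1 / ?d)\<^sup>2 * (4 ^ card (B r) * ((cmod (\<Sum>k\<in>B r. ?c e f k k))\<^sup>2 +
      (\<Sum>k\<in>B r. \<Sum>l\<in>B r - {k}. (cmod (?c e f k l))\<^sup>2)))"
      using sum_phases_quadratic[OF basis_finite[OF assms(3)], of 0 "?c e f"]
      by (simp flip: sum_distrib_left)
  qed
  also have "\<dots> = 4 ^ card (B r) / ?d\<^sup>2 * ((\<Sum>f\<in>B t. \<Sum>e\<in>B s. (cmod (\<Sum>k\<in>B r. ?c e f k k))\<^sup>2) +
      (\<Sum>f\<in>B t. \<Sum>e\<in>B s. \<Sum>k\<in>B r. \<Sum>l\<in>B r - {k}. (cmod (?c e f k l))\<^sup>2))"
    unfolding sum.distrib[symmetric] sum_distrib_left
    by (intro sum.cong refl) (simp add: power_divide)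
  also have "(\<Sum>f\<in>B t. \<Sum>e\<in>B s. (cmod (\<Sum>k\<in>B r. ?c e f k k))\<^sup>2) = hs t (\<Oplus>k\<in>B r. k\<^sup>\<star> \<otimes> (a \<otimes> k))"
    using assms kl by (subst hs_eq_coeff[of s]) (auto intro!: sum_in_submodule[OF submodule_mp] simp: coeff_sum)
  also have "(\<Sum>f\<in>B t. \<Sum>e\<in>B s. \<Sum>k\<in>B r. \<Sum>l\<in>B r - {k}. (cmod (?c e f k l))\<^sup>2) =
      (\<Sum>k\<in>B r. \<Sum>f\<in>B t. \<Sum>e\<in>B s. \<Sum>l\<in>B r - {k}. (cmod (?c e f k l))\<^sup>2)"
    by (rule sum_rotate)
  also have "\<dots> = (\<Sum>k\<in>B r. \<Sum>l\<in>B r - {k}. \<Sum>f\<in>B t. \<Sum>e\<in>B s. (cmod (?c e f k l))\<^sup>2)"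
    by (rule sum.cong[OF refl], rule sum_rotate)
  also have "\<dots> = (\<Sum>k\<in>B r. \<Sum>l\<in>B r - {k}. hs t (k\<^sup>\<star> \<otimes> (a \<otimes> l)))"
    using assms kl by (intro sum.cong refl) (auto simp: hs_eq_coeff)
  finally show ?thesis .
qed

text \<open>Some choice of phases does at least as well as the mean
  \<open>(D + d H - S) / d^2\<close>, where \<open>D\<close> belongs to the trace over
  \<open>B r\<close>, \<open>S\<close> to the diagonal blocks and \<open>d H - S\<close> to the
  off-diagonal ones. The number \<open>\<kappa>\<close> compares \<open>D\<close> with its trivial
  bound \<open>d^2 H\<close>.\<close>

lemma exists_contracting_vector:
  assumes P: "s \<in> P" "t \<in> P" "r \<in> P" and a: "a \<in> mp s t"
    and \<kappa>: "hs t (\<Oplus>k\<in>B r. k\<^sup>\<star> \<otimes> (a \<otimes> k)) \<le> \<kappa> * (real (card (B r)))\<^sup>2 * hs t a"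
  obtains z where "z \<in> sphere r"
    "hs t (z\<^sup>\<star> \<otimes> (a \<otimes> z)) \<le> ((1 - 1 / card (B r)) * \<kappa> + 1 / card (B r)) * hs t a"
proof -
  let ?Z = "PiE (B r) (\<lambda>_. phases)"
  define d where "d = real (card (B r))"
  have card: "card (B r) > 0"
    using P basis_nonempty by (simp add: card_gt_0_iff)
  then have d: "d \<ge> 1"
    by (simp add: d_def)
  define D where "D = hs t (\<Oplus>k\<in>B r. k\<^sup>\<star> \<otimes> (a \<otimes> k))"
  define S where "S = (\<Sum>k\<in>B r. hs t (k\<^sup>\<star> \<otimes> (a \<otimes> k)))"
  define H where "H = hs t a"
  have kk: "k\<^sup>\<star> \<otimes> (a \<otimes> k) \<in> mp s t" if "k \<in> B r" for k
    using that P a by (intro compress_mp[of s t r] basis_fib) auto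
  have DS: "D \<le> d * S"
    unfolding D_def d_def S_def using P kk by (intro hs_sum_le) auto
  have "(\<Sum>k\<in>B r. \<Sum>l\<in>B r - {k}. hs t (k\<^sup>\<star> \<otimes> (a \<otimes> l))) =
      (\<Sum>k\<in>B r. (\<Sum>l\<in>B r. hs t (k\<^sup>\<star> \<otimes> (a \<otimes> l))) - hs t (k\<^sup>\<star> \<otimes> (a \<otimes> k)))"
    using P by (intro sum.cong refl) (simp add: sum_diff1)
  also have "\<dots> = d * H - S"
    using hs_split[OF P a] by (simp add: sum_subtractf d_def S_def H_def)
  finally have off: "(\<Sum>k\<in>B r. \<Sum>l\<in>B r - {k}. hs t (k\<^sup>\<star> \<otimes> (a \<otimes> l))) = d * H - S" .
  define m where "m = ((1 - 1 / d) * \<kappa> + 1 / d) * H"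
  \<comment> \<open>From \<open>D \<le> d S\<close> the off-diagonal part is at most
    \<open>d H - D / d\<close>; this produces the weight \<open>1 - 1/d\<close> in front of
    \<open>\<kappa>\<close>.\<close>
  have "D + (d * H - S) \<le> (1 - 1 / d) * D + d * H"
    using DS d by (simp add: field_simps)
  also have "(1 - 1 / d) * D \<le> (1 - 1 / d) * (\<kappa> * d\<^sup>2 * H)"
    using \<kappa> d by (intro mult_left_mono) (auto simp: D_def d_def H_def)
  also have "(1 - 1 / d) * (\<kappa> * d\<^sup>2 * H) + d * H = d\<^sup>2 * m"
    using d by (simp add: m_def field_simps power2_eq_square)
  finally have le: "D + (d * H - S) \<le> d\<^sup>2 * m" by simp
  have total: "(\<Sum>\<zeta>\<in>?Z. hs t ((phase_vector r \<zeta>)\<^sup>\<star> \<otimes> (a \<otimes> phase_vector r \<zeta>))) \<le> 4 ^ card (B r) * m"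
  proof -
    have "(\<Sum>\<zeta>\<in>?Z. hs t ((phase_vector r \<zeta>)\<^sup>\<star> \<otimes> (a \<otimes> phase_vector r \<zeta>))) =
        4 ^ card (B r) / d\<^sup>2 * (D + (d * H - S))"
      using sum_hs_phase_vector[OF P a] by (simp add: off D_def d_def)
    also have "\<dots> \<le> 4 ^ card (B r) / d\<^sup>2 * (d\<^sup>2 * m)"
      using le by (intro mult_left_mono) auto
    also have "\<dots> = 4 ^ card (B r) * m"
      using d by simp
    finally show ?thesis .
  qed
  have "\<exists>\<zeta>\<in>?Z. hs t ((phase_vector r \<zeta>)\<^sup>\<star> \<otimes> (a \<otimes> phase_vector r \<zeta>)) \<le> m"
  proof (rule ccontr)
    assume "\<not> ?thesis"
    then have *: "m < hs t ((phase_vector r \<zeta>)\<^sup>\<star> \<otimes> (a \<otimes> phase_vector r \<zeta>))" if "\<zeta> \<in> ?Z" for \<zeta>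
      using that by (auto simp: not_le)
    have "?Z \<noteq> {}"
      by (auto simp: PiE_eq_empty_iff phases_def)
    then have "(\<Sum>\<zeta>\<in>?Z. m) < (\<Sum>\<zeta>\<in>?Z. hs t ((phase_vector r \<zeta>)\<^sup>\<star> \<otimes> (a \<otimes> phase_vector r \<zeta>)))"
      using P * by (intro sum_strict_mono finite_PiE) auto
    with total P show False
      by (simp add: card_PiE_phases)
  qed
  then show thesis
    using that phase_vector_sphere[OF P(3)] unfolding m_def d_def H_def by blast
qed

text \<open>Let \<open>r\<close> be the one of \<open>s\<close>, \<open>t\<close> with the larger
  dimension \<open>d\<close> and \<open>q\<close> the other, with dimension \<open>e\<close>. The
  trace of \<open>a\<close> over \<open>B r\<close> equals the one over \<open>B q\<close>, which
  has only \<open>e\<close> terms, so \<open>\<kappa> = (e/d)^2 < 1\<close> is admissible. The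
  factor \<open>\<rho>\<close> is a convex combination of \<open>\<kappa>\<close> and 1. It is the
  same for all \<open>a\<close>, as iteration requires.\<close>

lemma exists_contraction:
  assumes P: "s \<in> P" "t \<in> P" "s \<noteq> t"
  obtains r \<rho> where "r \<in> P" "0 \<le> \<rho>" "\<rho> < 1"
    "\<And>a. a \<in> mp s t \<Longrightarrow> \<exists>z\<in>sphere r. hs t (z\<^sup>\<star> \<otimes> (a \<otimes> z)) \<le> \<rho> * hs t a"
proof -
  have pos: "card (B x) > 0" if "x \<in> P" for x
    using that basis_nonempty by (simp add: card_gt_0_iff)
  have "card (B s) \<noteq> card (B t)"
    using P basis_inj by (auto dest: inj_onD)
  then obtain r q where rq: "r \<in> P" "q \<in> P" "card (B q) < card (B r)" "{r, q} = {s, t}"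
    using P by (metis insert_commute nat_neq_iff)
  define d e where "d = real (card (B r))" and "e = real (card (B q))"
  have de: "0 < e" "e < d" "1 \<le> e"
    using rq pos[OF rq(2)] by (auto simp: d_def e_def)
  define \<kappa> where "\<kappa> = (e / d)\<^sup>2"
  have \<kappa>: "0 \<le> \<kappa>" "\<kappa> < 1"
    using de by (auto simp: \<kappa>_def power_less_one_iff abs_square_less_1)
  define \<rho> where "\<rho> = (1 - 1 / d) * \<kappa> + 1 / d"
  have d1: "d > 1" using de by simp
  have "(1 - 1 / d) * \<kappa> < (1 - 1 / d) * 1"
    using d1 \<kappa> by (intro mult_strict_left_mono) auto
  then have "\<rho> < 1"
    unfolding \<rho>_def by (simp only: mult_1_right less_diff_eq)
  moreover have "0 \<le> \<rho>"
    using d1 \<kappa>(1) unfolding \<rho>_def by (intro add_nonneg_nonneg mult_nonneg_nonneg) auto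
  ultimately have \<rho>: "0 \<le> \<rho>" "\<rho> < 1"
    by auto
  have main: "\<exists>z\<in>sphere r. hs t (z\<^sup>\<star> \<otimes> (a \<otimes> z)) \<le> \<rho> * hs t a" if a: "a \<in> mp s t" for a
  proof -
    have "(\<Oplus>k\<in>B s. k\<^sup>\<star> \<otimes> (a \<otimes> k)) = (\<Oplus>k\<in>B t. k\<^sup>\<star> \<otimes> (a \<otimes> k))"
      by (rule frame_trace[OF P(1,2) frame_basis frame_basis a]) (use P in auto)
    then have eq: "(\<Oplus>k\<in>B r. k\<^sup>\<star> \<otimes> (a \<otimes> k)) = (\<Oplus>k\<in>B q. k\<^sup>\<star> \<otimes> (a \<otimes> k))"
      using rq(4) by (auto simp: doubleton_eq_iff)
    \<comment> \<open>Cauchy-Schwarz over the \<open>e\<close> terms gives one factor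
      \<open>e\<close>, and \<open>hs_diagonal_le\<close> the other.\<close>
    have "hs t (\<Oplus>k\<in>B q. k\<^sup>\<star> \<otimes> (a \<otimes> k)) \<le> e * (\<Sum>k\<in>B q. hs t (k\<^sup>\<star> \<otimes> (a \<otimes> k)))"
      unfolding e_def
      by (rule hs_sum_le[OF basis_finite[OF rq(2)] P(1,2) compress_mp[OF P(1,2) rq(2) a]])
        (auto intro: basis_fib rq)
    also have "\<dots> \<le> e * (e * hs t a)"
      unfolding e_def using hs_diagonal_le[OF P(1,2) rq(2) a] by (intro mult_left_mono) auto
    also have "\<dots> = \<kappa> * d\<^sup>2 * hs t a"
      using de by (simp add: \<kappa>_def power_divide power2_eq_square)
    finally have "hs t (\<Oplus>k\<in>B r. k\<^sup>\<star> \<otimes> (a \<otimes> k)) \<le> \<kappa> * (real (card (B r)))\<^sup>2 * hs t a"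
      by (simp add: eq d_def)
    then obtain z where "z \<in> sphere r"
      "hs t (z\<^sup>\<star> \<otimes> (a \<otimes> z)) \<le> ((1 - 1 / card (B r)) * \<kappa> + 1 / card (B r)) * hs t a"
      using exists_contracting_vector[OF P(1,2) rq(1) a] by blast
    then show ?thesis
      unfolding \<rho>_def d_def by blast
  qed
  show thesis
    using that rq(1) \<rho> main by blast
qed

lemma compress_compress:
  "\<lbrakk>x \<in> carrier A; y \<in> carrier A; a \<in> carrier A\<rbrakk>
    \<Longrightarrow> (x \<otimes> y)\<^sup>\<star> \<otimes> (a \<otimes> (x \<otimes> y)) = y\<^sup>\<star> \<otimes> ((x\<^sup>\<star> \<otimes> (a \<otimes> x)) \<otimes> y)"
  by (simp add: star_mult mult_assoc)

lemma nrm_compress_le: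
  assumes "y \<in> sphere s" "z \<in> sphere t" "a \<in> carrier A"
  shows "\<parallel>y\<^sup>\<star> \<otimes> (a \<otimes> z)\<parallel> \<le> \<parallel>a\<parallel>"
  using nrm_mult3_le[of "y\<^sup>\<star>" a z] assms by (auto simp: nrm_sphere sphere_carrier)

text \<open>Expansion in \<open>B t\<close> and Cauchy-Schwarz. The dimensional factor is harmless
  because \<open>t\<close> stays fixed while \<open>hs\<close> is driven to zero.\<close>

lemma nrm_le_hs:
  assumes "t \<in> P" "a \<in> carrier A"
  shows "\<parallel>a\<parallel>\<^sup>2 \<le> card (B t) * hs t a"
proof -
  have "\<parallel>a\<parallel> = \<parallel>\<Oplus>f\<in>B t. (a \<otimes> f) \<otimes> f\<^sup>\<star>\<parallel>"
    using frame_expand_right[OF frame_basis[OF assms(1)] assms(2)] by simp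
  also have "\<dots> \<le> (\<Sum>f\<in>B t. \<parallel>(a \<otimes> f) \<otimes> f\<^sup>\<star>\<parallel>)"
    using assms by (intro nrm_sum_le) auto
  also have "\<dots> \<le> (\<Sum>f\<in>B t. \<parallel>a \<otimes> f\<parallel>)"
  proof (rule sum_mono)
    fix f assume f: "f \<in> B t"
    have "\<parallel>(a \<otimes> f) \<otimes> f\<^sup>\<star>\<parallel> \<le> \<parallel>a \<otimes> f\<parallel> * \<parallel>f\<^sup>\<star>\<parallel>"
      using f assms by (intro nrm_mult) auto
    then show "\<parallel>(a \<otimes> f) \<otimes> f\<^sup>\<star>\<parallel> \<le> \<parallel>a \<otimes> f\<parallel>"
      using f assms nrm_sphere[OF basis_sphere] by simp
  qed
  finally have "\<parallel>a\<parallel>\<^sup>2 \<le> (\<Sum>f\<in>B t. \<parallel>a \<otimes> f\<parallel>)\<^sup>2"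
    using assms nrm_nonneg by (intro power_mono) auto
  also have "\<dots> \<le> (\<Sum>f\<in>B t. \<parallel>a \<otimes> f\<parallel>\<^sup>2) * card (B t)"
    by (rule sum_squared_le_sum_of_squares)
  finally show ?thesis
    by (simp add: hs_def mult.commute)
qed

text \<open>A nontrivial degree means \<open>s \<noteq> t\<close>, hence different dimensions. By
  \<open>compress_mp\<close> the compressed element stays in \<open>mp s t\<close>, where the same
  \<open>\<rho>\<close> applies again; the successive vectors are multiplied into one.\<close>

lemma exists_small_compression:
  assumes g: "a \<in> deg g" "g \<noteq> \<one>\<^bsub>G\<^esub>" and \<epsilon>: "\<epsilon> > 0"
  shows "\<exists>r\<in>P. \<exists>z\<in>sphere r. \<parallel>z\<^sup>\<star> \<otimes> (a \<otimes> z)\<parallel> < \<epsilon>"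
proof -
  obtain s t where st: "s \<in> P" "t \<in> P" "s \<cdot> inv\<^bsub>G\<^esub> t = g" "a \<in> mp s t"
    using g by (auto simp: deg_def)
  have "s \<noteq> t"
    using st g by auto
  obtain r0 \<rho> where r0: "r0 \<in> P" and \<rho>: "0 \<le> \<rho>" "\<rho> < 1"
    and contr: "\<And>a. a \<in> mp s t \<Longrightarrow> \<exists>z\<in>sphere r0. hs t (z\<^sup>\<star> \<otimes> (a \<otimes> z)) \<le> \<rho> * hs t a"
    using exists_contraction[OF st(1,2) \<open>s \<noteq> t\<close>] by blast
  have iter: "\<exists>r\<in>P. \<exists>z\<in>sphere r. hs t (z\<^sup>\<star> \<otimes> (a \<otimes> z)) \<le> \<rho> ^ n * hs t a" for n
  proof (induction n)
    case 0
    obtain z where z: "z \<in> sphere r0" "hs t (z\<^sup>\<star> \<otimes> (a \<otimes> z)) \<le> \<rho> * hs t a"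
      using contr[OF st(4)] by blast
    moreover have "\<rho> * hs t a \<le> 1 * hs t a"
      using \<rho> by (intro mult_right_mono hs_nonneg) auto
    ultimately show ?case
      using r0 by (intro bexI[of _ r0] bexI[of _ z]) auto
  next
    case (Suc n)
    then obtain r z where rz: "r \<in> P" "z \<in> sphere r" "hs t (z\<^sup>\<star> \<otimes> (a \<otimes> z)) \<le> \<rho> ^ n * hs t a"
      by blast
    have "z\<^sup>\<star> \<otimes> (a \<otimes> z) \<in> mp s t"
      using rz st by (intro compress_mp[of s t r] sphere_fib) auto
    then obtain z' where z': "z' \<in> sphere r0"
      "hs t (z'\<^sup>\<star> \<otimes> ((z\<^sup>\<star> \<otimes> (a \<otimes> z)) \<otimes> z')) \<le> \<rho> * hs t (z\<^sup>\<star> \<otimes> (a \<otimes> z))"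
      using contr by blast
    note z'(2)
    also have "\<rho> * hs t (z\<^sup>\<star> \<otimes> (a \<otimes> z)) \<le> \<rho> * (\<rho> ^ n * hs t a)"
      using rz \<rho> by (intro mult_left_mono) auto
    finally have "hs t ((z \<otimes> z')\<^sup>\<star> \<otimes> (a \<otimes> (z \<otimes> z'))) \<le> \<rho> ^ Suc n * hs t a"
      using rz z' st compress_compress[of z z' a] by (simp add: sphere_carrier mp_carrier mult.assoc)
    moreover have "z \<otimes> z' \<in> sphere (r \<cdot> r0)"
      using rz z' r0 by (intro sphere_mult)
    ultimately show ?case
      using rz r0 by blast
  qed
  have "(\<lambda>n. card (B t) * (\<rho> ^ n * hs t a)) \<longlonglongrightarrow> card (B t) * (0 * hs t a)"
    using \<rho> by (intro tendsto_intros LIMSEQ_power_zero) auto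
  then have "eventually (\<lambda>n. card (B t) * (\<rho> ^ n * hs t a) < \<epsilon>\<^sup>2) sequentially"
    using \<epsilon> by (intro order_tendstoD) auto
  then obtain n where n: "card (B t) * (\<rho> ^ n * hs t a) < \<epsilon>\<^sup>2"
    by (auto simp: eventually_sequentially)
  obtain r z where rz: "r \<in> P" "z \<in> sphere r" "hs t (z\<^sup>\<star> \<otimes> (a \<otimes> z)) \<le> \<rho> ^ n * hs t a"
    using iter by blast
  have zaz: "z\<^sup>\<star> \<otimes> (a \<otimes> z) \<in> carrier A"
    using rz st by (auto simp: sphere_carrier mp_carrier)
  have "\<parallel>z\<^sup>\<star> \<otimes> (a \<otimes> z)\<parallel>\<^sup>2 \<le> card (B t) * hs t (z\<^sup>\<star> \<otimes> (a \<otimes> z))"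
    using st zaz by (intro nrm_le_hs)
  also have "\<dots> \<le> card (B t) * (\<rho> ^ n * hs t a)"
    using rz by (intro mult_left_mono) auto
  finally have "\<parallel>z\<^sup>\<star> \<otimes> (a \<otimes> z)\<parallel>\<^sup>2 < \<epsilon>\<^sup>2"
    using n by simp
  then have "\<parallel>z\<^sup>\<star> \<otimes> (a \<otimes> z)\<parallel> < \<epsilon>"
    using \<epsilon> by (simp add: power2_less_imp_less)
  with rz show ?thesis by blast
qed

text \<open>The elements are treated one at a time: a further compression keeps degrees and does not
  increase norms, so what has become small stays small.\<close>

lemma exists_common_small_compression:
  assumes "finite J" "\<And>j. j \<in> J \<Longrightarrow> a j \<in> deg (g j)" "\<And>j. j \<in> J \<Longrightarrow> g j \<noteq> \<one>\<^bsub>G\<^esub>" "\<epsilon> > 0"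
  shows "\<exists>r\<in>P. \<exists>z\<in>sphere r. \<forall>j\<in>J. \<parallel>z\<^sup>\<star> \<otimes> (a j \<otimes> z)\<parallel> < \<epsilon>"
  using assms(1-3)
proof (induction J)
  case empty
  then show ?case
    using sphere_nonempty P_one by blast
next
  case (insert i J)
  then obtain r z where rz: "r \<in> P" "z \<in> sphere r" "\<And>j. j \<in> J \<Longrightarrow> \<parallel>z\<^sup>\<star> \<otimes> (a j \<otimes> z)\<parallel> < \<epsilon>"
    by (metis insert_iff)
  have aA: "a j \<in> carrier A" if "j \<in> insert i J" for j
    using insert.prems(1)[OF that] by auto
  have "z\<^sup>\<star> \<otimes> (a i \<otimes> z) \<in> deg (g i)"
    using insert.prems(1)[of i] rz by (intro compress_deg[of _ _ r] sphere_fib) auto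
  then obtain r' z' where rz': "r' \<in> P" "z' \<in> sphere r'" "\<parallel>z'\<^sup>\<star> \<otimes> ((z\<^sup>\<star> \<otimes> (a i \<otimes> z)) \<otimes> z')\<parallel> < \<epsilon>"
    using exists_small_compression insert.prems(2)[of i] assms(4) by blast
  have zA: "z \<in> carrier A" "z' \<in> carrier A"
    using rz rz' by auto
  have "\<parallel>(z \<otimes> z')\<^sup>\<star> \<otimes> (a j \<otimes> (z \<otimes> z'))\<parallel> < \<epsilon>" if j: "j \<in> insert i J" for j
  proof (cases "j = i")
    case True
    then show ?thesis
      using rz' zA aA[OF j] by (simp add: compress_compress)
  next
    case False
    then have "\<parallel>z'\<^sup>\<star> \<otimes> ((z\<^sup>\<star> \<otimes> (a j \<otimes> z)) \<otimes> z')\<parallel> \<le> \<parallel>z\<^sup>\<star> \<otimes> (a j \<otimes> z)\<parallel>"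
      using rz' zA aA[OF j] by (intro nrm_compress_le[of _ r' _ r']) auto
    also have "\<dots> < \<epsilon>"
      using rz(3) j False by auto
    finally show ?thesis
      using zA aA[OF j] by (simp add: compress_compress)
  qed
  moreover have "z \<otimes> z' \<in> sphere (r \<cdot> r')"
    using rz rz' by (intro sphere_mult)
  ultimately show ?case
    using rz(1) rz'(1) by blast
qed

end

text \<open>Let \<open>W n\<close> be the set of products of powers of the elements of
  \<open>S\<close> with exponents at most \<open>n\<close>. Commutativity lets exponents add up when
  products are multiplied, and counting exponent functions gives the bound.\<close>

lemma (in comm_group) exists_products_polynomial_growth:
  assumes "finite S" "S \<subseteq> carrier G"
  obtains W :: "nat \<Rightarrow> 'a set" where
    "\<And>n. finite (W n)" "\<And>n. W n \<subseteq> carrier G" "\<And>n. card (W n) \<le> (n + 1) ^ card S" "S \<subseteq> W 1"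
    "\<And>n g h. \<lbrakk>g \<in> W n; h \<in> W n\<rbrakk> \<Longrightarrow> g \<otimes> h \<in> W (2 * n)"
proof
  define W where "W n = (\<lambda>f. \<Otimes>s\<in>S. s [^] (f s :: nat)) ` PiE S (\<lambda>_. {..n})" for n
  have S: "s \<in> carrier G" if "s \<in> S" for s
    using that assms by auto
  show "finite (W n)" for n
    unfolding W_def using assms by (intro finite_imageI finite_PiE) auto
  show "W n \<subseteq> carrier G" for n
    unfolding W_def using S by (auto intro!: finprod_closed)
  show "card (W n) \<le> (n + 1) ^ card S" for n
  proof -
    have "card (W n) \<le> card (PiE S (\<lambda>_. {..n}))"
      unfolding W_def using assms by (intro card_image_le finite_PiE) auto
    also have "\<dots> = (n + 1) ^ card S"
      using assms by (simp add: card_PiE prod_constant)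
    finally show ?thesis .
  qed
  show "S \<subseteq> W 1"
  proof
    fix s assume s: "s \<in> S"
    have "(\<Otimes>i\<in>S. i [^] ((\<lambda>i\<in>S. if i = s then 1 else 0 :: nat) i)) = (\<Otimes>i\<in>S. if i = s then i else \<one>)"
      using S by (intro finprod_cong') auto
    also have "\<dots> = s"
      using s S assms by (intro finprod_singleton_swap) auto
    finally show "s \<in> W 1"
      unfolding W_def by (intro image_eqI[of _ _ "\<lambda>i\<in>S. if i = s then 1 else 0 :: nat"]) auto
  qed
  show "g \<otimes> h \<in> W (2 * n)" if gh: "g \<in> W n" "h \<in> W n" for n g h
  proof -
    obtain f f' where f: "f \<in> PiE S (\<lambda>_. {..n})" "g = (\<Otimes>s\<in>S. s [^] (f s :: nat))"
      and f': "f' \<in> PiE S (\<lambda>_. {..n})" "h = (\<Otimes>s\<in>S. s [^] (f' s :: nat))"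
      using gh by (auto simp: W_def)
    have "g \<otimes> h = (\<Otimes>s\<in>S. s [^] f s \<otimes> s [^] f' s)"
      unfolding f f' using S by (intro finprod_multf[symmetric]) auto
    also have "\<dots> = (\<Otimes>s\<in>S. s [^] ((\<lambda>s\<in>S. f s + f' s) s))"
      using S by (intro finprod_cong') (auto simp: nat_pow_mult)
    finally have gh_eq: "g \<otimes> h = (\<Otimes>s\<in>S. s [^] ((\<lambda>s\<in>S. f s + f' s) s))" .
    have "f s + f' s \<le> 2 * n" if "s \<in> S" for s
      using PiE_mem[OF f(1) that] PiE_mem[OF f'(1) that] by simp
    then have "(\<lambda>s\<in>S. f s + f' s) \<in> PiE S (\<lambda>_. {..2 * n})"
      by auto
    then show ?thesis
      unfolding W_def gh_eq by blast
  qed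
qed

context cuntz_family
begin

subsection \<open>Simplicity\<close>

text \<open>Passing from a bound on one fibre to the C*-norm by expansion in \<open>B t\<close>
  costs a factor \<open>card (B t)\<close>. The powers of \<open>T = a* a\<close> satisfy bounds of
  the same kind on \<open>fib t\<close>, so \<open>le_if_powers_le\<close> with exponent
  \<open>p = 0\<close> removes this constant.\<close>

lemma nrm_mp_le:
  assumes P: "s \<in> P" "t \<in> P" and a: "a \<in> mp s t" and m: "0 \<le> m"
    and le: "\<And>f. f \<in> sphere t \<Longrightarrow> \<parallel>a \<otimes> f\<parallel> \<le> m"
  shows "\<parallel>a\<parallel> \<le> m"
proof -
  have aA: "a \<in> carrier A"
    using a by auto
  have a_le: "\<parallel>a \<otimes> x\<parallel> \<le> m * \<parallel>x\<parallel>" if x: "x \<in> fib t" for x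
  proof (cases "\<parallel>x\<parallel> = 0")
    case True
    then show ?thesis
      using x aA by (simp add: nrm_eq_0 fib_carrier)
  next
    case False
    have xA: "x \<in> carrier A"
      using x by auto
    then have pos: "\<parallel>x\<parallel> > 0"
      using False nrm_nonneg[of x] by simp
    define y where "y = complex_of_real (1 / \<parallel>x\<parallel>) \<odot> x"
    have "y \<in> sphere t"
      using x xA P pos submodule_scale[OF submodule_fib] by (simp add: y_def sphere_def nrm_smult norm_divide)
    then have "\<parallel>a \<otimes> y\<parallel> \<le> m"
      by (rule le)
    moreover have "a \<otimes> x = complex_of_real \<parallel>x\<parallel> \<odot> (a \<otimes> y)"
      using xA aA pos by (simp add: y_def smult_mult_right flip: of_real_mult)
    ultimately show ?thesis
      using pos xA aA by (simp add: nrm_smult mult.commute[of m] y_def)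
  qed
  define T where "T = a\<^sup>\<star> \<otimes> a"
  have T: "T \<in> mp t t"
    unfolding T_def by (rule mp_mult[OF mp_star[OF P a] a])
  have TA: "T \<in> carrier A" "T\<^sup>\<star> = T"
    using aA by (auto simp: T_def star_mult)
  have T_le: "\<parallel>T \<otimes> x\<parallel> \<le> m\<^sup>2 * \<parallel>x\<parallel>" if x: "x \<in> fib t" for x
  proof -
    define y where "y = T \<otimes> x"
    have y: "y \<in> fib t"
      using T x by (simp add: y_def mpD)
    have A: "x \<in> carrier A" "y \<in> carrier A"
      using x y by auto
    \<comment> \<open>Only the second factor \<open>y\<close> is written out as
      \<open>a* a x\<close>; then \<open>y* a*\<close> is the adjoint of \<open>a y\<close>.\<close>
    have "y\<^sup>\<star> \<otimes> y = (a \<otimes> y)\<^sup>\<star> \<otimes> (a \<otimes> x)"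
      using A aA by (subst (2) y_def) (simp add: T_def star_mult mult_assoc)
    then have "\<parallel>y\<parallel>\<^sup>2 \<le> \<parallel>a \<otimes> y\<parallel> * \<parallel>a \<otimes> x\<parallel>"
      using nrm_star_mult[OF A(2)] nrm_mult[of "(a \<otimes> y)\<^sup>\<star>" "a \<otimes> x"] A aA by simp
    also have "\<dots> \<le> (m * \<parallel>y\<parallel>) * (m * \<parallel>x\<parallel>)"
      using a_le x y m A aA nrm_nonneg by (intro mult_mono) auto
    finally have "\<parallel>y\<parallel> * \<parallel>y\<parallel> \<le> (m\<^sup>2 * \<parallel>x\<parallel>) * \<parallel>y\<parallel>"
      by (simp add: power2_eq_square mult_ac)
    then show ?thesis
      using A nrm_nonneg[of y] nrm_nonneg[of x] mult_le_cancel_right[of "\<parallel>y\<parallel>" "\<parallel>y\<parallel>" "m\<^sup>2 * \<parallel>x\<parallel>"]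
      by (cases "\<parallel>y\<parallel> = 0") (auto simp: y_def)
  qed
  define Q where "Q k = ((\<lambda>y. y \<otimes> y) ^^ k) T" for k
  have Q: "Q k \<in> mp t t \<and> (\<forall>x\<in>fib t. \<parallel>Q k \<otimes> x\<parallel> \<le> (m\<^sup>2) ^ (2 ^ k) * \<parallel>x\<parallel>)" for k
  proof (induction k)
    case 0
    then show ?case
      using T T_le by (simp add: Q_def)
  next
    case (Suc k)
    have eq: "Q (Suc k) = Q k \<otimes> Q k"
      by (simp add: Q_def)
    have "\<parallel>Q (Suc k) \<otimes> x\<parallel> \<le> (m\<^sup>2) ^ (2 ^ Suc k) * \<parallel>x\<parallel>" if x: "x \<in> fib t" for x
    proof -
      have Qx: "Q k \<otimes> x \<in> fib t"
        using Suc x by (auto intro: mpD)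
      have "\<parallel>Q (Suc k) \<otimes> x\<parallel> = \<parallel>Q k \<otimes> (Q k \<otimes> x)\<parallel>"
        unfolding eq using mult_assoc[OF mp_carrier mp_carrier fib_carrier] Suc x by metis
      also have "\<dots> \<le> (m\<^sup>2) ^ (2 ^ k) * \<parallel>Q k \<otimes> x\<parallel>"
        using Suc Qx by auto
      also have "\<dots> \<le> (m\<^sup>2) ^ (2 ^ k) * ((m\<^sup>2) ^ (2 ^ k) * \<parallel>x\<parallel>)"
        using Suc x by (intro mult_left_mono) auto
      also have "\<dots> = (m\<^sup>2) ^ (2 ^ Suc k) * \<parallel>x\<parallel>"
        by (simp add: power_add[symmetric] mult_2 flip: mult.assoc)
      finally show ?thesis .
    qed
    then show ?case
      using Suc mp_mult unfolding eq by blast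
  qed
  have "\<parallel>T\<parallel> \<le> m\<^sup>2"
  proof (rule le_if_powers_le[of _ _ "card (B t)" 0])
    fix k
    have QA: "Q k \<in> carrier A"
      using Q[of k] by auto
    have "\<parallel>T\<parallel> ^ (2 ^ k) = \<parallel>Q k\<parallel>"
      using nrm_iterated_square[OF TA] by (simp add: Q_def)
    also have "\<dots> = \<parallel>\<Oplus>f\<in>B t. (Q k \<otimes> f) \<otimes> f\<^sup>\<star>\<parallel>"
      using frame_expand_right[OF frame_basis[OF P(2)] QA] by simp
    also have "\<dots> \<le> (\<Sum>f\<in>B t. \<parallel>(Q k \<otimes> f) \<otimes> f\<^sup>\<star>\<parallel>)"
      using P QA by (intro nrm_sum_le) auto
    also have "\<dots> \<le> (\<Sum>f\<in>B t. (m\<^sup>2) ^ (2 ^ k))"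
    proof (rule sum_mono)
      fix f assume f: "f \<in> B t"
      have fS: "f \<in> sphere t" "f \<in> fib t" "f \<in> carrier A"
        using f P basis_sphere sphere_fib by auto
      have "\<parallel>(Q k \<otimes> f) \<otimes> f\<^sup>\<star>\<parallel> \<le> \<parallel>Q k \<otimes> f\<parallel> * \<parallel>f\<^sup>\<star>\<parallel>"
        using fS QA by (intro nrm_mult) auto
      also have "\<dots> = \<parallel>Q k \<otimes> f\<parallel>"
        using fS by (simp add: nrm_sphere)
      also have "\<dots> \<le> (m\<^sup>2) ^ (2 ^ k) * \<parallel>f\<parallel>"
        using Q[of k] fS by blast
      finally show "\<parallel>(Q k \<otimes> f) \<otimes> f\<^sup>\<star>\<parallel> \<le> (m\<^sup>2) ^ (2 ^ k)"
        using fS by (simp add: nrm_sphere)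
    qed
    finally show "\<parallel>T\<parallel> ^ (2 ^ k) \<le> real (card (B t)) * (2 ^ k + 1) ^ 0 * (m\<^sup>2) ^ (2 ^ k)"
      by simp
  qed (use TA nrm_nonneg in auto)
  then have "\<parallel>a\<parallel>\<^sup>2 \<le> m\<^sup>2"
    using nrm_star_mult[OF aA] by (simp add: T_def)
  then show ?thesis
    using m by (rule power2_le_imp_le)
qed

text \<open>For a unit vector \<open>f\<close> put \<open>v = y g0 f\<close>. In
  \<open>v* Y f\<close> the term of \<open>g0\<close> is the scalar \<open>||v||^2\<close> and all
  others have nontrivial degree, so a compression leaves this scalar up to
  \<open>\<epsilon>\<close>. Elements of \<open>I\<close> stay in \<open>I\<close>, and a scalar has
  distance at least its modulus from them. Hence \<open>||v||^2 \<le> ||v|| m\<close>, and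
  \<open>nrm_mp_le\<close> passes from the vectors \<open>v\<close> to \<open>y g0\<close>.\<close>

lemma nrm_component_le:
  assumes I: "closed_ideal I A" "u \<notin> I" "n \<in> I"
    and y: "finite F" "\<And>g. g \<in> F \<Longrightarrow> y g \<in> deg g" and g0: "g0 \<in> F"
  shows "\<parallel>y g0\<parallel> \<le> \<parallel>(\<Oplus>g\<in>F. y g) \<ominus> n\<parallel>"
proof -
  let ?Y = "\<Oplus>g\<in>F. y g"
  have nA: "n \<in> carrier A"
    using I closed_idealD(2) by blast
  have yA: "y g \<in> carrier A" if "g \<in> F" for g
    using y(2)[OF that] by auto
  then have YA: "?Y \<in> carrier A"
    by auto
  obtain s t where st: "s \<in> P" "t \<in> P" "s \<cdot> inv\<^bsub>G\<^esub> t = g0" "y g0 \<in> mp s t"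
    using y(2)[OF g0] by (auto simp: deg_def)
  define m where "m = \<parallel>?Y \<ominus> n\<parallel>"
  have m: "0 \<le> m"
    using YA nA by (auto simp: m_def intro: nrm_nonneg)
  have "\<parallel>y g0 \<otimes> f\<parallel> \<le> m" if f: "f \<in> sphere t" for f
  proof -
    define v where "v = y g0 \<otimes> f"
    have v: "v \<in> fib s"
      unfolding v_def using st f by (intro mpD[of _ s t] sphere_fib) auto
    have A: "v \<in> carrier A" "f \<in> carrier A"
      using v f by auto
    define a where "a g = v\<^sup>\<star> \<otimes> (y g \<otimes> f)" for g
    have aA: "a g \<in> carrier A" if "g \<in> F" for g
      using A yA[OF that] by (simp add: a_def)
    have a_deg: "a g \<in> deg (inv\<^bsub>G\<^esub> s \<cdot> (g \<cdot> t))" if "g \<in> F" for g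
      unfolding a_def
      by (rule deg_mult[OF deg_star[OF fib_deg[OF st(1) v]] deg_mult[OF y(2)[OF that] fib_deg[OF st(2) sphere_fib[OF f]]]])
    have nontriv: "inv\<^bsub>G\<^esub> s \<cdot> (g \<cdot> t) \<noteq> \<one>\<^bsub>G\<^esub>" if g: "g \<in> F - {g0}" for g
    proof
      assume one: "inv\<^bsub>G\<^esub> s \<cdot> (g \<cdot> t) = \<one>\<^bsub>G\<^esub>"
      have gG: "g \<in> carrier G"
        using y(2)[of g] g deg_in_carrier by blast
      have "g \<cdot> t = s"
        using G.inv_equality[OF one] gG st(1,2) by (metis G.inv_inv G.m_closed G.inv_closed P_carrier)
      then have "g = s \<cdot> inv\<^bsub>G\<^esub> t"
        using gG st(1,2) by (metis G.inv_solve_right P_carrier)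
      with st(3) g show False by simp
    qed
    define c where "c = complex_of_real (\<parallel>v\<parallel>\<^sup>2)"
    have main: "\<parallel>v\<parallel>\<^sup>2 \<le> \<parallel>v\<parallel> * m + \<epsilon>" if \<epsilon>: "\<epsilon> > 0" for \<epsilon>
    proof -
      define \<delta> where "\<delta> = \<epsilon> / (card F + 1)"
      have \<delta>: "\<delta> > 0"
        using \<epsilon> by (simp add: \<delta>_def)
      obtain r z where rz: "r \<in> P" "z \<in> sphere r" "\<And>g. g \<in> F - {g0} \<Longrightarrow> \<parallel>z\<^sup>\<star> \<otimes> (a g \<otimes> z)\<parallel> < \<delta>"
        using exists_common_small_compression[of "F - {g0}" a "\<lambda>g. inv\<^bsub>G\<^esub> s \<cdot> (g \<cdot> t)" \<delta>]
          y(1) a_deg nontriv \<delta> by auto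
      have zA: "z \<in> carrier A"
        using rz by auto
      define p q where "p = v \<otimes> z" and "q = f \<otimes> z"
      have pq: "p \<in> carrier A" "q \<in> carrier A"
        using A zA by (auto simp: p_def q_def)
      have comp: "p\<^sup>\<star> \<otimes> (y g \<otimes> q) = z\<^sup>\<star> \<otimes> (a g \<otimes> z)" if "g \<in> F" for g
        using A zA yA[OF that] by (simp add: p_def q_def a_def star_mult mult_assoc)
      define E where "E = (\<Oplus>g\<in>F - {g0}. z\<^sup>\<star> \<otimes> (a g \<otimes> z))"
      have EA: "E \<in> carrier A"
        unfolding E_def using zA aA by auto
      have "\<parallel>E\<parallel> \<le> (\<Sum>g\<in>F - {g0}. \<parallel>z\<^sup>\<star> \<otimes> (a g \<otimes> z)\<parallel>)"
        unfolding E_def using zA aA by (intro nrm_sum_le) auto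
      also have "\<dots> \<le> (\<Sum>g\<in>F - {g0}. \<delta>)"
        using rz(3) by (intro sum_mono less_imp_le) auto
      also have "\<dots> \<le> card F * \<delta>"
        using y(1) \<delta> by (auto intro!: mult_right_mono card_mono)
      also have "\<dots> \<le> \<epsilon>"
        using \<epsilon> by (simp add: \<delta>_def field_simps)
      finally have E_le: "\<parallel>E\<parallel> \<le> \<epsilon>" .
      have "p\<^sup>\<star> \<otimes> (?Y \<otimes> q) = (\<Oplus>g\<in>F. p\<^sup>\<star> \<otimes> (y g \<otimes> q))"
        using pq yA by (simp add: sum_mult_left sum_mult_right)
      also have "\<dots> = (\<Oplus>g\<in>insert g0 (F - {g0}). z\<^sup>\<star> \<otimes> (a g \<otimes> z))"
        using g0 comp zA aA by (intro sum_cong) auto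
      also have "\<dots> = z\<^sup>\<star> \<otimes> (a g0 \<otimes> z) \<oplus> E"
        unfolding E_def using y(1) zA aA g0 by (intro sum_insert) auto
      also have "a g0 = c \<odot> u"
        using inner_self[OF st(1) v] by (simp add: a_def c_def flip: v_def)
      also have "z\<^sup>\<star> \<otimes> (c \<odot> u \<otimes> z) = c \<odot> u"
        using zA sphere_isometry[OF rz(1,2)] by (simp add: smult_mult_left smult_mult_right)
      finally have Y_eq: "p\<^sup>\<star> \<otimes> (?Y \<otimes> q) = c \<odot> u \<oplus> E" .
      define n' where "n' = p\<^sup>\<star> \<otimes> (n \<otimes> q)"
      have n': "n' \<in> I"
        unfolding n'_def using pq I closed_idealD(3,4)[OF I(1)] by simp
      have n'A: "n' \<in> carrier A"
        using pq nA by (simp add: n'_def)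
      have "p\<^sup>\<star> \<otimes> ((?Y \<ominus> n) \<otimes> q) = (c \<odot> u \<oplus> E) \<ominus> n'"
        using pq YA nA by (simp add: mult_diff_left mult_diff_right Y_eq n'_def)
      also have "\<dots> = (c \<odot> u \<ominus> n') \<oplus> E"
        using EA n'A by (simp add: a_minus_def M.a_ac)
      finally have eq: "c \<odot> u \<ominus> n' = p\<^sup>\<star> \<otimes> ((?Y \<ominus> n) \<otimes> q) \<ominus> E"
        using EA n'A by (simp add: a_minus_def M.a_assoc M.r_neg)
      have p_le: "\<parallel>p\<parallel> \<le> \<parallel>v\<parallel>" "\<parallel>q\<parallel> \<le> 1"
        using nrm_mult[of v z] nrm_mult[of f z] A zA nrm_sphere[OF rz(2)] nrm_sphere[OF f]
        by (auto simp: p_def q_def)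
      have "\<parallel>v\<parallel>\<^sup>2 = cmod c"
        by (simp add: c_def norm_power)
      also have "\<dots> \<le> \<parallel>c \<odot> u \<ominus> n'\<parallel>"
        by (rule proper_ideal_dist_scalar[OF I(1,2) n'])
      also have "\<dots> \<le> \<parallel>p\<^sup>\<star> \<otimes> ((?Y \<ominus> n) \<otimes> q)\<parallel> + \<parallel>E\<parallel>"
        unfolding eq using nrm_triangle[of "p\<^sup>\<star> \<otimes> ((?Y \<ominus> n) \<otimes> q)" "\<ominus> E"] pq YA nA EA by (simp add: a_minus_def)
      also have "\<parallel>p\<^sup>\<star> \<otimes> ((?Y \<ominus> n) \<otimes> q)\<parallel> \<le> \<parallel>p\<^sup>\<star>\<parallel> * m * \<parallel>q\<parallel>"
        unfolding m_def using pq YA nA by (intro nrm_mult3_le) auto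
      also have "\<dots> \<le> (\<parallel>v\<parallel> * m) * 1"
        using p_le pq m A nrm_nonneg by (intro mult_mono) (auto intro: mult_nonneg_nonneg)
      finally show "\<parallel>v\<parallel>\<^sup>2 \<le> \<parallel>v\<parallel> * m + \<epsilon>"
        using E_le by simp
    qed
    have "\<parallel>v\<parallel>\<^sup>2 \<le> \<parallel>v\<parallel> * m"
      by (rule field_le_epsilon) (rule main)
    then have "\<parallel>v\<parallel> \<le> m"
      using m nrm_nonneg[OF A(1)] by (cases "\<parallel>v\<parallel> = 0") (auto simp: power2_eq_square)
    then show ?thesis
      by (simp add: v_def)
  qed
  then show ?thesis
    using nrm_mp_le[OF st(1,2,4) m] by (simp add: m_def)
qed

text \<open>Finite sums of homogeneous elements with degrees in \<open>S\<close>, where a degree may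
  occur repeatedly. The set \<open>S\<close> is recorded because its cardinality enters the norm
  estimates.\<close>

inductive_set graded :: "'g set \<Rightarrow> 'a set" for S :: "'g set" where
  zero: "\<zero> \<in> graded S"
| add: "\<lbrakk>g \<in> S; a \<in> deg g; y \<in> graded S\<rbrakk> \<Longrightarrow> a \<oplus> y \<in> graded S"

lemma graded_carrier: "y \<in> graded S \<Longrightarrow> y \<in> carrier A"
  by (induction rule: graded.induct) auto

lemma graded_mono: "\<lbrakk>y \<in> graded S; S \<subseteq> S'\<rbrakk> \<Longrightarrow> y \<in> graded S'"
  by (induction rule: graded.induct) (auto intro: graded.intros)

lemma deg_graded: "\<lbrakk>a \<in> deg g; g \<in> S\<rbrakk> \<Longrightarrow> a \<in> graded S"
  using graded.add[OF _ _ graded.zero, of g S a] by (simp add: deg_carrier)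

lemma graded_add:
  assumes "x \<in> graded S" "y \<in> graded S" shows "x \<oplus> y \<in> graded S"
  using assms
proof (induction rule: graded.induct)
  case zero
  then show ?case by (simp add: graded_carrier)
next
  case (add g a x)
  have "(a \<oplus> x) \<oplus> y = a \<oplus> (x \<oplus> y)"
    using add by (intro M.a_assoc) (auto intro: graded_carrier)
  with add show ?case
    by (auto intro: graded.add)
qed

lemma graded_scale: "y \<in> graded S \<Longrightarrow> c \<odot> y \<in> graded S"
  by (induction rule: graded.induct)
    (auto intro: graded.intros deg_scale simp: scale_add_right deg_carrier graded_carrier)

lemma graded_star: "y \<in> graded S \<Longrightarrow> y\<^sup>\<star> \<in> graded ((\<lambda>g. inv\<^bsub>G\<^esub> g) ` S)"
  by (induction rule: graded.induct)
    (auto intro: graded.intros deg_star simp: star_add deg_carrier graded_carrier)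

lemma deg_mult_graded:
  assumes "y \<in> graded S'" "a \<in> deg g" "g \<in> S"
  shows "a \<otimes> y \<in> graded ((\<lambda>(g, h). g \<cdot> h) ` (S \<times> S'))"
  using assms(1)
proof (induction rule: graded.induct)
  case zero
  then show ?case
    using assms(2) by (auto simp: deg_carrier intro: graded.zero)
next
  case (add h b y)
  have "a \<otimes> (b \<oplus> y) = a \<otimes> b \<oplus> a \<otimes> y"
    using add assms by (intro distrib_left) (auto intro: deg_carrier graded_carrier)
  moreover have "\<dots> \<in> graded ((\<lambda>(g, h). g \<cdot> h) ` (S \<times> S'))"
    using add assms by (intro graded.add[of "g \<cdot> h"] deg_mult) auto
  ultimately show ?case by simp
qed

lemma graded_mult:
  assumes "x \<in> graded S" "y \<in> graded S'"
  shows "x \<otimes> y \<in> graded ((\<lambda>(g, h). g \<cdot> h) ` (S \<times> S'))"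
  using assms(1)
proof (induction rule: graded.induct)
  case zero
  then show ?case
    using graded_carrier[OF assms(2)] by (auto intro: graded.zero)
next
  case (add g a x)
  have "(a \<oplus> x) \<otimes> y = a \<otimes> y \<oplus> x \<otimes> y"
    using add assms by (intro distrib_right) (auto intro: deg_carrier graded_carrier)
  then show ?case
    using graded_add[OF deg_mult_graded[OF assms(2) add(2,1)] add(4)] by simp
qed

text \<open>Terms of equal degree are merged by \<open>deg_add\<close>, so the number of components
  is bounded by the number of degrees.\<close>

lemma graded_components:
  assumes "y \<in> graded S"
  shows "\<exists>F c. finite F \<and> F \<subseteq> S \<and> (\<forall>g\<in>F. c g \<in> deg g) \<and> y = (\<Oplus>g\<in>F. c g)"
  using assms
proof (induction rule: graded.induct)
  case zero
  show ?case
    by (intro exI[of _ "{}"]) auto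
next
  case (add h a y)
  then obtain F c where F: "finite F" "F \<subseteq> S" "\<And>g. g \<in> F \<Longrightarrow> c g \<in> deg g" "y = (\<Oplus>g\<in>F. c g)"
    by auto
  have cA: "c g \<in> carrier A" if "g \<in> F" for g
    using F(3)[OF that] by auto
  have aA: "a \<in> carrier A"
    using add by auto
  define c' where "c' = c(h := if h \<in> F then a \<oplus> c h else a)"
  have c': "c' g \<in> deg g" if "g \<in> insert h F" for g
    using that F(3) add deg_add by (auto simp: c'_def)
  have c'A: "c' g \<in> carrier A" if "g \<in> insert h F" for g
    using c'[OF that] by auto
  have rest: "(\<Oplus>g\<in>F - {h}. c' g) = (\<Oplus>g\<in>F - {h}. c g)"
    using cA by (intro sum_cong) (auto simp: c'_def)
  have ins: "(\<Oplus>g\<in>insert h F. c' g) = c' h \<oplus> (\<Oplus>g\<in>F - {h}. c g)"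
  proof -
    have "(\<Oplus>g\<in>insert h (F - {h}). c' g) = c' h \<oplus> (\<Oplus>g\<in>F - {h}. c' g)"
      using F(1) c'A by (intro sum_insert) auto
    then show ?thesis
      by (simp add: rest)
  qed
  have "a \<oplus> y = (\<Oplus>g\<in>insert h F. c' g)"
  proof (cases "h \<in> F")
    case True
    have "y = (\<Oplus>g\<in>insert h (F - {h}). c g)"
      using True F(4) by (simp add: insert_absorb)
    also have "\<dots> = c h \<oplus> (\<Oplus>g\<in>F - {h}. c g)"
      using F(1) cA True by (intro sum_insert) auto
    finally show ?thesis
      using True aA cA unfolding ins by (simp add: c'_def M.a_assoc)
  next
    case False
    then show ?thesis
      unfolding ins by (simp add: c'_def F(4))
  qed
  then show ?case
    using F add c' by (intro exI[of _ "insert h F"] exI[of _ c']) auto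
qed

text \<open>The triangle inequality over the components is crude; its factor \<open>card S\<close>
  is removed afterwards by passing to powers.\<close>

lemma nrm_graded_le_card:
  assumes I: "closed_ideal I A" "u \<notin> I" "n \<in> I" and Y: "Y \<in> graded S" "finite S"
  shows "\<parallel>Y\<parallel> \<le> card S * \<parallel>Y \<ominus> n\<parallel>"
proof -
  obtain F c where F: "finite F" "F \<subseteq> S" "\<And>g. g \<in> F \<Longrightarrow> c g \<in> deg g" "Y = (\<Oplus>g\<in>F. c g)"
    using graded_components[OF Y(1)] by blast
  have A: "Y \<in> carrier A" "n \<in> carrier A" "\<And>g. g \<in> F \<Longrightarrow> c g \<in> carrier A"
    using graded_carrier[OF Y(1)] closed_idealD(2)[OF I(1)] I(3) F(3) by auto
  have "\<parallel>Y\<parallel> \<le> (\<Sum>g\<in>F. \<parallel>c g\<parallel>)"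
    unfolding F(4) using A by (intro nrm_sum_le) auto
  also have "\<dots> \<le> (\<Sum>g\<in>F. \<parallel>Y \<ominus> n\<parallel>)"
    unfolding F(4) using F by (intro sum_mono nrm_component_le[OF I]) auto
  also have "\<dots> \<le> card S * \<parallel>Y \<ominus> n\<parallel>"
    using F Y A by (auto intro!: mult_right_mono card_mono nrm_nonneg)
  finally show ?thesis .
qed

text \<open>Amenability of the grading group enters here: the number of homogeneous components of
  \<open>T\<^sup>N\<close> grows only polynomially in \<open>N\<close>, so the bound with the factor \<open>card S\<close>, applied to powers
  of \<open>T = Y\<^sup>* Y\<close>, self-improves.\<close>

lemma nrm_graded_le:
  assumes I: "closed_ideal I A" "u \<notin> I" "n \<in> I" and Y: "Y \<in> graded S" "finite S"
  shows "\<parallel>Y\<parallel> \<le> \<parallel>Y \<ominus> n\<parallel>"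
proof -
  have A: "Y \<in> carrier A" "n \<in> carrier A"
    using graded_carrier[OF Y(1)] closed_idealD(2)[OF I(1)] I(3) by auto
  define S0 where "S0 = (\<lambda>(g, h). g \<cdot> h) ` (((\<lambda>g. inv\<^bsub>G\<^esub> g) ` (S \<inter> carrier G)) \<times> (S \<inter> carrier G))"
  have Y': "Y \<in> graded (S \<inter> carrier G)"
    using Y(1) by (induction rule: graded.induct) (auto intro: graded.intros deg_in_carrier)
  have S0: "finite S0" "S0 \<subseteq> carrier G"
    using Y(2) by (auto simp: S0_def)
  define T where "T = Y\<^sup>\<star> \<otimes> Y"
  \<comment> \<open>\<open>T'\<close> is congruent to \<open>T\<close> modulo \<open>I\<close> and
    has norm at most \<open>||Y|| ||Y - n||\<close>. The powers remain congruent, so for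
    \<open>N = 2^k\<close> the element \<open>T^N\<close> has distance at most
    \<open>||T'||^N\<close> from \<open>I\<close>.\<close>
  define T' where "T' = Y\<^sup>\<star> \<otimes> (Y \<ominus> n)"
  have T: "T \<in> graded S0"
    unfolding T_def S0_def by (intro graded_mult graded_star Y')
  have TA: "T \<in> carrier A" "T\<^sup>\<star> = T" "T' \<in> carrier A"
    using A by (auto simp: T_def T'_def star_mult)
  obtain W where W: "\<And>n. finite (W n)" "\<And>n. W n \<subseteq> carrier G" "\<And>n. card (W n) \<le> (n + 1) ^ card S0" "S0 \<subseteq> W 1"
    "\<And>n g h. \<lbrakk>g \<in> W n; h \<in> W n\<rbrakk> \<Longrightarrow> g \<cdot> h \<in> W (2 * n)"
    using G.exists_products_polynomial_growth[OF S0] by blast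
  define Q where "Q k = ((\<lambda>y. y \<otimes> y) ^^ k) T" for k
  define Q' where "Q' k = ((\<lambda>y. y \<otimes> y) ^^ k) T'" for k
  have QA: "Q k \<in> carrier A" "\<parallel>Q k\<parallel> = \<parallel>T\<parallel> ^ (2 ^ k)" "Q' k \<in> carrier A" "\<parallel>Q' k\<parallel> \<le> \<parallel>T'\<parallel> ^ (2 ^ k)" for k
    using nrm_iterated_square[OF TA(1,2), of k] nrm_iterated_square_le[OF TA(3), of k]
    by (auto simp: Q_def Q'_def)
  have Q_graded: "Q k \<in> graded (W (2 ^ k))" for k
  proof (induction k)
    case 0
    then show ?case
      using graded_mono[OF T W(4)] by (simp add: Q_def)
  next
    case (Suc k)
    have "Q (Suc k) = Q k \<otimes> Q k"
      by (simp add: Q_def)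
    also have "\<dots> \<in> graded ((\<lambda>(g, h). g \<cdot> h) ` (W (2 ^ k) \<times> W (2 ^ k)))"
      by (rule graded_mult[OF Suc Suc])
    finally show ?case
      by (rule graded_mono) (auto intro: W(5))
  qed
  have diff: "Q k \<ominus> Q' k \<in> I" for k
  proof (induction k)
    case 0
    have "T \<ominus> T' = Y\<^sup>\<star> \<otimes> n"
      using A by (simp add: T_def T'_def mult_diff_right)
    then show ?case
      using A I closed_idealD(3)[OF I(1)] by (simp add: Q_def Q'_def)
  next
    case (Suc k)
    have "Q (Suc k) \<ominus> Q' (Suc k) = Q k \<otimes> (Q k \<ominus> Q' k) \<oplus> (Q k \<ominus> Q' k) \<otimes> Q' k"
      using mult_diff_mult[OF QA(1,1,3,3)] by (simp add: Q_def Q'_def)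
    also have "\<dots> \<in> I"
      using closed_idealD(3-5)[OF I(1)] Suc QA by simp
    finally show ?case .
  qed
  have "\<parallel>T\<parallel> \<le> \<parallel>T'\<parallel>"
  proof (rule le_if_powers_le[of _ _ 1 "card S0"])
    fix k
    have "\<parallel>T\<parallel> ^ (2 ^ k) \<le> card (W (2 ^ k)) * \<parallel>Q k \<ominus> (Q k \<ominus> Q' k)\<parallel>"
      using nrm_graded_le_card[OF I(1,2) diff[of k] Q_graded[of k] W(1)] QA(2)[of k] by simp
    also have "\<dots> \<le> (2 ^ k + 1) ^ card S0 * \<parallel>T'\<parallel> ^ (2 ^ k)"
    proof (intro mult_mono)
      have "real (card (W (2 ^ k))) \<le> real ((2 ^ k + 1) ^ card S0)"
        using W(3) by (simp only: of_nat_le_iff)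
      then show "real (card (W (2 ^ k))) \<le> (2 ^ k + 1) ^ card S0"
        by (simp add: add.commute)
      show "\<parallel>Q k \<ominus> (Q k \<ominus> Q' k)\<parallel> \<le> \<parallel>T'\<parallel> ^ 2 ^ k"
        using QA by simp
    qed (use QA nrm_nonneg in auto)
    finally show "\<parallel>T\<parallel> ^ (2 ^ k) \<le> 1 * (2 ^ k + 1) ^ card S0 * \<parallel>T'\<parallel> ^ (2 ^ k)"
      by simp
  qed (use TA nrm_nonneg in auto)
  also have "\<parallel>T'\<parallel> \<le> \<parallel>Y\<parallel> * \<parallel>Y \<ominus> n\<parallel>"
    using nrm_mult[of "Y\<^sup>\<star>" "Y \<ominus> n"] A by (simp add: T'_def)
  finally have "\<parallel>Y\<parallel> * \<parallel>Y\<parallel> \<le> \<parallel>Y\<parallel> * \<parallel>Y \<ominus> n\<parallel>"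
    using nrm_star_mult[OF A(1)] by (simp add: T_def power2_eq_square)
  then show ?thesis
    using A nrm_nonneg[of Y] nrm_nonneg[of "Y \<ominus> n"]
    by (cases "\<parallel>Y\<parallel> = 0") (auto simp: mult_le_cancel_left)
qed

text \<open>The elements with such approximations form a C*-subalgebra that contains every
  \<open>B t\<close>, and these sets generate \<open>A\<close>.\<close>

lemma graded_dense:
  assumes "x \<in> carrier A" "\<epsilon> > 0"
  obtains S y where "finite S" "y \<in> graded S" "\<parallel>x \<ominus> y\<parallel> < \<epsilon>"
proof -
  define D where "D = {x \<in> carrier A. \<forall>\<epsilon>>0. \<exists>S y. finite S \<and> y \<in> graded S \<and> \<parallel>x \<ominus> y\<parallel> < \<epsilon>}"
  have DI: "x \<in> D" if "x \<in> carrier A" "\<And>\<epsilon>. \<epsilon> > 0 \<Longrightarrow> \<exists>S y. finite S \<and> y \<in> graded S \<and> \<parallel>x \<ominus> y\<parallel> < \<epsilon>" for x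
    using that by (simp add: D_def)
  have DE: "\<exists>S y. finite S \<and> y \<in> graded S \<and> y \<in> carrier A \<and> \<parallel>x \<ominus> y\<parallel> < \<epsilon>" if "x \<in> D" "\<epsilon> > 0" for x \<epsilon>
    using that graded_carrier unfolding D_def by blast
  have DA: "D \<subseteq> carrier A"
    by (auto simp: D_def)
  have graded_D: "y \<in> D" if "y \<in> graded S" "finite S" for y S
    using that graded_carrier[OF that(1)] by (intro DI) (auto intro!: exI[of _ S] exI[of _ y])
  have "cstar_subalgebra D A"
  proof (rule cstar_subalgebraI[OF DA])
    show "\<zero> \<in> D"
      by (rule graded_D[OF graded.zero[of "{}"]]) simp
    show "x \<oplus> y \<in> D" if xy: "x \<in> D" "y \<in> D" for x y
    proof (rule DI)
      show "x \<oplus> y \<in> carrier A"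
        using xy DA by auto
      fix \<epsilon> :: real assume "\<epsilon> > 0"
      then obtain S a S' b where ab: "finite S" "a \<in> graded S" "a \<in> carrier A" "\<parallel>x \<ominus> a\<parallel> < \<epsilon> / 2"
        "finite S'" "b \<in> graded S'" "b \<in> carrier A" "\<parallel>y \<ominus> b\<parallel> < \<epsilon> / 2"
        using DE[OF xy(1), of "\<epsilon> / 2"] DE[OF xy(2), of "\<epsilon> / 2"] by auto
      have "a \<oplus> b \<in> graded (S \<union> S')"
        using ab by (auto intro!: graded_add intro: graded_mono)
      moreover have "\<parallel>(x \<oplus> y) \<ominus> (a \<oplus> b)\<parallel> < \<epsilon>"
        using ab xy DA nrm_triangle[of "x \<ominus> a" "y \<ominus> b"] by (simp add: diff_add_add subset_iff)
      ultimately show "\<exists>S z. finite S \<and> z \<in> graded S \<and> \<parallel>(x \<oplus> y) \<ominus> z\<parallel> < \<epsilon>"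
        using ab by (intro exI[of _ "S \<union> S'"] exI[of _ "a \<oplus> b"]) auto
    qed
    show "c \<odot> x \<in> D" if x: "x \<in> D" for c x
    proof (rule DI)
      show "c \<odot> x \<in> carrier A"
        using x DA by auto
      fix \<epsilon> :: real assume "\<epsilon> > 0"
      then have "\<epsilon> / (cmod c + 1) > 0"
        by (simp add: add_nonneg_pos)
      then obtain S a where a: "finite S" "a \<in> graded S" "a \<in> carrier A" "\<parallel>x \<ominus> a\<parallel> < \<epsilon> / (cmod c + 1)"
        using DE[OF x] by blast
      have xA: "x \<in> carrier A" using x DA by auto
      have "\<parallel>c \<odot> x \<ominus> c \<odot> a\<parallel> = cmod c * \<parallel>x \<ominus> a\<parallel>"
        using xA a by (simp add: nrm_smult flip: scale_diff)
      also have "\<dots> \<le> (cmod c + 1) * \<parallel>x \<ominus> a\<parallel>"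
        using xA a by (intro mult_right_mono nrm_nonneg) auto
      also have "\<dots> < \<epsilon>"
        using a(4) by (simp add: pos_less_divide_eq add_nonneg_pos mult.commute)
      finally show "\<exists>S z. finite S \<and> z \<in> graded S \<and> \<parallel>c \<odot> x \<ominus> z\<parallel> < \<epsilon>"
        using a graded_scale by blast
    qed
    show "x \<otimes> y \<in> D" if xy: "x \<in> D" "y \<in> D" for x y
    proof (rule DI)
      have A: "x \<in> carrier A" "y \<in> carrier A"
        using xy DA by auto
      then show "x \<otimes> y \<in> carrier A" by simp
      fix \<epsilon> :: real assume \<epsilon>: "\<epsilon> > 0"
      have "\<epsilon> / (2 * (\<parallel>x\<parallel> + 1)) > 0"
        using \<epsilon> nrm_nonneg[OF A(1)] by (simp add: add_nonneg_pos)
      then obtain S' b where b: "finite S'" "b \<in> graded S'" "b \<in> carrier A" "\<parallel>y \<ominus> b\<parallel> < \<epsilon> / (2 * (\<parallel>x\<parallel> + 1))"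
        using DE[OF xy(2)] by blast
      \<comment> \<open>The accuracy required for \<open>x\<close> depends on the norm of
        \<open>b\<close>, so \<open>b\<close> has to be chosen before \<open>a\<close>.\<close>
      have "\<epsilon> / (2 * (\<parallel>b\<parallel> + 1)) > 0"
        using \<epsilon> nrm_nonneg[OF b(3)] by (simp add: add_nonneg_pos)
      then obtain S a where a: "finite S" "a \<in> graded S" "a \<in> carrier A" "\<parallel>x \<ominus> a\<parallel> < \<epsilon> / (2 * (\<parallel>b\<parallel> + 1))"
        using DE[OF xy(1)] by blast
      have "\<parallel>x\<parallel> * \<parallel>y \<ominus> b\<parallel> \<le> (\<parallel>x\<parallel> + 1) * \<parallel>y \<ominus> b\<parallel>"
        using A b by (intro mult_right_mono nrm_nonneg) auto
      also have "\<dots> < \<epsilon> / 2"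
        using b(4) nrm_nonneg[OF A(1)] by (simp add: pos_less_divide_eq add_nonneg_pos algebra_simps)
      finally have 1: "\<parallel>x\<parallel> * \<parallel>y \<ominus> b\<parallel> < \<epsilon> / 2" .
      have "\<parallel>x \<ominus> a\<parallel> * \<parallel>b\<parallel> \<le> \<parallel>x \<ominus> a\<parallel> * (\<parallel>b\<parallel> + 1)"
        using A a by (intro mult_left_mono nrm_nonneg) auto
      also have "\<dots> < \<epsilon> / 2"
        using a(4) nrm_nonneg[OF b(3)] by (simp add: pos_less_divide_eq add_nonneg_pos algebra_simps)
      finally have 2: "\<parallel>x \<ominus> a\<parallel> * \<parallel>b\<parallel> < \<epsilon> / 2" .
      have "\<parallel>x \<otimes> y \<ominus> a \<otimes> b\<parallel> < \<epsilon>"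
        using nrm_mult_diff_le[OF A a(3) b(3)] 1 2 by simp
      then show "\<exists>S z. finite S \<and> z \<in> graded S \<and> \<parallel>x \<otimes> y \<ominus> z\<parallel> < \<epsilon>"
        using a(1) b(1)
        by (intro exI[of _ "(\<lambda>(g, h). g \<cdot> h) ` (S \<times> S')"] exI[of _ "a \<otimes> b"] conjI
          graded_mult[OF a(2) b(2)] finite_imageI finite_cartesian_product)
    qed
    show "x\<^sup>\<star> \<in> D" if x: "x \<in> D" for x
    proof (rule DI)
      have xA: "x \<in> carrier A" using x DA by auto
      then show "x\<^sup>\<star> \<in> carrier A" by simp
      fix \<epsilon> :: real assume "\<epsilon> > 0"
      then obtain S a where a: "finite S" "a \<in> graded S" "a \<in> carrier A" "\<parallel>x \<ominus> a\<parallel> < \<epsilon>"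
        using DE[OF x] by blast
      moreover have "\<parallel>x\<^sup>\<star> \<ominus> a\<^sup>\<star>\<parallel> = \<parallel>x \<ominus> a\<parallel>"
        using nrm_star[of "x \<ominus> a"] xA a by (simp add: star_diff)
      ultimately show "\<exists>S z. finite S \<and> z \<in> graded S \<and> \<parallel>x\<^sup>\<star> \<ominus> z\<parallel> < \<epsilon>"
        using graded_star[OF a(2)] by (metis finite_imageI)
    qed
    show "x \<in> D" if x: "x \<in> carrier A" and lim: "\<forall>\<epsilon>>0. \<exists>y\<in>D. \<parallel>x \<ominus> y\<parallel> < \<epsilon>" for x
    proof (rule DI[OF x])
      fix \<epsilon> :: real assume "\<epsilon> > 0"
      then obtain y where y: "y \<in> D" "\<parallel>x \<ominus> y\<parallel> < \<epsilon> / 2"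
        using lim by (meson half_gt_zero)
      then obtain S a where a: "finite S" "a \<in> graded S" "a \<in> carrier A" "\<parallel>y \<ominus> a\<parallel> < \<epsilon> / 2"
        using DE[OF y(1), of "\<epsilon> / 2"] \<open>\<epsilon> > 0\<close> by auto
      have "\<parallel>x \<ominus> a\<parallel> < \<epsilon>"
        using nrm_diff_triangle[of x y a] x y a DA by auto
      then show "\<exists>S z. finite S \<and> z \<in> graded S \<and> \<parallel>x \<ominus> z\<parallel> < \<epsilon>"
        using a by blast
    qed
  qed
  moreover have "(\<Union>t\<in>P. B t) \<subseteq> D"
    using basis_fib fib_deg by (auto intro!: graded_D[of _ "{t}" for t] deg_graded)
  ultimately have "D = carrier A"
    by (rule generated_eq_carrier[OF generated])
  then show thesis
    using assms that unfolding D_def by blast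
qed

text \<open>A graded \<open>y\<close> close to \<open>n \<in> I\<close> satisfies
  \<open>||y|| \<le> ||y - n||\<close>, so \<open>||n|| \<le> 2 ||n - y||\<close> is arbitrarily
  small.\<close>

lemma proper_ideal_eq_zero:
  assumes I: "closed_ideal I A" "u \<notin> I"
  shows "I = {\<zero>}"
proof -
  have "n = \<zero>" if n: "n \<in> I" for n
  proof -
    have nA: "n \<in> carrier A"
      using n closed_idealD(2)[OF I(1)] by auto
    have "\<parallel>n\<parallel> \<le> 0 + \<epsilon>" if "\<epsilon> > 0" for \<epsilon>
    proof -
      obtain S y where y: "finite S" "y \<in> graded S" "\<parallel>n \<ominus> y\<parallel> < \<epsilon> / 2"
        using graded_dense[OF nA, of "\<epsilon> / 2"] \<open>\<epsilon> > 0\<close> by auto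
      have yA: "y \<in> carrier A"
        using y graded_carrier by blast
      have "\<parallel>n\<parallel> \<le> \<parallel>n \<ominus> y\<parallel> + \<parallel>y\<parallel>"
        by (rule nrm_le_diff_add[OF nA yA])
      also have "\<parallel>y\<parallel> \<le> \<parallel>y \<ominus> n\<parallel>"
        by (rule nrm_graded_le[OF I n y(2,1)])
      finally show ?thesis
        using y nrm_diff_commute[OF nA yA] by simp
    qed
    then have "\<parallel>n\<parallel> \<le> 0"
      by (rule field_le_epsilon)
    then show ?thesis
      using nrm_nonneg[OF nA] nrm_eq_0[OF nA] by simp
  qed
  moreover have "\<zero> \<in> I"
    by (rule submodule_zero[OF closed_idealD(1)[OF I(1)]])
  ultimately show ?thesis by blast
qed

theorem simple: "simple_cstar A"
  unfolding simple_cstar_def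
proof (intro conjI allI impI)
  show "carrier A \<noteq> {\<zero>}"
    using unit_closed unit_nonzero by blast
  show "I = {\<zero>} \<or> I = carrier A" if "closed_ideal I A" for I
    using proper_ideal_eq_zero closed_ideal_eq_carrier that by blast
qed


subsection \<open>Pure infiniteness\<close>

text \<open>A compression of \<open>x* x\<close> can be a definite positive scalar only if
  \<open>x w z\<close> does not become small along with the vectors \<open>z\<close>. Collected here
  are the \<open>x\<close> for which it does so behind every \<open>w\<close>; quantifying over
  \<open>w\<close> makes the set stable under multiplication from the right. It is a proper closed
  ideal and therefore zero by simplicity, which takes the place of a faithful conditional
  expectation.\<close>

definition vanishing :: "'a set" where
  "vanishing = {x \<in> carrier A. \<forall>t\<in>P. \<forall>w\<in>fib t. \<forall>\<epsilon>>0. \<exists>r\<in>P. \<exists>z\<in>sphere r. \<parallel>x \<otimes> (w \<otimes> z)\<parallel> < \<epsilon>}"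

lemma vanishingI:
  assumes "x \<in> carrier A"
    "\<And>t w \<epsilon>. \<lbrakk>t \<in> P; w \<in> fib t; \<epsilon> > 0\<rbrakk> \<Longrightarrow> \<exists>r\<in>P. \<exists>z\<in>sphere r. \<parallel>x \<otimes> (w \<otimes> z)\<parallel> < \<epsilon>"
  shows "x \<in> vanishing"
  using assms by (simp add: vanishing_def)

lemma vanishingE:
  assumes "x \<in> vanishing" "t \<in> P" "w \<in> fib t" "\<epsilon> > 0"
  obtains r z where "r \<in> P" "z \<in> sphere r" "\<parallel>x \<otimes> (w \<otimes> z)\<parallel> < \<epsilon>"
  using assms unfolding vanishing_def by blast

lemma vanishing_carrier: "x \<in> vanishing \<Longrightarrow> x \<in> carrier A"
  by (simp add: vanishing_def)

lemma nrm_mult_sphere_le: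
  assumes "x \<in> carrier A" "z \<in> sphere r" shows "\<parallel>x \<otimes> z\<parallel> \<le> \<parallel>x\<parallel>"
  using nrm_mult[of x z] assms nrm_sphere[OF assms(2)] sphere_carrier[OF assms(2)] by simp

lemma vanishing_add:
  assumes "x \<in> vanishing" "y \<in> vanishing" shows "x \<oplus> y \<in> vanishing"
proof (rule vanishingI)
  have A: "x \<in> carrier A" "y \<in> carrier A"
    using assms by (auto simp: vanishing_carrier)
  then show "x \<oplus> y \<in> carrier A" by simp
  fix t w and \<epsilon> :: real assume tw: "t \<in> P" "w \<in> fib t" "\<epsilon> > 0"
  obtain r z where rz: "r \<in> P" "z \<in> sphere r" "\<parallel>x \<otimes> (w \<otimes> z)\<parallel> < \<epsilon> / 2"
    using vanishingE[OF assms(1) tw(1,2), of "\<epsilon> / 2"] tw(3) by auto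
  have wz: "w \<otimes> z \<in> fib (t \<cdot> r)"
    by (rule fib_mult[OF tw(1) rz(1) tw(2) sphere_fib[OF rz(2)]])
  \<comment> \<open>\<open>y\<close> is tested behind \<open>w z\<close>, so that the vector found
    for \<open>x\<close> is kept as a left factor.\<close>
  obtain r' z' where rz': "r' \<in> P" "z' \<in> sphere r'" "\<parallel>y \<otimes> ((w \<otimes> z) \<otimes> z')\<parallel> < \<epsilon> / 2"
    using vanishingE[OF assms(2) P_mult[OF tw(1) rz(1)] wz, of "\<epsilon> / 2"] tw(3) by auto
  have wA: "w \<in> carrier A" "z \<in> carrier A" "z' \<in> carrier A"
    using tw rz rz' by auto
  have "\<parallel>(x \<oplus> y) \<otimes> (w \<otimes> (z \<otimes> z'))\<parallel> \<le> \<parallel>(x \<otimes> (w \<otimes> z)) \<otimes> z'\<parallel> + \<parallel>y \<otimes> ((w \<otimes> z) \<otimes> z')\<parallel>"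
    using A wA nrm_triangle[of "x \<otimes> (w \<otimes> (z \<otimes> z'))" "y \<otimes> (w \<otimes> (z \<otimes> z'))"]
    by (simp add: distrib_right mult_assoc)
  also have "\<parallel>(x \<otimes> (w \<otimes> z)) \<otimes> z'\<parallel> \<le> \<parallel>x \<otimes> (w \<otimes> z)\<parallel>"
    using A wA rz' by (intro nrm_mult_sphere_le) auto
  finally have "\<parallel>(x \<oplus> y) \<otimes> (w \<otimes> (z \<otimes> z'))\<parallel> < \<epsilon>"
    using rz rz' by simp
  then show "\<exists>r\<in>P. \<exists>z\<in>sphere r. \<parallel>(x \<oplus> y) \<otimes> (w \<otimes> z)\<parallel> < \<epsilon>"
    using sphere_mult[OF rz(1) rz'(1) rz(2) rz'(2)] rz(1) rz'(1) by blast
qed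

lemma vanishing_mult_left:
  assumes "x \<in> vanishing" "a \<in> carrier A" shows "a \<otimes> x \<in> vanishing"
proof (rule vanishingI)
  have A: "x \<in> carrier A"
    using assms by (auto simp: vanishing_carrier)
  then show "a \<otimes> x \<in> carrier A" using assms by simp
  fix t w and \<epsilon> :: real assume tw: "t \<in> P" "w \<in> fib t" "\<epsilon> > 0"
  have pos: "\<parallel>a\<parallel> + 1 > 0"
    using nrm_nonneg[OF assms(2)] by simp
  obtain r z where rz: "r \<in> P" "z \<in> sphere r" "\<parallel>x \<otimes> (w \<otimes> z)\<parallel> < \<epsilon> / (\<parallel>a\<parallel> + 1)"
    using vanishingE[OF assms(1) tw(1,2), of "\<epsilon> / (\<parallel>a\<parallel> + 1)"] tw(3) pos by auto
  have wA: "w \<in> carrier A" "z \<in> carrier A"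
    using tw rz by auto
  have "\<parallel>(a \<otimes> x) \<otimes> (w \<otimes> z)\<parallel> \<le> \<parallel>a\<parallel> * \<parallel>x \<otimes> (w \<otimes> z)\<parallel>"
    using A wA assms nrm_mult[of a "x \<otimes> (w \<otimes> z)"] by (simp add: mult_assoc)
  also have "\<dots> \<le> (\<parallel>a\<parallel> + 1) * \<parallel>x \<otimes> (w \<otimes> z)\<parallel>"
    using A wA by (intro mult_right_mono nrm_nonneg) auto
  also have "\<dots> < \<epsilon>"
    using rz(3) pos by (simp add: pos_less_divide_eq mult.commute)
  finally show "\<exists>r\<in>P. \<exists>z\<in>sphere r. \<parallel>(a \<otimes> x) \<otimes> (w \<otimes> z)\<parallel> < \<epsilon>"
    using rz by blast
qed

lemma vanishing_scale:
  assumes "x \<in> vanishing" shows "c \<odot> x \<in> vanishing"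
  using vanishing_mult_left[OF assms, of "c \<odot> u"] vanishing_carrier[OF assms]
  by (simp add: smult_mult_left)

lemma zero_vanishing: "\<zero> \<in> vanishing"
proof (rule vanishingI)
  fix t w and \<epsilon> :: real assume tw: "t \<in> P" "w \<in> fib t" "\<epsilon> > 0"
  obtain z where z: "z \<in> sphere \<one>\<^bsub>G\<^esub>"
    using sphere_nonempty by blast
  then have "\<parallel>\<zero> \<otimes> (w \<otimes> z)\<parallel> < \<epsilon>"
    using tw by (simp add: fib_carrier sphere_carrier)
  then show "\<exists>r\<in>P. \<exists>z\<in>sphere r. \<parallel>\<zero> \<otimes> (w \<otimes> z)\<parallel> < \<epsilon>"
    using z P_one by blast
qed simp

lemma vanishing_closed:
  assumes "x \<in> carrier A" "\<forall>\<epsilon>>0. \<exists>y\<in>vanishing. \<parallel>x \<ominus> y\<parallel> < \<epsilon>" shows "x \<in> vanishing"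
proof (rule vanishingI[OF assms(1)])
  fix t w and \<epsilon> :: real assume tw: "t \<in> P" "w \<in> fib t" "\<epsilon> > 0"
  have wA: "w \<in> carrier A"
    using tw by auto
  have pos: "2 * (\<parallel>w\<parallel> + 1) > 0"
    using nrm_nonneg[OF wA] by simp
  obtain y where y: "y \<in> vanishing" "\<parallel>x \<ominus> y\<parallel> < \<epsilon> / (2 * (\<parallel>w\<parallel> + 1))"
    using assms(2) tw(3) pos by (meson divide_pos_pos)
  have yA: "y \<in> carrier A"
    using y by (simp add: vanishing_carrier)
  obtain r z where rz: "r \<in> P" "z \<in> sphere r" "\<parallel>y \<otimes> (w \<otimes> z)\<parallel> < \<epsilon> / 2"
    using vanishingE[OF y(1) tw(1,2), of "\<epsilon> / 2"] tw(3) by auto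
  have zA: "z \<in> carrier A"
    using rz by auto
  have "\<parallel>x \<otimes> (w \<otimes> z)\<parallel> \<le> \<parallel>x \<otimes> (w \<otimes> z) \<ominus> y \<otimes> (w \<otimes> z)\<parallel> + \<parallel>y \<otimes> (w \<otimes> z)\<parallel>"
    using assms(1) yA wA zA by (intro nrm_le_diff_add) auto
  also have "x \<otimes> (w \<otimes> z) \<ominus> y \<otimes> (w \<otimes> z) = (x \<ominus> y) \<otimes> (w \<otimes> z)"
    using assms(1) yA wA zA by (simp add: mult_diff_left)
  also have "\<parallel>(x \<ominus> y) \<otimes> (w \<otimes> z)\<parallel> \<le> \<parallel>x \<ominus> y\<parallel> * \<parallel>w \<otimes> z\<parallel>"
    using assms(1) yA wA zA by (intro nrm_mult) auto
  also have "\<dots> \<le> \<parallel>x \<ominus> y\<parallel> * (\<parallel>w\<parallel> + 1)"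
    using nrm_mult_sphere_le[OF wA rz(2)] assms(1) yA by (intro mult_left_mono nrm_nonneg) auto
  also have "\<dots> < \<epsilon> / 2"
    using y(2) pos by (simp add: pos_less_divide_eq algebra_simps)
  finally have "\<parallel>x \<otimes> (w \<otimes> z)\<parallel> < \<epsilon>"
    using rz by simp
  then show "\<exists>r\<in>P. \<exists>z\<in>sphere r. \<parallel>x \<otimes> (w \<otimes> z)\<parallel> < \<epsilon>"
    using rz by blast
qed

text \<open>For \<open>c*\<close> the test vector \<open>w\<close> is replaced by
  \<open>c* w c\<close>, which lies in \<open>fib t\<close> because \<open>w c\<close> belongs to
  \<open>fib (s t)\<close> and \<open>G\<close> is abelian. A vector \<open>z\<close> found for it
  yields \<open>c z\<close> for the original \<open>w\<close>.\<close>

lemma vanishing_mult_basis: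
  assumes x: "x \<in> vanishing" and c: "s \<in> P" "c \<in> B s"
  shows "x \<otimes> c \<in> vanishing" "x \<otimes> c\<^sup>\<star> \<in> vanishing"
proof -
  have A: "x \<in> carrier A" "c \<in> carrier A"
    using x c by (auto simp: vanishing_carrier)
  show "x \<otimes> c \<in> vanishing"
  proof (rule vanishingI)
    fix t w and \<epsilon> :: real assume tw: "t \<in> P" "w \<in> fib t" "\<epsilon> > 0"
    have "c \<otimes> w \<in> fib (s \<cdot> t)"
      by (rule fib_mult[OF c(1) tw(1) basis_fib[OF c] tw(2)])
    then obtain r z where rz: "r \<in> P" "z \<in> sphere r" "\<parallel>x \<otimes> ((c \<otimes> w) \<otimes> z)\<parallel> < \<epsilon>"
      using vanishingE[OF x P_mult[OF c(1) tw(1)] _ tw(3)] by blast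
    moreover have "x \<otimes> ((c \<otimes> w) \<otimes> z) = (x \<otimes> c) \<otimes> (w \<otimes> z)"
      using A fib_carrier[OF tw(2)] sphere_carrier[OF rz(2)] by (simp add: mult_assoc)
    ultimately show "\<exists>r\<in>P. \<exists>z\<in>sphere r. \<parallel>(x \<otimes> c) \<otimes> (w \<otimes> z)\<parallel> < \<epsilon>"
      by auto
  qed (use A in simp)
  show "x \<otimes> c\<^sup>\<star> \<in> vanishing"
  proof (rule vanishingI)
    fix t w and \<epsilon> :: real assume tw: "t \<in> P" "w \<in> fib t" "\<epsilon> > 0"
    have wA: "w \<in> carrier A" using tw by auto
    have "w \<otimes> c \<in> fib (s \<cdot> t)"
      using fib_mult[OF tw(1) c(1) tw(2) basis_fib[OF c]] tw c by (simp add: G.m_comm)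
    then have "c\<^sup>\<star> \<otimes> (w \<otimes> c) \<in> fib t"
      by (rule fib_cancel[OF c(1) tw(1) basis_fib[OF c]])
    then obtain r z where rz: "r \<in> P" "z \<in> sphere r" "\<parallel>x \<otimes> ((c\<^sup>\<star> \<otimes> (w \<otimes> c)) \<otimes> z)\<parallel> < \<epsilon>"
      using vanishingE[OF x tw(1) _ tw(3)] by blast
    moreover have "x \<otimes> ((c\<^sup>\<star> \<otimes> (w \<otimes> c)) \<otimes> z) = (x \<otimes> c\<^sup>\<star>) \<otimes> (w \<otimes> (c \<otimes> z))"
      using A wA sphere_carrier[OF rz(2)] by (simp add: mult_assoc)
    moreover have "c \<otimes> z \<in> sphere (s \<cdot> r)"
      by (rule sphere_mult[OF c(1) rz(1) basis_sphere[OF c] rz(2)])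
    ultimately show "\<exists>r\<in>P. \<exists>z\<in>sphere r. \<parallel>(x \<otimes> c\<^sup>\<star>) \<otimes> (w \<otimes> z)\<parallel> < \<epsilon>"
      using P_mult[OF c(1) rz(1)] by auto
  qed (use A in simp)
qed

text \<open>The elements \<open>a\<close> for which both \<open>a\<close> and \<open>a*\<close>
  preserve the set as right multipliers form a C*-subalgebra that contains every \<open>B t\<close>.
  The adjoint is included in the condition to make this set self-adjoint.\<close>

lemma vanishing_mult_right:
  assumes "x \<in> vanishing" "a \<in> carrier A" shows "x \<otimes> a \<in> vanishing"
proof -
  define S where "S = {a \<in> carrier A. \<forall>x\<in>vanishing. x \<otimes> a \<in> vanishing \<and> x \<otimes> a\<^sup>\<star> \<in> vanishing}"
  have S: "S \<subseteq> carrier A"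
    by (auto simp: S_def)
  have "cstar_subalgebra S A"
  proof (rule cstar_subalgebraI[OF S])
    show "\<zero> \<in> S"
      using zero_vanishing by (simp add: S_def vanishing_carrier)
    show "a \<oplus> b \<in> S" if "a \<in> S" "b \<in> S" for a b
      using that by (auto simp: S_def star_add distrib_left vanishing_carrier intro!: vanishing_add)
    show "c \<odot> a \<in> S" if "a \<in> S" for c a
      using that by (auto simp: S_def star_smult smult_mult_right vanishing_carrier intro!: vanishing_scale)
    show "a \<otimes> b \<in> S" if "a \<in> S" "b \<in> S" for a b
      using that by (auto simp: S_def star_mult vanishing_carrier simp flip: mult_assoc)
    show "a\<^sup>\<star> \<in> S" if "a \<in> S" for a
      using that by (auto simp: S_def)
    show "a \<in> S" if a: "a \<in> carrier A" and lim: "\<forall>\<epsilon>>0. \<exists>b\<in>S. \<parallel>a \<ominus> b\<parallel> < \<epsilon>" for a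
    proof -
      have "x \<otimes> a \<in> vanishing \<and> x \<otimes> a\<^sup>\<star> \<in> vanishing" if x: "x \<in> vanishing" for x
      proof -
        have xA: "x \<in> carrier A"
          using x by (rule vanishing_carrier)
        have pos: "\<parallel>x\<parallel> + 1 > 0"
          using nrm_nonneg[OF xA] by simp
        have approx: "\<exists>b\<in>S. \<parallel>x \<otimes> a \<ominus> x \<otimes> b\<parallel> < \<epsilon> \<and> \<parallel>x \<otimes> a\<^sup>\<star> \<ominus> x \<otimes> b\<^sup>\<star>\<parallel> < \<epsilon>" if "\<epsilon> > 0" for \<epsilon>
        proof -
          obtain b where b: "b \<in> S" "\<parallel>a \<ominus> b\<parallel> < \<epsilon> / (\<parallel>x\<parallel> + 1)"
            using lim \<open>\<epsilon> > 0\<close> pos by (meson divide_pos_pos)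
          have bA: "b \<in> carrier A"
            using b S by auto
          have le: "\<parallel>x \<otimes> d\<parallel> < \<epsilon>" if d: "d \<in> carrier A" "\<parallel>d\<parallel> = \<parallel>a \<ominus> b\<parallel>" for d
          proof -
            have "\<parallel>x \<otimes> d\<parallel> \<le> \<parallel>x\<parallel> * \<parallel>d\<parallel>"
              using xA d by (intro nrm_mult)
            also have "\<dots> \<le> (\<parallel>x\<parallel> + 1) * \<parallel>d\<parallel>"
              using d by (intro mult_right_mono nrm_nonneg) auto
            also have "\<dots> < \<epsilon>"
              using b(2) d(2) pos by (simp add: pos_less_divide_eq mult.commute)
            finally show ?thesis .
          qed
          have "\<parallel>x \<otimes> (a \<ominus> b)\<parallel> < \<epsilon>"
            using a bA by (intro le) auto
          moreover have "\<parallel>x \<otimes> (a \<ominus> b)\<^sup>\<star>\<parallel> < \<epsilon>"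
            using a bA by (intro le) auto
          ultimately show ?thesis
            using b(1) a bA xA by (auto simp: mult_diff_right star_diff)
        qed
        have "x \<otimes> a \<in> vanishing"
        proof (rule vanishing_closed)
          show "\<forall>\<epsilon>>0. \<exists>y\<in>vanishing. \<parallel>x \<otimes> a \<ominus> y\<parallel> < \<epsilon>"
            using approx x unfolding S_def by blast
        qed (use xA a in simp)
        moreover have "x \<otimes> a\<^sup>\<star> \<in> vanishing"
        proof (rule vanishing_closed)
          show "\<forall>\<epsilon>>0. \<exists>y\<in>vanishing. \<parallel>x \<otimes> a\<^sup>\<star> \<ominus> y\<parallel> < \<epsilon>"
            using approx x unfolding S_def by blast
        qed (use xA a in simp)
        ultimately show ?thesis ..
      qed
      with a show ?thesis
        by (simp add: S_def)
    qed
  qed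
  moreover have "(\<Union>t\<in>P. B t) \<subseteq> S"
    using vanishing_mult_basis by (auto simp: S_def)
  ultimately have "S = carrier A"
    by (rule generated_eq_carrier[OF generated])
  with assms show ?thesis
    by (auto simp: S_def)
qed

lemma vanishing_eq_zero: "vanishing = {\<zero>}"
proof (rule proper_ideal_eq_zero)
  show "closed_ideal vanishing A"
    by (rule closed_idealI) (auto intro: vanishing_carrier zero_vanishing vanishing_add vanishing_scale
        vanishing_mult_left vanishing_mult_right vanishing_closed)
  show "u \<notin> vanishing"
  proof
    assume u: "u \<in> vanishing"
    obtain w where w: "w \<in> sphere \<one>\<^bsub>G\<^esub>"
      using sphere_nonempty by blast
    obtain r z where rz: "r \<in> P" "z \<in> sphere r" "\<parallel>u \<otimes> (w \<otimes> z)\<parallel> < 1"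
      using vanishingE[OF u P_one sphere_fib[OF w] zero_less_one] by blast
    have "\<parallel>w \<otimes> z\<parallel> = 1"
      using sphere_mult[OF P_one rz(1) w rz(2)] by (rule nrm_sphere)
    with rz w show False
      by (simp add: sphere_carrier)
  qed
qed

section \<open>Compression to multiples of the unit\<close>

lemma nrm_compress_bounded_below:
  assumes "x \<in> carrier A" "x \<noteq> \<zero>"
  obtains t w \<epsilon> where "t \<in> P" "w \<in> fib t" "\<epsilon> > 0"
    "\<And>r z. \<lbrakk>r \<in> P; z \<in> sphere r\<rbrakk> \<Longrightarrow> \<epsilon> \<le> \<parallel>x \<otimes> (w \<otimes> z)\<parallel>"
proof -
  have "x \<notin> vanishing"
    using assms vanishing_eq_zero by auto
  then show thesis
    using assms(1) that unfolding vanishing_def by (auto simp: not_less)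
qed

text \<open>An element of \<open>mp s t\<close> sends \<open>fib t\<close> into
  \<open>fib s\<close>, so it suffices that \<open>z\<close> has a factor from such a
  \<open>fib t\<close> for each of the finitely many components; their order is irrelevant because
  \<open>G\<close> is abelian. Each \<open>y g z\<close> is then a fibre vector, whose square is a
  scalar.\<close>

lemma exists_common_shift:
  assumes "finite F" "\<And>g. g \<in> F \<Longrightarrow> y g \<in> deg g"
  shows "\<exists>r\<in>P. \<exists>z\<in>sphere r. \<forall>g\<in>F. \<exists>s\<in>P. y g \<otimes> z \<in> fib s"
  using assms
proof (induction F)
  case empty
  then show ?case
    using sphere_nonempty P_one by blast
next
  case (insert h F)
  then obtain r z where rz: "r \<in> P" "z \<in> sphere r" "\<And>g. g \<in> F \<Longrightarrow> \<exists>s\<in>P. y g \<otimes> z \<in> fib s"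
    by (metis insert_iff)
  obtain s t where st: "s \<in> P" "t \<in> P" "y h \<in> mp s t"
    using insert.prems[of h] by (auto simp: deg_def)
  obtain z' where z': "z' \<in> sphere t"
    using sphere_nonempty[OF st(2)] by blast
  have zA: "z \<in> carrier A" "z' \<in> carrier A"
    using rz z' by auto
  have "\<exists>s\<in>P. y g \<otimes> (z \<otimes> z') \<in> fib s" if g: "g \<in> insert h F" for g
  proof (cases "g = h")
    case True
    have "z \<otimes> z' \<in> fib (t \<cdot> r)"
      using fib_mult[OF rz(1) st(2) sphere_fib[OF rz(2)] sphere_fib[OF z']] rz st by (simp add: G.m_comm)
    then have "y h \<otimes> (z \<otimes> z') \<in> fib (s \<cdot> r)"
      by (rule mpD[OF mp_raise[OF st(1,2) rz(1) st(3)]])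
    with True show ?thesis
      using P_mult[OF st(1) rz(1)] by blast
  next
    case False
    then obtain s' where s': "s' \<in> P" "y g \<otimes> z \<in> fib s'"
      using rz(3) g by auto
    have "y g \<in> carrier A"
      using insert.prems[OF g] by auto
    then have "y g \<otimes> (z \<otimes> z') = (y g \<otimes> z) \<otimes> z'"
      using zA by (simp add: mult_assoc)
    then show ?thesis
      using fib_mult[OF s'(1) st(2) s'(2) sphere_fib[OF z']] P_mult[OF s'(1) st(2)] by auto
  qed
  then show ?case
    using sphere_mult[OF rz(1) st(2) rz(2) z'] P_mult[OF rz(1) st(2)] by blast
qed

text \<open>A vector \<open>z\<close> moves all components into fibres, which turns the diagonal
  terms of \<open>Y* Y\<close> into scalars. A further vector \<open>z'\<close> makes the cross
  terms small, since the one for \<open>g\<close>, \<open>h\<close> has degree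
  \<open>g^-1 h \<noteq> 1\<close>. The scalar \<open>\<mu>\<close> is the sum of the squared norms
  of the shifted components.\<close>

lemma exists_near_scalar_compression:
  assumes Y: "Y \<in> graded S" and \<eta>: "\<eta> > 0"
  obtains r z \<mu> where "r \<in> P" "z \<in> sphere r" "0 \<le> \<mu>"
    "\<parallel>(Y \<otimes> z)\<^sup>\<star> \<otimes> (Y \<otimes> z) \<ominus> complex_of_real \<mu> \<odot> u\<parallel> \<le> \<eta>"
proof -
  obtain F c where F: "finite F" "\<And>g. g \<in> F \<Longrightarrow> c g \<in> deg g" "Y = (\<Oplus>g\<in>F. c g)"
    using graded_components[OF Y] by blast
  obtain r z where rz: "r \<in> P" "z \<in> sphere r" "\<And>g. g \<in> F \<Longrightarrow> \<exists>s\<in>P. c g \<otimes> z \<in> fib s"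
    using exists_common_shift[OF F(1,2)] by blast
  have cA: "c g \<in> carrier A" if "g \<in> F" for g
    using F(2)[OF that] by auto
  have zA: "z \<in> carrier A"
    using rz by auto
  define v where "v g = c g \<otimes> z" for g
  have v_deg: "v g \<in> deg (g \<cdot> r)" if "g \<in> F" for g
    unfolding v_def using F(2)[OF that] fib_deg[OF rz(1) sphere_fib[OF rz(2)]] by (rule deg_mult)
  have gG: "g \<in> carrier G" if "g \<in> F" for g
    using F(2)[OF that] by (rule deg_in_carrier)
  define J where "J = {p \<in> F \<times> F. fst p \<noteq> snd p}"
  \<comment> \<open>At most \<open>card F * card F\<close> cross terms have to fit into
    \<open>\<eta>\<close>.\<close>
  define \<delta> where "\<delta> = \<eta> / (real (card F) * real (card F) + 1)"
  have \<delta>: "\<delta> > 0"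
    using \<eta> by (simp add: \<delta>_def add_nonneg_pos)
  have "\<exists>r\<in>P. \<exists>z\<in>sphere r. \<forall>p\<in>J. \<parallel>z\<^sup>\<star> \<otimes> (((v (fst p))\<^sup>\<star> \<otimes> v (snd p)) \<otimes> z)\<parallel> < \<delta>"
  proof (rule exists_common_small_compression[where
        g = "\<lambda>p. inv\<^bsub>G\<^esub> (fst p \<cdot> r) \<cdot> (snd p \<cdot> r)"])
    show "finite J"
      using F by (auto simp: J_def)
    show "(v (fst p))\<^sup>\<star> \<otimes> v (snd p) \<in> deg (inv\<^bsub>G\<^esub> (fst p \<cdot> r) \<cdot> (snd p \<cdot> r))" if "p \<in> J" for p
      using that by (intro deg_mult deg_star v_deg) (auto simp: J_def)
    show "inv\<^bsub>G\<^esub> (fst p \<cdot> r) \<cdot> (snd p \<cdot> r) \<noteq> \<one>\<^bsub>G\<^esub>" if p: "p \<in> J" for p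
    proof
      have carr: "fst p \<in> carrier G" "snd p \<in> carrier G" "r \<in> carrier G"
        using p gG rz by (auto simp: J_def)
      assume "inv\<^bsub>G\<^esub> (fst p \<cdot> r) \<cdot> (snd p \<cdot> r) = \<one>\<^bsub>G\<^esub>"
      then have "snd p \<cdot> r = fst p \<cdot> r"
        using carr by (metis G.inv_equality G.inv_inv G.inv_closed G.m_closed)
      then show False
        using p carr by (simp add: J_def)
    qed
  qed (rule \<delta>)
  then obtain r' z' where rz': "r' \<in> P" "z' \<in> sphere r'"
    "\<And>p. p \<in> J \<Longrightarrow> \<parallel>z'\<^sup>\<star> \<otimes> (((v (fst p))\<^sup>\<star> \<otimes> v (snd p)) \<otimes> z')\<parallel> < \<delta>"
    by blast
  have z'A: "z' \<in> carrier A"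
    using rz' by auto
  have vA: "v g \<in> carrier A" if "g \<in> F" for g
    using cA[OF that] zA by (simp add: v_def)
  define q where "q g = v g \<otimes> z'" for g
  have qA: "q g \<in> carrier A" if "g \<in> F" for g
    using vA[OF that] z'A by (simp add: q_def)
  have q_self: "(q g)\<^sup>\<star> \<otimes> q g = complex_of_real (\<parallel>q g\<parallel>\<^sup>2) \<odot> u" if g: "g \<in> F" for g
  proof -
    obtain s where s: "s \<in> P" "v g \<in> fib s"
      using rz(3)[OF g] by (auto simp: v_def)
    have "q g \<in> fib (s \<cdot> r')"
      unfolding q_def by (rule fib_mult[OF s(1) rz'(1) s(2) sphere_fib[OF rz'(2)]])
    then show ?thesis
      by (rule inner_self[OF P_mult[OF s(1) rz'(1)]])
  qed
  have q_cross: "\<parallel>(q g)\<^sup>\<star> \<otimes> q h\<parallel> < \<delta>" if "g \<in> F" "h \<in> F" "g \<noteq> h" for g h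
  proof -
    have "(q g)\<^sup>\<star> \<otimes> q h = z'\<^sup>\<star> \<otimes> (((v g)\<^sup>\<star> \<otimes> v h) \<otimes> z')"
      using vA that z'A by (simp add: q_def star_mult mult_assoc)
    then show ?thesis
      using rz'(3)[of "(g, h)"] that by (simp add: J_def)
  qed
  define E where "E g = (\<Oplus>h\<in>F - {g}. (q g)\<^sup>\<star> \<otimes> q h)" for g
  have EA: "E g \<in> carrier A" if "g \<in> F" for g
    unfolding E_def using qA that by auto
  have E_le: "\<parallel>E g\<parallel> \<le> card F * \<delta>" if g: "g \<in> F" for g
  proof -
    have "\<parallel>E g\<parallel> \<le> (\<Sum>h\<in>F - {g}. \<parallel>(q g)\<^sup>\<star> \<otimes> q h\<parallel>)"
      unfolding E_def using qA g by (intro nrm_sum_le) auto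
    also have "\<dots> \<le> (\<Sum>h\<in>F - {g}. \<delta>)"
      using g q_cross by (intro sum_mono less_imp_le) auto
    also have "\<dots> \<le> card F * \<delta>"
      using F(1) \<delta> by (auto intro!: mult_right_mono card_mono)
    finally show ?thesis .
  qed
  define \<mu> where "\<mu> = (\<Sum>g\<in>F. \<parallel>q g\<parallel>\<^sup>2)"
  let ?z = "z \<otimes> z'" and ?q = "\<Oplus>g\<in>F. q g"
  have Yz: "Y \<otimes> ?z = ?q"
  proof -
    have "Y \<otimes> ?z = (\<Oplus>g\<in>F. c g \<otimes> ?z)"
      unfolding F(3) using cA zA z'A by (intro sum_mult_right) auto
    also have "\<dots> = ?q"
      using cA zA z'A by (intro sum_cong refl) (auto simp: q_def v_def mult_assoc)
    finally show ?thesis .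
  qed
  have q'A: "?q \<in> carrier A"
    using qA by auto
  have "?q\<^sup>\<star> \<otimes> ?q = (\<Oplus>g\<in>F. (q g)\<^sup>\<star>) \<otimes> ?q"
    using qA by (simp add: star_sum)
  also have "\<dots> = (\<Oplus>g\<in>F. (q g)\<^sup>\<star> \<otimes> ?q)"
    using qA q'A by (intro sum_mult_right) auto
  also have "\<dots> = (\<Oplus>g\<in>F. complex_of_real (\<parallel>q g\<parallel>\<^sup>2) \<odot> u \<oplus> E g)"
  proof (intro sum_cong refl)
    fix g assume g: "g \<in> F"
    have "(q g)\<^sup>\<star> \<otimes> ?q = (\<Oplus>h\<in>F. (q g)\<^sup>\<star> \<otimes> q h)"
      using qA g by (intro sum_mult_left) auto
    also have "\<dots> = (\<Oplus>h\<in>insert g (F - {g}). (q g)\<^sup>\<star> \<otimes> q h)"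
      using g by (simp add: insert_absorb)
    also have "\<dots> = (q g)\<^sup>\<star> \<otimes> q g \<oplus> E g"
      unfolding E_def using F(1) qA g by (intro sum_insert) auto
    finally show "(q g)\<^sup>\<star> \<otimes> ?q = complex_of_real (\<parallel>q g\<parallel>\<^sup>2) \<odot> u \<oplus> E g"
      unfolding q_self[OF g] .
  qed (use EA in auto)
  also have "\<dots> = (\<Oplus>g\<in>F. complex_of_real (\<parallel>q g\<parallel>\<^sup>2) \<odot> u) \<oplus> (\<Oplus>g\<in>F. E g)"
    using EA by (intro M.finsum_addf) auto
  also have "(\<Oplus>g\<in>F. complex_of_real (\<parallel>q g\<parallel>\<^sup>2) \<odot> u) = complex_of_real \<mu> \<odot> u"
    unfolding sum_scale_const[OF F(1) unit_closed] by (simp add: \<mu>_def)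
  finally have eq: "?q\<^sup>\<star> \<otimes> ?q = complex_of_real \<mu> \<odot> u \<oplus> (\<Oplus>g\<in>F. E g)" .
  have "\<parallel>?q\<^sup>\<star> \<otimes> ?q \<ominus> complex_of_real \<mu> \<odot> u\<parallel> = \<parallel>\<Oplus>g\<in>F. E g\<parallel>"
  proof -
    have "(\<Oplus>g\<in>F. E g) \<in> carrier A"
      using EA by auto
    then have "complex_of_real \<mu> \<odot> u \<oplus> (\<Oplus>g\<in>F. E g) \<ominus> complex_of_real \<mu> \<odot> u = (\<Oplus>g\<in>F. E g)"
      using M.a_comm[of "complex_of_real \<mu> \<odot> u" "\<Oplus>g\<in>F. E g"]
      by (simp add: a_minus_def M.a_assoc M.r_neg)
    then show ?thesis
      by (simp add: eq)
  qed
  also have "\<dots> \<le> (\<Sum>g\<in>F. \<parallel>E g\<parallel>)"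
    using EA by (intro nrm_sum_le) auto
  also have "\<dots> \<le> (\<Sum>g\<in>F. card F * \<delta>)"
    by (intro sum_mono E_le)
  also have "\<dots> = real (card F) * real (card F) * \<delta>"
    by simp
  also have "\<dots> \<le> \<eta>"
  proof -
    have "m * (\<eta> / (m + 1)) \<le> \<eta>" if "m \<ge> 0" for m :: real
      using \<eta> that by (simp add: field_simps)
    then show ?thesis
      unfolding \<delta>_def by simp
  qed
  finally have "\<parallel>(Y \<otimes> ?z)\<^sup>\<star> \<otimes> (Y \<otimes> ?z) \<ominus> complex_of_real \<mu> \<odot> u\<parallel> \<le> \<eta>"
    unfolding Yz .
  moreover have "0 \<le> \<mu>"
    by (simp add: \<mu>_def sum_nonneg)
  ultimately show thesis
    using that[OF P_mult[OF rz(1) rz'(1)] sphere_mult[OF rz(1) rz'(1) rz(2) rz'(2)]] by blast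
qed

text \<open>The lower bound \<open>\<epsilon>\<close> for \<open>||x w z||\<close> is uniform in
  \<open>z\<close>; it is fixed before the approximation and keeps \<open>\<mu>\<close> away from
  zero. A total error of \<open>\<epsilon>^2 / 4\<close> gives
  \<open>\<mu> \<ge> 3 \<epsilon>^2 / 4\<close>, and so it is at most \<open>\<mu> / 2\<close>, the
  relative accuracy that \<open>exists_normalizer\<close> demands.\<close>

lemma exists_near_scalar_square:
  assumes x: "x \<in> carrier A" "x \<noteq> \<zero>"
  obtains b \<mu> where "b \<in> carrier A" "0 < \<mu>"
    "\<parallel>(x \<otimes> b)\<^sup>\<star> \<otimes> (x \<otimes> b) \<ominus> complex_of_real \<mu> \<odot> u\<parallel> \<le> \<mu> / 2"
proof -
  obtain t w \<epsilon> where w: "t \<in> P" "w \<in> fib t" "\<epsilon> > 0"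
    and below: "\<And>r z. \<lbrakk>r \<in> P; z \<in> sphere r\<rbrakk> \<Longrightarrow> \<epsilon> \<le> \<parallel>x \<otimes> (w \<otimes> z)\<parallel>"
    using nrm_compress_bounded_below[OF x] by blast
  have wA: "w \<in> carrier A"
    using w by auto
  define xw where "xw = x \<otimes> w"
  have xw: "xw \<in> carrier A"
    using x wA by (simp add: xw_def)
  \<comment> \<open>Replacing \<open>x w\<close> by \<open>Y\<close> changes the square by at most
    \<open>\<eta> (2 ||x w|| + 1)\<close>, and the compression of \<open>Y\<close> adds another
    \<open>\<eta>\<close>.\<close>
  define N where "N = 2 * \<parallel>xw\<parallel> + 2"
  have N: "N > 0"
    using nrm_nonneg[OF xw] by (simp add: N_def)
  define \<eta> where "\<eta> = min 1 (\<epsilon>\<^sup>2 / (4 * N))"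
  have \<eta>: "\<eta> > 0" "\<eta> \<le> 1" "\<eta> * N \<le> \<epsilon>\<^sup>2 / 4"
  proof -
    show "\<eta> > 0" "\<eta> \<le> 1"
      using w N by (auto simp: \<eta>_def)
    have "\<eta> * N \<le> \<epsilon>\<^sup>2 / (4 * N) * N"
      using N by (intro mult_right_mono) (auto simp: \<eta>_def)
    then show "\<eta> * N \<le> \<epsilon>\<^sup>2 / 4"
      using N by simp
  qed
  obtain S Y where Y: "finite S" "Y \<in> graded S" "\<parallel>xw \<ominus> Y\<parallel> < \<eta>"
    using graded_dense[OF xw \<eta>(1)] by blast
  have YA: "Y \<in> carrier A"
    using Y graded_carrier by blast
  obtain r z \<mu> where rz: "r \<in> P" "z \<in> sphere r" "0 \<le> \<mu>"
    and near: "\<parallel>(Y \<otimes> z)\<^sup>\<star> \<otimes> (Y \<otimes> z) \<ominus> complex_of_real \<mu> \<odot> u\<parallel> \<le> \<eta>"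
    using exists_near_scalar_compression[OF Y(2) \<eta>(1)] by blast
  have zA: "z \<in> carrier A"
    using rz by auto
  define h where "h = (xw \<otimes> z)\<^sup>\<star> \<otimes> (xw \<otimes> z)"
  define k where "k = (Y \<otimes> z)\<^sup>\<star> \<otimes> (Y \<otimes> z)"
  have hk: "h \<in> carrier A" "k \<in> carrier A"
    using xw YA zA by (auto simp: h_def k_def)
  have xwz: "\<parallel>xw \<otimes> z\<parallel> \<le> \<parallel>xw\<parallel>" "\<parallel>Y \<otimes> z\<parallel> \<le> \<parallel>xw\<parallel> + 1"
  proof -
    show "\<parallel>xw \<otimes> z\<parallel> \<le> \<parallel>xw\<parallel>"
      using nrm_mult_sphere_le[OF xw rz(2)] .
    have "\<parallel>Y \<otimes> z\<parallel> \<le> \<parallel>Y\<parallel>"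
      using nrm_mult_sphere_le[OF YA rz(2)] .
    also have "\<dots> \<le> \<parallel>Y \<ominus> xw\<parallel> + \<parallel>xw\<parallel>"
      by (rule nrm_le_diff_add[OF YA xw])
    finally show "\<parallel>Y \<otimes> z\<parallel> \<le> \<parallel>xw\<parallel> + 1"
      using Y(3) \<eta>(2) nrm_diff_commute[OF xw YA] by simp
  qed
  have diff: "\<parallel>xw \<otimes> z \<ominus> Y \<otimes> z\<parallel> \<le> \<eta>"
    using nrm_mult_sphere_le[of "xw \<ominus> Y" z r] xw YA zA rz Y(3) by (simp add: mult_diff_left)
  have "\<parallel>h \<ominus> k\<parallel> \<le> \<parallel>(xw \<otimes> z)\<^sup>\<star>\<parallel> * \<parallel>xw \<otimes> z \<ominus> Y \<otimes> z\<parallel> + \<parallel>(xw \<otimes> z)\<^sup>\<star> \<ominus> (Y \<otimes> z)\<^sup>\<star>\<parallel> * \<parallel>Y \<otimes> z\<parallel>"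
    unfolding h_def k_def using xw YA zA by (intro nrm_mult_diff_le) auto
  also have "\<parallel>(xw \<otimes> z)\<^sup>\<star> \<ominus> (Y \<otimes> z)\<^sup>\<star>\<parallel> = \<parallel>xw \<otimes> z \<ominus> Y \<otimes> z\<parallel>"
    using nrm_star[of "xw \<otimes> z \<ominus> Y \<otimes> z"] xw YA zA by (simp add: star_diff)
  also have "\<parallel>(xw \<otimes> z)\<^sup>\<star>\<parallel> = \<parallel>xw \<otimes> z\<parallel>"
    using xw zA by simp
  also have "\<parallel>xw \<otimes> z\<parallel> * \<parallel>xw \<otimes> z \<ominus> Y \<otimes> z\<parallel> + \<parallel>xw \<otimes> z \<ominus> Y \<otimes> z\<parallel> * \<parallel>Y \<otimes> z\<parallel> \<le> \<parallel>xw\<parallel> * \<eta> + \<eta> * (\<parallel>xw\<parallel> + 1)"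
    using xwz diff xw YA zA \<eta>(1) nrm_nonneg by (intro add_mono mult_mono) auto
  finally have hk_le: "\<parallel>h \<ominus> k\<parallel> \<le> \<eta> * (2 * \<parallel>xw\<parallel> + 1)"
    by (simp add: algebra_simps)
  have "\<parallel>h \<ominus> complex_of_real \<mu> \<odot> u\<parallel> \<le> \<parallel>h \<ominus> k\<parallel> + \<parallel>k \<ominus> complex_of_real \<mu> \<odot> u\<parallel>"
    using hk by (intro nrm_diff_triangle) auto
  also have "\<dots> \<le> \<eta> * N"
    using hk_le near by (simp add: N_def k_def algebra_simps)
  finally have close: "\<parallel>h \<ominus> complex_of_real \<mu> \<odot> u\<parallel> \<le> \<epsilon>\<^sup>2 / 4"
    using \<eta>(3) by simp
  have "\<epsilon>\<^sup>2 \<le> \<parallel>xw \<otimes> z\<parallel>\<^sup>2"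
    using below[OF rz(1,2)] w x wA zA by (intro power_mono) (auto simp: xw_def mult_assoc)
  also have "\<dots> = \<parallel>h\<parallel>"
    using xw zA by (simp add: h_def nrm_star_mult)
  also have "\<dots> \<le> \<parallel>h \<ominus> complex_of_real \<mu> \<odot> u\<parallel> + \<parallel>complex_of_real \<mu> \<odot> u\<parallel>"
    using hk by (intro nrm_le_diff_add) auto
  finally have "\<epsilon>\<^sup>2 \<le> \<epsilon>\<^sup>2 / 4 + \<mu>"
    using close rz(3) by simp
  moreover have "\<epsilon>\<^sup>2 > 0"
    using w by simp
  ultimately have "0 < \<mu>" "\<epsilon>\<^sup>2 / 4 \<le> \<mu> / 2"
    by linarith+
  moreover have "h = (x \<otimes> (w \<otimes> z))\<^sup>\<star> \<otimes> (x \<otimes> (w \<otimes> z))"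
    using x wA zA by (simp add: h_def xw_def mult_assoc)
  ultimately show thesis
    using that[of "w \<otimes> z" \<mu>] close wA zA by simp
qed

text \<open>Division by \<open>\<mu>\<close> brings the square within 1/2 of \<open>u\<close>, and
  \<open>exists_normalizer\<close> corrects the remainder by some \<open>d\<close>; the element
  wanted is \<open>b d / sqrt \<mu>\<close>.\<close>

lemma exists_isometry_through:
  assumes x: "x \<in> carrier A" "x \<noteq> \<zero>"
  obtains b where "b \<in> carrier A" "(x \<otimes> b)\<^sup>\<star> \<otimes> (x \<otimes> b) = u"
proof -
  obtain b \<mu> where b: "b \<in> carrier A" "0 < \<mu>"
    "\<parallel>(x \<otimes> b)\<^sup>\<star> \<otimes> (x \<otimes> b) \<ominus> complex_of_real \<mu> \<odot> u\<parallel> \<le> \<mu> / 2"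
    using exists_near_scalar_square[OF x] by blast
  define k where "k = (x \<otimes> b)\<^sup>\<star> \<otimes> (x \<otimes> b)"
  have k: "k \<in> carrier A" "k\<^sup>\<star> = k"
    using x b by (auto simp: k_def star_mult)
  define h where "h = complex_of_real (1 / \<mu>) \<odot> k"
  have h: "h \<in> carrier A" "h\<^sup>\<star> = h"
    using k by (auto simp: h_def star_smult)
  have "h \<ominus> u = complex_of_real (1 / \<mu>) \<odot> (k \<ominus> complex_of_real \<mu> \<odot> u)"
    using k b(2) by (simp add: h_def scale_diff)
  then have "\<parallel>h \<ominus> u\<parallel> = (1 / \<mu>) * \<parallel>k \<ominus> complex_of_real \<mu> \<odot> u\<parallel>"
    using k b(2) by (simp add: nrm_smult norm_divide)
  also have "\<dots> \<le> (1 / \<mu>) * (\<mu> / 2)"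
    using b by (intro mult_left_mono) (auto simp: k_def)
  finally have "\<parallel>u \<ominus> h\<parallel> \<le> 1/2"
    using b(2) h nrm_diff_commute[of u h] by simp
  then obtain d where d: "d \<in> carrier A" "d\<^sup>\<star> \<otimes> (h \<otimes> d) = u"
    using exists_normalizer[OF h] by blast
  define c where "c = complex_of_real (1 / sqrt \<mu>)"
  have c: "cnj c = c" "c * c = complex_of_real (1 / \<mu>)"
    using b(2) by (simp_all add: c_def del: of_real_divide flip: of_real_mult)
  have xd: "x \<otimes> (c \<odot> (b \<otimes> d)) = c \<odot> ((x \<otimes> b) \<otimes> d)"
    using x b d by (simp add: smult_mult_right mult_assoc)
  have "(x \<otimes> (c \<odot> (b \<otimes> d)))\<^sup>\<star> \<otimes> (x \<otimes> (c \<odot> (b \<otimes> d))) = (c * c) \<odot> (d\<^sup>\<star> \<otimes> (k \<otimes> d))"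
    unfolding xd k_def using x b d c(1)
    by (simp add: star_smult star_mult smult_mult_left smult_mult_right mult_assoc)
  also have "\<dots> = d\<^sup>\<star> \<otimes> (h \<otimes> d)"
    unfolding c(2) h_def using k d by (simp add: smult_mult_left smult_mult_right)
  finally show thesis
    using that[of "c \<odot> (b \<otimes> d)"] b d by simp
qed

text \<open>The non-unitary isometry \<open>w\<close> is transported by \<open>v\<close>: the
  partial isometry \<open>v w v*\<close> links \<open>v v*\<close> with its proper subprojection
  \<open>v w w* v*\<close>.\<close>

lemma infinite_range_projection:
  assumes v: "v \<in> carrier A" "v\<^sup>\<star> \<otimes> v = u" and w: "w \<in> carrier A" "w\<^sup>\<star> \<otimes> w = u" "w \<otimes> w\<^sup>\<star> \<noteq> u"
  shows "infinite_projection A (v \<otimes> v\<^sup>\<star>)"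
proof -
  have vv: "v\<^sup>\<star> \<otimes> (v \<otimes> x) = x" if "x \<in> carrier A" for x
    using mult_assoc[of "v\<^sup>\<star>" v x] v that by simp
  have ww: "w\<^sup>\<star> \<otimes> (w \<otimes> x) = x" if "x \<in> carrier A" for x
    using mult_assoc[of "w\<^sup>\<star>" w x] w that by simp
  define p where "p = v \<otimes> v\<^sup>\<star>"
  define q where "q = v \<otimes> (w \<otimes> (w\<^sup>\<star> \<otimes> v\<^sup>\<star>))"
  have pq: "p \<in> carrier A" "q \<in> carrier A"
    using v w by (auto simp: p_def q_def)
  have "projection A p"
    using v vv by (simp add: projection_def p_def star_mult mult_assoc)
  moreover have "projection A q"
    using v w vv ww by (simp add: projection_def q_def star_mult mult_assoc)
  moreover have "cstar_le A q p"
  proof -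
    \<comment> \<open>With the projection \<open>e = u - w w*\<close> this is
      \<open>y = e v*\<close>, so \<open>y* y = v e v* = p - q\<close>.\<close>
    define y where "y = v\<^sup>\<star> \<ominus> w \<otimes> (w\<^sup>\<star> \<otimes> v\<^sup>\<star>)"
    have yA: "y \<in> carrier A"
      using v w by (simp add: y_def)
    have wy: "w\<^sup>\<star> \<otimes> y = \<zero>"
      using v w ww by (simp add: y_def mult_diff_right)
    have ystar: "y\<^sup>\<star> = v \<ominus> v \<otimes> (w \<otimes> w\<^sup>\<star>)"
      using v w by (simp add: y_def star_diff star_mult mult_assoc)
    have "y\<^sup>\<star> \<otimes> y = v \<otimes> y \<ominus> v \<otimes> (w \<otimes> (w\<^sup>\<star> \<otimes> y))"
      unfolding ystar using v w yA by (simp add: mult_diff_left mult_assoc)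
    also have "\<dots> = v \<otimes> y"
      using v w yA by (simp add: wy)
    also have "\<dots> = p \<ominus> q"
      using v w by (simp add: y_def p_def q_def mult_diff_right)
    finally have "p \<ominus> q = y\<^sup>\<star> \<otimes> y" ..
    then show ?thesis
      using pq yA by (auto simp: cstar_le_def positive_def)
  qed
  moreover have "q \<noteq> p"
  proof
    assume "q = p"
    then have "v\<^sup>\<star> \<otimes> (q \<otimes> v) = v\<^sup>\<star> \<otimes> (p \<otimes> v)" by simp
    then have "w \<otimes> w\<^sup>\<star> = u"
      using v w vv by (simp add: p_def q_def mult_assoc)
    with w show False by simp
  qed
  moreover have "mvn_equivalent A p q"
    unfolding mvn_equivalent_def
  proof (intro bexI conjI)
    show "(v \<otimes> (w \<otimes> v\<^sup>\<star>))\<^sup>\<star> \<otimes> (v \<otimes> (w \<otimes> v\<^sup>\<star>)) = p"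
      using v w vv ww by (simp add: p_def star_mult mult_assoc)
    show "(v \<otimes> (w \<otimes> v\<^sup>\<star>)) \<otimes> (v \<otimes> (w \<otimes> v\<^sup>\<star>))\<^sup>\<star> = q"
      using v w vv by (simp add: q_def star_mult mult_assoc)
  qed (use v w in simp)
  ultimately show ?thesis
    unfolding infinite_projection_def p_def[symmetric] by blast
qed

text \<open>If \<open>v = x b\<close> is an isometry, its range projection \<open>x b b* x*\<close>
  is at most \<open>K x x*\<close>, an element of \<open>S\<close>, and hence lies in the hereditary
  subalgebra. It is infinite because a fibre of dimension at least 2 supplies an isometry
  \<open>e\<close> with \<open>e e* \<noteq> u\<close>; such a fibre sits over every element of
  \<open>P\<close> other than 1.\<close>

theorem purely_infinite:
  assumes "P \<noteq> {\<one>\<^bsub>G\<^esub>}"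
  shows "purely_infinite A"
  unfolding purely_infinite_def
proof (intro allI impI, elim conjE)
  fix S assume S: "hereditary_subalgebra S A" "S \<noteq> {\<zero>}"
  have sub: "submodule S complex_field A" and mult: "\<And>x y. \<lbrakk>x \<in> S; y \<in> S\<rbrakk> \<Longrightarrow> x \<otimes> y \<in> S"
    and star: "\<And>x. x \<in> S \<Longrightarrow> x\<^sup>\<star> \<in> S"
    and her: "\<And>a b. \<lbrakk>a \<in> carrier A; b \<in> S; cstar_le A \<zero> a; cstar_le A a b\<rbrakk> \<Longrightarrow> a \<in> S"
    using S(1) by (auto simp: hereditary_subalgebra_def cstar_subalgebra_def)
  obtain x where x: "x \<in> S" "x \<noteq> \<zero>"
    using submodule_zero[OF sub] S(2) by blast
  have xA: "x \<in> carrier A"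
    using x submoduleE(1)[OF sub] by auto
  obtain b where b: "b \<in> carrier A" "(x \<otimes> b)\<^sup>\<star> \<otimes> (x \<otimes> b) = u"
    using exists_isometry_through[OF xA x(2)] by blast
  define v where "v = x \<otimes> b"
  have v: "v \<in> carrier A" "v\<^sup>\<star> \<otimes> v = u"
    using xA b by (auto simp: v_def)
  obtain K c where K: "K > 0" "c \<in> carrier A" "complex_of_real K \<odot> u \<ominus> (b\<^sup>\<star>)\<^sup>\<star> \<otimes> b\<^sup>\<star> = c\<^sup>\<star> \<otimes> c"
    using exists_dominating_scalar[of "b\<^sup>\<star>"] b by blast
  have "v \<otimes> v\<^sup>\<star> \<in> S"
  proof (rule her)
    show "v \<otimes> v\<^sup>\<star> \<in> carrier A"
      using v by simp
    show "complex_of_real K \<odot> (x \<otimes> x\<^sup>\<star>) \<in> S"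
      using x mult star submodule_scale[OF sub] by blast
    show "cstar_le A \<zero> (v \<otimes> v\<^sup>\<star>)"
      using v unfolding cstar_le_def positive_def by (auto intro!: bexI[of _ "v\<^sup>\<star>"])
    show "cstar_le A (v \<otimes> v\<^sup>\<star>) (complex_of_real K \<odot> (x \<otimes> x\<^sup>\<star>))"
      unfolding cstar_le_def positive_def
    proof (intro conjI bexI)
      have "(c \<otimes> x\<^sup>\<star>)\<^sup>\<star> \<otimes> (c \<otimes> x\<^sup>\<star>) = x \<otimes> ((c\<^sup>\<star> \<otimes> c) \<otimes> x\<^sup>\<star>)"
        using xA K by (simp add: star_mult mult_assoc)
      also have "\<dots> = complex_of_real K \<odot> (x \<otimes> x\<^sup>\<star>) \<ominus> v \<otimes> v\<^sup>\<star>"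
        unfolding K(3)[symmetric] v_def using xA b
        by (simp add: star_mult mult_assoc mult_diff_left mult_diff_right smult_mult_left smult_mult_right)
      finally show "complex_of_real K \<odot> (x \<otimes> x\<^sup>\<star>) \<ominus> v \<otimes> v\<^sup>\<star> = (c \<otimes> x\<^sup>\<star>)\<^sup>\<star> \<otimes> (c \<otimes> x\<^sup>\<star>)" ..
    qed (use v xA K in auto)
  qed
  moreover have "infinite_projection A (v \<otimes> v\<^sup>\<star>)"
  proof -
    obtain t where t: "t \<in> P" "t \<noteq> \<one>\<^bsub>G\<^esub>"
      using assms P_one by blast
    then have "card (B t) \<noteq> 1"
      using basis_one basis_inj P_one by (metis inj_onD)
    then obtain e f where ef: "e \<in> B t" "f \<in> B t" "e \<noteq> f"
      using basis_nonempty[OF t(1)] by (metis is_singletonI' is_singleton_altdef)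
    have A: "e \<in> carrier A" "f \<in> carrier A"
      using ef t by auto
    have "e \<otimes> e\<^sup>\<star> \<noteq> u"
    proof
      assume eq: "e \<otimes> e\<^sup>\<star> = u"
      have "f = (e \<otimes> e\<^sup>\<star>) \<otimes> f"
        using A by (simp add: eq)
      also have "\<dots> = e \<otimes> (e\<^sup>\<star> \<otimes> f)"
        using A by (simp add: mult_assoc)
      also have "\<dots> = \<zero>"
        using ef t A by (simp add: basis_orthonormal)
      finally have "u = \<zero>"
        using basis_orthonormal[OF t(1) ef(2) ef(2)] by simp
      then show False
        using unit_nonzero by simp
    qed
    then show ?thesis
      using v A basis_orthonormal[OF t(1) ef(1) ef(1)] by (intro infinite_range_projection[of v e]) auto
  qed
  ultimately show "\<exists>p\<in>S. infinite_projection A p" by blast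
qed

end

section \<open>Hilbert spaces\<close>

lemma (in complex_space) submodule_linear_span:
  assumes "S \<subseteq> carrier V" shows "submodule (linear_span V S) complex_field V"
proof (rule submoduleI)
  have "carrier V \<in> {W. submodule W complex_field V \<and> S \<subseteq> W}"
    using assms carrier_is_submodule by simp
  then show "linear_span V S \<subseteq> carrier V"
    unfolding linear_span_def by blast
  show "\<zero> \<in> linear_span V S"
    unfolding linear_span_def using submodule_zero by blast
  show "\<ominus> a \<in> linear_span V S" if "a \<in> linear_span V S" for a
    using that submoduleE(3) unfolding linear_span_def by blast
  show "a \<oplus> b \<in> linear_span V S" if "a \<in> linear_span V S" "b \<in> linear_span V S" for a b
    using that submoduleE(5) unfolding linear_span_def by blast
  show "a \<odot> x \<in> linear_span V S" if "x \<in> linear_span V S" for a x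
    using that submodule_scale unfolding linear_span_def by blast
qed

lemma linear_span_superset: "S \<subseteq> linear_span V S"
  by (auto simp: linear_span_def)

lemma linear_span_minimal: "\<lbrakk>submodule W complex_field V; S \<subseteq> W\<rbrakk> \<Longrightarrow> linear_span V S \<subseteq> W"
  by (auto simp: linear_span_def)

context hilbert_space
begin

lemma ip_add_right:
  "\<lbrakk>x \<in> carrier H; y \<in> carrier H; z \<in> carrier H\<rbrakk> \<Longrightarrow> ip H z (x \<oplus> y) = ip H z x + ip H z y"
  using ip_cnj[of "x \<oplus> y" z] ip_cnj[of x z] ip_cnj[of y z] by (simp add: ip_add_left)

lemma ip_smult_right:
  "\<lbrakk>x \<in> carrier H; z \<in> carrier H\<rbrakk> \<Longrightarrow> ip H z (c \<odot> x) = cnj c * ip H z x"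
  using ip_cnj[of "c \<odot> x" z] ip_cnj[of x z] by (simp add: ip_smult_left)

lemma ip_zero_left [simp]: "z \<in> carrier H \<Longrightarrow> ip H \<zero> z = 0"
  using ip_smult_left[of "\<zero>" z 0] by simp

lemma ip_diff_left:
  "\<lbrakk>x \<in> carrier H; y \<in> carrier H; z \<in> carrier H\<rbrakk> \<Longrightarrow> ip H (x \<ominus> y) z = ip H x z - ip H y z"
  by (simp add: diff_eq_scale ip_add_left ip_smult_left)

lemma ip_diff_right:
  "\<lbrakk>x \<in> carrier H; y \<in> carrier H; z \<in> carrier H\<rbrakk> \<Longrightarrow> ip H z (x \<ominus> y) = ip H z x - ip H z y"
  by (simp add: diff_eq_scale ip_add_right ip_smult_right)

lemma ip_sum_left:
  "\<lbrakk>\<And>i. i \<in> I \<Longrightarrow> f i \<in> carrier H; z \<in> carrier H\<rbrakk> \<Longrightarrow> ip H (\<Oplus>i\<in>I. f i) z = (\<Sum>i\<in>I. ip H (f i) z)"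
  by (induction I rule: infinite_finite_induct) (simp_all add: sum_insert ip_add_left)

lemma hnorm_nonneg: "x \<in> carrier H \<Longrightarrow> 0 \<le> hnorm H x"
  by (simp add: hnorm_def ip_nonneg)

lemma ip_self: assumes "x \<in> carrier H" shows "ip H x x = complex_of_real ((hnorm H x)\<^sup>2)"
  using ip_cnj[OF assms assms] ip_nonneg[OF assms] by (simp add: hnorm_def complex_eq_iff)

lemma hnorm_eq_0: "x \<in> carrier H \<Longrightarrow> hnorm H x = 0 \<longleftrightarrow> x = \<zero>"
  using ip_self[of x] ip_definite[of x] by (auto simp: hnorm_def)

lemma cauchy_schwarz:
  assumes "x \<in> carrier H" "y \<in> carrier H"
  shows "cmod (ip H x y) \<le> hnorm H x * hnorm H y"
proof (cases "y = \<zero>")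
  case True
  then have "ip H x y = 0"
    using ip_cnj[OF assms(2,1)] assms by simp
  then show ?thesis
    using assms by (simp add: hnorm_nonneg)
next
  case False
  define c where "c = ip H x y"
  define N where "N = (hnorm H y)\<^sup>2"
  have N: "N > 0"
    using False assms hnorm_eq_0[of y] by (simp add: N_def)
  \<comment> \<open>The usual vector \<open>x - (c / N) y\<close>, multiplied by \<open>N\<close> to
    avoid division.\<close>
  define v where "v = complex_of_real N \<odot> x \<ominus> c \<odot> y"
  have yx: "ip H y x = cnj c"
    using ip_cnj[OF assms] by (simp add: c_def)
  have "ip H v v = complex_of_real (N * (N * (hnorm H x)\<^sup>2 - (cmod c)\<^sup>2))"
    using assms
    by (simp add: v_def ip_diff_left ip_diff_right ip_smult_left ip_smult_right ip_self[OF assms(1)]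
        ip_self[OF assms(2)] yx complex_norm_square
        algebra_simps flip: c_def N_def del: of_real_power)
  then have "0 \<le> N * (N * (hnorm H x)\<^sup>2 - (cmod c)\<^sup>2)"
    using ip_nonneg[of v] assms by (simp add: v_def del: of_real_mult of_real_diff)
  then have "(cmod c)\<^sup>2 \<le> (hnorm H x * hnorm H y)\<^sup>2"
    using N by (simp add: zero_le_mult_iff N_def power_mult_distrib mult.commute)
  then show ?thesis
    using assms by (auto simp: c_def intro: power2_le_imp_le mult_nonneg_nonneg hnorm_nonneg)
qed

lemma hnorm_triangle:
  assumes "x \<in> carrier H" "y \<in> carrier H"
  shows "hnorm H (x \<oplus> y) \<le> hnorm H x + hnorm H y"
proof (rule power2_le_imp_le)
  have "complex_of_real ((hnorm H (x \<oplus> y))\<^sup>2) = ip H x x + ip H y y + (ip H x y + cnj (ip H x y))"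
    using assms ip_self[of "x \<oplus> y", symmetric] ip_cnj[of x y] by (simp add: ip_add_left ip_add_right)
  also have "\<dots> = complex_of_real ((hnorm H x)\<^sup>2 + (hnorm H y)\<^sup>2 + 2 * Re (ip H x y))"
    using assms by (simp add: ip_self complex_add_cnj)
  finally have "(hnorm H (x \<oplus> y))\<^sup>2 = (hnorm H x)\<^sup>2 + (hnorm H y)\<^sup>2 + 2 * Re (ip H x y)"
    by (simp only: of_real_eq_iff)
  also have "Re (ip H x y) \<le> hnorm H x * hnorm H y"
    using cauchy_schwarz[OF assms] complex_Re_le_cmod[of "ip H x y"] by linarith
  finally show "(hnorm H (x \<oplus> y))\<^sup>2 \<le> (hnorm H x + hnorm H y)\<^sup>2"
    by (simp add: power2_sum)
qed (use assms hnorm_nonneg in auto)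

sublocale Met: Metric_space "carrier H" "norm_dist H (hnorm H)"
proof
  have minus: "hnorm H (\<ominus> x) = hnorm H x" if "x \<in> carrier H" for x
    using that by (simp add: hnorm_def minus_eq_scale ip_smult_left ip_smult_right)
  show "0 \<le> norm_dist H (hnorm H) x y" for x y
    by (simp add: norm_dist_def hnorm_nonneg)
  show "norm_dist H (hnorm H) x y = norm_dist H (hnorm H) y x" for x y
    using diff_swap[of x y] minus[of "x \<ominus> y"] by (auto simp: norm_dist_def)
  show "norm_dist H (hnorm H) x y = 0 \<longleftrightarrow> x = y" if "x \<in> carrier H" "y \<in> carrier H" for x y
    using that by (simp add: norm_dist_def hnorm_eq_0 diff_eq_zero_iff)
  show "norm_dist H (hnorm H) x z \<le> norm_dist H (hnorm H) x y + norm_dist H (hnorm H) y z"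
    if "x \<in> carrier H" "y \<in> carrier H" "z \<in> carrier H" for x y z
    using that hnorm_triangle[of "x \<ominus> y" "y \<ominus> z"] diff_diff_split[of x y z] by (simp add: norm_dist_def)
qed

definition orthonormal :: "'e set \<Rightarrow> bool" where
  "orthonormal S \<longleftrightarrow> S \<subseteq> carrier H \<and> (\<forall>x\<in>S. \<forall>y\<in>S. ip H x y = (if x = y then 1 else 0))"

text \<open>This provides the orthonormal bases whose existence gives a meaning to the choice in
  \<open>hdim\<close> and to the sets chosen for the Cuntz family.\<close>

lemma gram_schmidt:
  assumes "finite T" "T \<subseteq> carrier H"
  shows "\<exists>S. finite S \<and> orthonormal S \<and> T \<subseteq> linear_span H S"
  using assms
proof (induction T)
  case empty
  then show ?case
    by (intro exI[of _ "{}"]) (auto simp: orthonormal_def)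
next
  case (insert x T)
  then obtain S where S: "finite S" "orthonormal S" "T \<subseteq> linear_span H S"
    by auto
  have x: "x \<in> carrier H" and SH: "S \<subseteq> carrier H"
    using insert S by (auto simp: orthonormal_def)
  define p where "p = (\<Oplus>b\<in>S. ip H x b \<odot> b)"
  have p: "p \<in> carrier H"
    unfolding p_def using SH by auto
  have span: "submodule (linear_span H S) complex_field H"
    by (rule submodule_linear_span[OF SH])
  have p_span: "p \<in> linear_span H S"
    unfolding p_def using linear_span_superset[of S H]
    by (intro sum_in_submodule[OF span] submodule_scale[OF span]) auto
  define y where "y = x \<ominus> p"
  have y: "y \<in> carrier H"
    using x p by (simp add: y_def)
  have xyp: "x = y \<oplus> p"
    using x p by (simp add: y_def)
  have y_orth: "ip H y b = 0" if b: "b \<in> S" for b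
  proof -
    have bH: "b \<in> carrier H" using b SH by auto
    have "ip H p b = (\<Sum>b'\<in>S. ip H x b' * ip H b' b)"
      unfolding p_def using SH bH by (subst ip_sum_left) (auto intro!: sum.cong simp: ip_smult_left)
    also have "\<dots> = (\<Sum>b'\<in>S. if b' = b then ip H x b' else 0)"
      using S(2) b by (intro sum.cong) (auto simp: orthonormal_def)
    also have "\<dots> = ip H x b"
      using S(1) b by (simp add: sum.delta)
    finally show ?thesis
      using x p bH by (simp add: y_def ip_diff_left)
  qed
  show ?case
  proof (cases "y = \<zero>")
    case True
    then have "x = p"
      using xyp p by simp
    then show ?thesis
      using S p_span by (intro exI[of _ S]) auto
  next
    case False
    then have ny: "hnorm H y > 0"
      using hnorm_eq_0[OF y] hnorm_nonneg[OF y] by simp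
    define e where "e = complex_of_real (1 / hnorm H y) \<odot> y"
    have e: "e \<in> carrier H"
      using y by (simp add: e_def)
    have ee: "ip H e e = 1"
      using y ny by (simp add: e_def ip_smult_left ip_smult_right ip_self[OF y] power2_eq_square)
    have eb: "ip H e b = 0" "ip H b e = 0" if "b \<in> S" for b
      using y_orth[OF that] y SH that ip_cnj[of e b] e by (auto simp: e_def ip_smult_left subset_iff)
    have S': "orthonormal (insert e S)"
      using S(2) e ee eb by (auto simp: orthonormal_def)
    have S'H: "insert e S \<subseteq> carrier H"
      using SH e by simp
    have span': "submodule (linear_span H (insert e S)) complex_field H"
      by (rule submodule_linear_span[OF S'H])
    have le: "linear_span H S \<subseteq> linear_span H (insert e S)"
      using linear_span_superset[of "insert e S" H] by (intro linear_span_minimal[OF span']) auto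
    have "y = complex_of_real (hnorm H y) \<odot> e"
      using y ny by (simp add: e_def)
    moreover have "e \<in> linear_span H (insert e S)"
      using linear_span_superset[of "insert e S" H] by auto
    ultimately have "y \<in> linear_span H (insert e S)"
      using submodule_scale[OF span'] by metis
    then have "x \<in> linear_span H (insert e S)"
      unfolding xyp using le p_span by (intro submoduleE(5)[OF span']) auto
    then show ?thesis
      using S S' le by (intro exI[of _ "insert e S"]) auto
  qed
qed

lemma exists_orthonormal_basis:
  assumes "finite_dimensional H" shows "\<exists>S. orthonormal_basis H S"
proof -
  obtain T where T: "finite T" "T \<subseteq> carrier H" "linear_span H T = carrier H"
    using assms by (auto simp: finite_dimensional_def)
  obtain S where S: "orthonormal S" "T \<subseteq> linear_span H S"
    using gram_schmidt[OF T(1,2)] by blast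
  have span: "submodule (linear_span H S) complex_field H"
    using S by (intro submodule_linear_span) (simp add: orthonormal_def)
  have "linear_span H S = carrier H"
    using linear_span_minimal[OF span S(2)] submoduleE(1)[OF span] T(3) by auto
  moreover have "norm_topology H (hnorm H) closure_of carrier H = carrier H"
    using closure_of_topspace[of "Met.mtopology"] by (simp add: norm_topology_def)
  ultimately show ?thesis
    using S(1) by (intro exI[of _ S]) (simp add: orthonormal_basis_def total_in_def orthonormal_def)
qed

text \<open>For \<open>y\<close> in the span, orthogonality gives
  \<open>||x||^2 \<le> ||x - y||^2\<close>, and density makes the right-hand side arbitrarily
  small.\<close>

lemma total_orthogonal:
  assumes "total_in H S" "S \<subseteq> carrier H" and x: "x \<in> carrier H" "\<And>s. s \<in> S \<Longrightarrow> ip H s x = 0"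
  shows "x = \<zero>"
proof -
  define W where "W = {w \<in> carrier H. ip H w x = 0}"
  have "submodule W complex_field H"
    using x(1) by (intro submoduleI) (auto simp: W_def ip_add_left ip_smult_left minus_eq_scale)
  then have span: "linear_span H S \<subseteq> W"
    by (rule linear_span_minimal) (use assms in \<open>auto simp: W_def\<close>)
  have "(hnorm H x)\<^sup>2 \<le> 0 + \<epsilon>" if "\<epsilon> > 0" for \<epsilon>
  proof -
    have "x \<in> Met.mtopology closure_of linear_span H S"
      using assms(1) x by (simp add: total_in_def norm_topology_def)
    moreover have "sqrt \<epsilon> > 0"
      using that by simp
    ultimately obtain y where y: "y \<in> linear_span H S" "y \<in> Met.mball x (sqrt \<epsilon>)"
      unfolding Met.metric_closure_of by blast
    then have yH: "y \<in> carrier H" "ip H y x = 0" and d: "hnorm H (x \<ominus> y) < sqrt \<epsilon>"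
      using span by (auto simp: W_def norm_dist_def)
    have "ip H x y = 0"
      using ip_cnj[of y x] yH x by simp
    then have "ip H (x \<ominus> y) (x \<ominus> y) = ip H x x + ip H y y"
      using x yH by (simp add: ip_diff_left ip_diff_right)
    then have "complex_of_real ((hnorm H (x \<ominus> y))\<^sup>2) = complex_of_real ((hnorm H x)\<^sup>2 + (hnorm H y)\<^sup>2)"
      using x yH by (simp add: ip_self)
    then have "(hnorm H (x \<ominus> y))\<^sup>2 = (hnorm H x)\<^sup>2 + (hnorm H y)\<^sup>2"
      by (simp only: of_real_eq_iff)
    moreover have "(hnorm H (x \<ominus> y))\<^sup>2 < (sqrt \<epsilon>)\<^sup>2"
      using d x yH by (intro power_strict_mono hnorm_nonneg) auto
    moreover have "(sqrt \<epsilon>)\<^sup>2 = \<epsilon>"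
      using that by simp
    ultimately show ?thesis
      using zero_le_power2[of "hnorm H y"] by linarith
  qed
  then have "(hnorm H x)\<^sup>2 \<le> 0"
    by (rule field_le_epsilon)
  then show ?thesis
    using hnorm_eq_0[OF x(1)] by simp
qed

end

section \<open>Product systems\<close>

context product_system
begin

lemma fibre_iff: "t \<in> carrier P \<Longrightarrow> x \<in> carrier (fibre E t) \<longleftrightarrow> x \<in> total_space E \<and> pr E x = t"
  by (simp add: carrier_fibre)

lemma pmult_fibre:
  "\<lbrakk>s \<in> carrier P; t \<in> carrier P; x \<in> carrier (fibre E s); y \<in> carrier (fibre E t)\<rbrakk>
    \<Longrightarrow> pmult E x y \<in> carrier (fibre E (s \<otimes> t))"
  by (simp add: fibre_iff pmult_closed proj_pmult)

text \<open>A unit vector \<open>e\<close> of the one-dimensional fibre satisfies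
  \<open>e e = c e\<close>, with \<open>c \<noteq> 0\<close> because the product respects inner
  products; so \<open>e / c\<close> is idempotent. For an idempotent, the squared norm equals its
  own square, and being nonzero it is 1.\<close>

lemma exists_idempotent:
  assumes "finite_dimensional (fibre E \<one>)"
  obtains e where "e \<in> carrier (fibre E \<one>)" "pmult E e e = e" "ip (fibre E \<one>) e e = 1"
proof -
  interpret H: hilbert_space "fibre E \<one>"
    by (rule fibre_hilbert) simp
  let ?H = "fibre E \<one>"
  define S where "S = (SOME S. orthonormal_basis ?H S)"
  have S: "orthonormal_basis ?H S"
    unfolding S_def using H.exists_orthonormal_basis[OF assms] by (rule someI_ex)
  have "card S = 1"
    using dim_fibre_one by (simp add: hdim_def S_def)
  then obtain e where e: "S = {e}"
    by (auto simp: card_1_singleton_iff)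
  have eH: "e \<in> carrier ?H" "ip ?H e e = 1"
    using S e by (auto simp: orthonormal_basis_def)
  have ee: "pmult E e e \<in> carrier ?H"
    using pmult_fibre[of \<one> \<one> e e] eH by simp
  define c where "c = ip ?H (pmult E e e) e"
  have "pmult E e e \<ominus>\<^bsub>?H\<^esub> c \<odot>\<^bsub>?H\<^esub> e = \<zero>\<^bsub>?H\<^esub>"
  proof (rule H.total_orthogonal)
    show "total_in ?H S" "S \<subseteq> carrier ?H"
      using S by (auto simp: orthonormal_basis_def)
    show "pmult E e e \<ominus>\<^bsub>?H\<^esub> c \<odot>\<^bsub>?H\<^esub> e \<in> carrier ?H"
      using ee eH by simp
    show "ip ?H s (pmult E e e \<ominus>\<^bsub>?H\<^esub> c \<odot>\<^bsub>?H\<^esub> e) = 0" if "s \<in> S" for s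
      using that ee eH H.ip_cnj[of "pmult E e e" e] by (simp add: e H.ip_diff_right H.ip_smult_right c_def)
  qed
  then have ee_eq: "pmult E e e = c \<odot>\<^bsub>?H\<^esub> e"
    using ee eH by (simp add: H.diff_eq_zero_iff)
  have "ip ?H (pmult E e e) (pmult E e e) = 1"
    using pmult_ip[of \<one> \<one> e e e e] eH by simp
  then have c: "c \<noteq> 0"
    using eH unfolding ee_eq by (auto simp: H.ip_smult_left)
  define f where "f = (1 / c) \<odot>\<^bsub>?H\<^esub> e"
  have f: "f \<in> carrier ?H"
    using eH by (simp add: f_def)
  have "pmult E f f = (1 / c) \<odot>\<^bsub>?H\<^esub> pmult E e f"
    using pmult_smult_left[of \<one> \<one> e f "1 / c"] eH f by (simp add: f_def)
  also have "pmult E e f = (1 / c) \<odot>\<^bsub>?H\<^esub> pmult E e e"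
    using pmult_smult_right[of \<one> \<one> e e "1 / c"] eH by (simp add: f_def)
  finally have ff: "pmult E f f = f"
    using c eH by (simp add: ee_eq f_def)
  have "ip ?H f f = ip ?H f f * ip ?H f f"
    using pmult_ip[of \<one> \<one> f f f f] f by (simp add: ff)
  moreover have "ip ?H f f \<noteq> 0"
    using c eH by (simp add: f_def H.ip_smult_left H.ip_smult_right)
  ultimately show thesis
    using that[OF f ff] by simp
qed

text \<open>Multiplication by the idempotent unit vector \<open>e\<close> preserves inner products
  and is idempotent, hence \<open>(e x | x) = (e e x | e x) = (e x | e x) = (x | x)\<close>, and
  \<open>||e x - x|| = 0\<close> follows. A two-sided identity is unique, which resolves the
  description in \<open>punit\<close>.\<close>

lemma punit:
  assumes "finite_dimensional (fibre E \<one>)"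
  shows "punit E \<in> carrier (fibre E \<one>)"
    and "\<And>x. x \<in> total_space E \<Longrightarrow> pmult E (punit E) x = x"
    and "\<And>x. x \<in> total_space E \<Longrightarrow> pmult E x (punit E) = x"
proof -
  obtain e where e: "e \<in> carrier (fibre E \<one>)" "pmult E e e = e" "ip (fibre E \<one>) e e = 1"
    using exists_idempotent[OF assms] by blast
  have eT: "e \<in> total_space E"
    using e by (simp add: fibre_iff)
  have unit: "pmult E e x = x \<and> pmult E x e = x" if x: "x \<in> total_space E" for x
  proof -
    define t where "t = pr E x"
    have t: "t \<in> carrier P"
      using x proj_closed by (simp add: t_def)
    interpret H: hilbert_space "fibre E t"
      by (rule fibre_hilbert[OF t])
    let ?ip = "ip (fibre E t)"
    have xH: "x \<in> carrier (fibre E t)"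
      using x t by (simp add: fibre_iff t_def)
    have eq: "y = x" if y: "y \<in> carrier (fibre E t)" "?ip y x = ?ip x x" "?ip y y = ?ip x x" for y
    proof -
      have "?ip x y = ?ip x x"
        using H.ip_cnj[OF y(1) xH] H.ip_cnj[OF xH xH] y(2) by simp
      then have "?ip (y \<ominus>\<^bsub>fibre E t\<^esub> x) (y \<ominus>\<^bsub>fibre E t\<^esub> x) = 0"
        using y xH by (simp add: H.ip_diff_left H.ip_diff_right)
      then show ?thesis
        using y xH H.ip_definite[of "y \<ominus>\<^bsub>fibre E t\<^esub> x"] by (simp add: H.diff_eq_zero_iff)
    qed
    have ex: "pmult E e x \<in> carrier (fibre E t)"
      using pmult_fibre[of \<one> t e x] e t xH by simp
    have xe: "pmult E x e \<in> carrier (fibre E t)"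
      using pmult_fibre[of t \<one> x e] e t xH by simp
    have "?ip (pmult E e x) x = ?ip (pmult E e (pmult E e x)) (pmult E e x)"
      using pmult_ip[of \<one> t e e "pmult E e x" x] e t xH ex by simp
    also have "pmult E e (pmult E e x) = pmult E e x"
      using pmult_assoc[OF eT eT x] e by simp
    also have exx: "?ip (pmult E e x) (pmult E e x) = ?ip x x"
      using pmult_ip[of \<one> t e e x x] e t xH by simp
    finally have left: "pmult E e x = x"
      using eq[OF ex] exx by simp
    have "?ip (pmult E x e) x = ?ip (pmult E (pmult E x e) e) (pmult E x e)"
      using pmult_ip[of t \<one> "pmult E x e" x e e] e t xH xe by simp
    also have "pmult E (pmult E x e) e = pmult E x e"
      using pmult_assoc[OF x eT eT] e by simp
    also have xex: "?ip (pmult E x e) (pmult E x e) = ?ip x x"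
      using pmult_ip[of t \<one> x x e e] e t xH by simp
    finally have "pmult E x e = x"
      using eq[OF xe] xex by simp
    with left show ?thesis ..
  qed
  have "punit E = e"
    unfolding punit_def
  proof (rule the_equality)
    show "e \<in> total_space E \<and> (\<forall>x\<in>total_space E. pmult E e x = x \<and> pmult E x e = x)"
      using eT unit by blast
    show "u = e" if "u \<in> total_space E \<and> (\<forall>x\<in>total_space E. pmult E u x = x \<and> pmult E x u = x)" for u
      using that eT unit by metis
  qed
  then show "punit E \<in> carrier (fibre E \<one>)"
    "\<And>x. x \<in> total_space E \<Longrightarrow> pmult E (punit E) x = x"
    "\<And>x. x \<in> total_space E \<Longrightarrow> pmult E x (punit E) = x"
    using e unit by simp_all
qed

lemma ip_punit:
  assumes "finite_dimensional (fibre E \<one>)"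
  shows "ip (fibre E \<one>) (punit E) (punit E) = 1"
proof -
  obtain e where e: "e \<in> carrier (fibre E \<one>)" "pmult E e e = e" "ip (fibre E \<one>) e e = 1"
    using exists_idempotent[OF assms] by blast
  note u = punit[OF assms]
  let ?i = "ip (fibre E \<one>) (punit E) (punit E)"
  have "pmult E (punit E) e = e"
    using u(2)[of e] e by (simp add: fibre_iff)
  then have "ip (fibre E \<one>) e e = ?i * ip (fibre E \<one>) e e"
    using pmult_ip[of \<one> \<one> "punit E" "punit E" e e] u(1) e by simp
  then show ?thesis
    using e by simp
qed

end

text \<open>The image of the identity of \<open>E\<close> becomes the unit of \<open>A\<close>; it
  is nonzero because it reproduces every \<open>\<phi> x\<close>. Orthonormality makes
  \<open>\<phi>\<close> injective on the chosen bases, so that \<open>card (B t)\<close> is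
  \<open>hdim\<close>.\<close>

lemma cuntz_family_of_representation:
  fixes G :: "('g, 'm) monoid_scheme" and A :: "'a cstar" (structure) and \<phi> :: "'e \<Rightarrow> 'a"
  assumes G: "comm_group G" and P: "submonoid P G"
    and E: "product_system (G\<lparr>carrier := P\<rparr>) E"
    and fin: "\<And>t. t \<in> P \<Longrightarrow> finite_dimensional (fibre E t)"
    and inj: "inj_on (\<lambda>s. hdim (fibre E s)) P"
    and A: "cstar_algebra A"
    and \<phi>: "cuntz_representation (G\<lparr>carrier := P\<rparr>) E A \<phi>"
    and nonzero: "\<exists>x\<in>total_space E. \<phi> x \<noteq> \<zero>"
    and gen: "cstar_generated A (\<phi> ` total_space E) = carrier A"
  shows "cuntz_family A (\<phi> (punit E)) G P (\<lambda>t. \<phi> ` (SOME S. orthonormal_basis (fibre E t) S))"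
proof -
  interpret cstar_algebra A by fact
  interpret G: comm_group G by fact
  interpret E: product_system "G\<lparr>carrier := P\<rparr>" E by fact
  interpret P: submonoid P G by fact
  define u where "u = \<phi> (punit E)"
  define S where "S t = (SOME S. orthonormal_basis (fibre E t) S)" for t
  have fin1: "finite_dimensional (fibre E \<one>\<^bsub>G\<lparr>carrier := P\<rparr>\<^esub>)"
    using fin by simp
  note unit = E.punit[OF fin1]
  have uT: "punit E \<in> total_space E" "pr E (punit E) = \<one>\<^bsub>G\<^esub>"
    using unit(1) by (simp_all add: E.fibre_iff)
  have \<phi>A: "\<phi> x \<in> carrier A" if "x \<in> total_space E" for x
    using \<phi> that by (simp add: cuntz_representation_def representation_def)
  have \<phi>_mult: "\<phi> (pmult E x y) = \<phi> x \<otimes> \<phi> y" if "x \<in> total_space E" "y \<in> total_space E" for x y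
    using \<phi> that by (simp add: cuntz_representation_def representation_def)
  have \<phi>_ip: "star A (\<phi> y) \<otimes> \<phi> x = ip (fibre E (pr E x)) x y \<odot> u"
    if "x \<in> total_space E" "y \<in> total_space E" "pr E x = pr E y" for x y
    using \<phi> that by (simp add: cuntz_representation_def representation_def u_def)
  have uA: "u \<in> carrier A"
    using \<phi>A uT by (simp add: u_def)
  have \<phi>_unit: "u \<otimes> \<phi> x = \<phi> x" "\<phi> x \<otimes> u = \<phi> x" if "x \<in> total_space E" for x
    using \<phi>_mult[OF uT(1) that] \<phi>_mult[OF that uT(1)] unit that by (simp_all add: u_def)
  have u0: "u \<noteq> \<zero>"
  proof
    assume "u = \<zero>"
    then have "\<phi> x = \<zero>" if "x \<in> total_space E" for x
      using \<phi>_unit(1)[OF that] \<phi>A[OF that] by simp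
    with nonzero show False by blast
  qed
  have "star A u \<otimes> u = u"
    using \<phi>_ip[OF uT(1) uT(1)] E.ip_punit[OF fin1] uA uT by (simp add: u_def)
  then have u_star: "star A u = u"
    using star_mult[of "star A u" u] uA by simp
  \<comment> \<open>That \<open>u\<close> acts as a unit is known on the generators only; the
    elements on which it does so form a C*-subalgebra.\<close>
  define C where "C = {a \<in> carrier A. u \<otimes> a = a \<and> a \<otimes> u = a}"
  have CA: "C \<subseteq> carrier A"
    by (auto simp: C_def)
  have "cstar_subalgebra C A"
  proof (rule cstar_subalgebraI[OF CA])
    show "\<zero> \<in> C"
      using uA by (simp add: C_def)
    show "x \<oplus> y \<in> C" if "x \<in> C" "y \<in> C" for x y
      using that uA by (simp add: C_def distrib_left distrib_right)
    show "c \<odot> x \<in> C" if "x \<in> C" for c x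
      using that uA by (simp add: C_def smult_mult_left smult_mult_right)
    show "x \<otimes> y \<in> C" if "x \<in> C" "y \<in> C" for x y
      using that uA mult_assoc[of u x y] mult_assoc[of x y u] by (simp add: C_def)
    show "star A x \<in> C" if "x \<in> C" for x
      using that uA star_mult[of u x] star_mult[of x u] by (simp add: C_def u_star)
    show "x \<in> C" if x: "x \<in> carrier A" and lim: "\<forall>\<epsilon>>0. \<exists>y\<in>C. nrm A (x \<ominus> y) < \<epsilon>" for x
    proof -
      have pos: "nrm A u + 1 > 0"
        using nrm_nonneg[OF uA] by simp
      have "nrm A (u \<otimes> x \<ominus> x) \<le> 0 + \<epsilon> \<and> nrm A (x \<otimes> u \<ominus> x) \<le> 0 + \<epsilon>" if "\<epsilon> > 0" for \<epsilon>
      proof -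
        have "\<epsilon> / (nrm A u + 1) > 0"
          using that pos by simp
        then obtain y where y: "y \<in> C" "nrm A (x \<ominus> y) < \<epsilon> / (nrm A u + 1)"
          using lim by blast
        have yA: "y \<in> carrier A" "u \<otimes> y = y" "y \<otimes> u = y"
          using y by (auto simp: C_def)
        have small: "(nrm A u + 1) * nrm A (x \<ominus> y) \<le> \<epsilon>"
          using y(2) pos by (simp add: pos_less_divide_eq mult.commute)
        have "nrm A (u \<otimes> x \<ominus> x) \<le> nrm A (u \<otimes> x \<ominus> y) + nrm A (y \<ominus> x)"
          using uA x yA by (intro nrm_diff_triangle) auto
        also have "u \<otimes> x \<ominus> y = u \<otimes> (x \<ominus> y)"
          using uA x yA by (simp add: mult_diff_right)
        also have "nrm A (u \<otimes> (x \<ominus> y)) \<le> nrm A u * nrm A (x \<ominus> y)"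
          using uA x yA by (intro nrm_mult) auto
        finally have 1: "nrm A (u \<otimes> x \<ominus> x) \<le> (nrm A u + 1) * nrm A (x \<ominus> y)"
          using nrm_diff_commute[OF x yA(1)] by (simp add: algebra_simps)
        have "nrm A (x \<otimes> u \<ominus> x) \<le> nrm A (x \<otimes> u \<ominus> y) + nrm A (y \<ominus> x)"
          using uA x yA by (intro nrm_diff_triangle) auto
        also have "x \<otimes> u \<ominus> y = (x \<ominus> y) \<otimes> u"
          using uA x yA by (simp add: mult_diff_left)
        also have "nrm A ((x \<ominus> y) \<otimes> u) \<le> nrm A (x \<ominus> y) * nrm A u"
          using uA x yA by (intro nrm_mult) auto
        finally have 2: "nrm A (x \<otimes> u \<ominus> x) \<le> (nrm A u + 1) * nrm A (x \<ominus> y)"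
          using nrm_diff_commute[OF x yA(1)] by (simp add: algebra_simps)
        show ?thesis
          using 1 2 small by simp
      qed
      then have "nrm A (u \<otimes> x \<ominus> x) \<le> 0" "nrm A (x \<otimes> u \<ominus> x) \<le> 0"
        by (blast intro: field_le_epsilon)+
      then show ?thesis
        using x uA nrm_nonneg[of "u \<otimes> x \<ominus> x"] nrm_nonneg[of "x \<otimes> u \<ominus> x"]
        by (simp add: C_def nrm_eq_0 diff_eq_zero_iff)
    qed
  qed
  moreover have "\<phi> ` total_space E \<subseteq> C"
    using \<phi>A \<phi>_unit by (auto simp: C_def)
  ultimately have C: "C = carrier A"
    by (rule generated_eq_carrier[OF gen])
  interpret unital_cstar A u
  proof
    show "u \<otimes> x = x" "x \<otimes> u = x" if "x \<in> carrier A" for x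
      using that C by (auto simp: C_def)
  qed (use uA u0 in auto)
  have S: "orthonormal_basis (fibre E t) (S t)" if "t \<in> P" for t
  proof -
    have "hilbert_space (fibre E t)"
      using E.fibre_hilbert that by simp
    from hilbert_space.exists_orthonormal_basis[OF this fin[OF that]] show ?thesis
      unfolding S_def by (rule someI_ex)
  qed
  have S_fibre: "x \<in> total_space E \<and> pr E x = t" if "t \<in> P" "x \<in> S t" for t x
    using S[OF that(1)] that E.fibre_iff[of t x] by (auto simp: orthonormal_basis_def)
  have S_orth: "star A (\<phi> x) \<otimes> \<phi> y = (if x = y then u else \<zero>)" if "t \<in> P" "x \<in> S t" "y \<in> S t" for t x y
    using \<phi>_ip[of y x] S_fibre[OF that(1,2)] S_fibre[OF that(1,3)] S[OF that(1)] that(2,3)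
    by (auto simp: orthonormal_basis_def)
  have \<phi>_inj: "inj_on \<phi> (S t)" if "t \<in> P" for t
  proof (rule inj_onI, rule ccontr)
    fix x y assume "x \<in> S t" "y \<in> S t" "\<phi> x = \<phi> y" "x \<noteq> y"
    then show False
      using S_orth[OF that, of x y] S_orth[OF that, of y y] unit_nonzero by simp
  qed
  have S_sum: "(\<Oplus>x\<in>S t. \<phi> x \<otimes> star A (\<phi> x)) = u" if "t \<in> P" for t
    using \<phi> S[OF that] that by (simp add: cuntz_representation_def u_def)
  \<comment> \<open>A sum over an infinite index set is \<open>\<zero>\<close> by convention, but
    here the sum is \<open>u\<close>.\<close>
  have S_finite: "finite (S t)" if "t \<in> P" for t
    using S_sum[OF that] unit_nonzero by (metis M.finsum_infinite)
  have card: "card (\<phi> ` S t) = hdim (fibre E t)" if "t \<in> P" for t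
    using card_image[OF \<phi>_inj[OF that]] by (simp add: hdim_def S_def)
  have B_sum: "(\<Oplus>f\<in>\<phi> ` S t. f \<otimes> star A f) = u" if "t \<in> P" for t
  proof -
    have "(\<Oplus>f\<in>\<phi> ` S t. f \<otimes> star A f) = (\<Oplus>x\<in>S t. \<phi> x \<otimes> star A (\<phi> x))"
      using \<phi>A S_fibre[OF that] by (intro M.finsum_reindex \<phi>_inj[OF that]) auto
    then show ?thesis
      using S_sum[OF that] by simp
  qed
  have ip_scalar: "star A (\<phi> x) \<otimes> \<phi> y \<in> scalars" if "x \<in> total_space E" "y \<in> total_space E" "pr E x = pr E y" for x y
    using \<phi>_ip[OF that(2,1)] that by simp
  have "cuntz_family A u G P (\<lambda>t. \<phi> ` S t)"
  proof
    show "finite (\<phi> ` S t)" if "t \<in> P" for t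
      using S_finite[OF that] by simp
    show "f \<in> carrier A" if "t \<in> P" "f \<in> \<phi> ` S t" for t f
      using that \<phi>A S_fibre by auto
    show "star A e \<otimes> f = (if e = f then u else \<zero>)" if "t \<in> P" "e \<in> \<phi> ` S t" "f \<in> \<phi> ` S t" for t e f
    proof -
      obtain x y where xy: "x \<in> S t" "y \<in> S t" "e = \<phi> x" "f = \<phi> y"
        using \<open>e \<in> \<phi> ` S t\<close> \<open>f \<in> \<phi> ` S t\<close> by blast
      then have "e = f \<longleftrightarrow> x = y"
        using \<phi>_inj[OF \<open>t \<in> P\<close>] by (auto dest: inj_onD)
      then show ?thesis
        using S_orth[OF \<open>t \<in> P\<close> xy(1,2)] xy(3,4) by simp
    qed
    show "(\<Oplus>f\<in>\<phi> ` S t. f \<otimes> star A f) = u" if "t \<in> P" for t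
      by (rule B_sum[OF that])
    show "star A h \<otimes> (e \<otimes> f) \<in> scalars"
      if st: "s \<in> P" "t \<in> P" and ef: "e \<in> \<phi> ` S s" "f \<in> \<phi> ` S t" "h \<in> \<phi> ` S (s \<otimes>\<^bsub>G\<^esub> t)" for s t e f h
    proof -
      obtain x y w where xyw: "x \<in> S s" "y \<in> S t" "w \<in> S (s \<otimes>\<^bsub>G\<^esub> t)" "e = \<phi> x" "f = \<phi> y" "h = \<phi> w"
        using ef by blast
      have x: "x \<in> total_space E" "pr E x = s" and y: "y \<in> total_space E" "pr E y = t"
        and w: "w \<in> total_space E" "pr E w = s \<otimes>\<^bsub>G\<^esub> t"
        using S_fibre[OF st(1) xyw(1)] S_fibre[OF st(2) xyw(2)] S_fibre[OF P.m_closed[OF st] xyw(3)] by auto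
      have "star A (\<phi> w) \<otimes> \<phi> (pmult E x y) \<in> scalars"
        using x y w E.proj_pmult[OF x(1) y(1)] E.pmult_closed[OF x(1) y(1)] by (intro ip_scalar) auto
      then show ?thesis
        using x y by (simp add: xyw \<phi>_mult)
    qed
    show "inj_on (\<lambda>t. card (\<phi> ` S t)) P"
      using inj card by (simp add: inj_on_def)
    show "card (\<phi> ` S \<one>\<^bsub>G\<^esub>) = 1"
      using card[OF P.one_closed] E.dim_fibre_one by simp
    show "cstar_generated A (\<Union>t\<in>P. \<phi> ` S t) = carrier A"
    proof
      have "cstar_subalgebra (carrier A) A"
        by (rule cstar_subalgebraI) auto
      then show "cstar_generated A (\<Union>t\<in>P. \<phi> ` S t) \<subseteq> carrier A"
        unfolding cstar_generated_def using \<phi>A S_fibre by blast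
      have "carrier A \<subseteq> W" if W: "cstar_subalgebra W A" "(\<Union>t\<in>P. \<phi> ` S t) \<subseteq> W" for W
      proof -
        have sub: "submodule W complex_field A"
          using W by (simp add: cstar_subalgebra_def)
        have "\<phi> x \<in> W" if x: "x \<in> total_space E" for x
        proof -
          define t where "t = pr E x"
          have t: "t \<in> P"
            using E.proj_closed[OF x] by (simp add: t_def)
          have sA: "\<phi> s \<in> carrier A" if "s \<in> S t" for s
            using S_fibre[OF t that] \<phi>A by simp
          \<comment> \<open>Inserting the completeness relation exhibits \<open>\<phi> x\<close> as
            a linear combination of basis images, so these generate the same algebra.\<close>
          have "\<phi> x = (\<Oplus>s\<in>S t. \<phi> s \<otimes> star A (\<phi> s)) \<otimes> \<phi> x"
            using S_sum[OF t] \<phi>A[OF x] by simp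
          also have "\<dots> = (\<Oplus>s\<in>S t. \<phi> s \<otimes> star A (\<phi> s) \<otimes> \<phi> x)"
            using sA \<phi>A[OF x] by (intro sum_mult_right) auto
          also have "\<dots> \<in> W"
          proof (rule sum_in_submodule[OF sub])
            fix s assume s: "s \<in> S t"
            have sc: "star A (\<phi> s) \<otimes> \<phi> x \<in> scalars"
              using S_fibre[OF t s] x by (intro ip_scalar) (auto simp: t_def)
            have "\<phi> s \<otimes> star A (\<phi> s) \<otimes> \<phi> x = scalar_of (star A (\<phi> s) \<otimes> \<phi> x) \<odot> \<phi> s"
              using mult_scalars[OF sc sA[OF s]] sA[OF s] \<phi>A[OF x] by (simp add: mult_assoc)
            also have "\<dots> \<in> W"
              using W(2) s t by (intro submodule_scale[OF sub]) auto
            finally show "\<phi> s \<otimes> star A (\<phi> s) \<otimes> \<phi> x \<in> W" .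
          qed
          finally show ?thesis .
        qed
        then have "W = carrier A"
          by (intro generated_eq_carrier[OF gen W(1)]) auto
        then show ?thesis by simp
      qed
      then show "carrier A \<subseteq> cstar_generated A (\<Union>t\<in>P. \<phi> ` S t)"
        unfolding cstar_generated_def by blast
    qed
  qed
  then show ?thesis
    unfolding u_def S_def .
qed

text \<open>The proviso on pure infiniteness is forced: for trivial \<open>P\<close> the algebra
  consists of the multiples of its unit, and no projection in it is infinite.\<close>

theorem theorem3p1:
  fixes G :: "('g, 'm) monoid_scheme"
    and P :: "'g set"
    and E :: "('g, 'e) prod_system"
    and OE :: "'a cstar"
    and iE :: "'e \<Rightarrow> 'a"
  assumes "comm_group G"
    and "countable (carrier G)"
    and "submonoid P G"
    and "product_system (G\<lparr>carrier := P\<rparr>) E"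
    and "\<And>t. t \<in> P \<Longrightarrow> finite_dimensional (fibre E t)"
    and "\<exists>(B :: 'a cstar) \<phi>. cstar_algebra B \<and>
           cuntz_representation (G\<lparr>carrier := P\<rparr>) E B \<phi> \<and> (\<exists>x\<in>total_space E. \<phi> x \<noteq> \<zero>\<^bsub>B\<^esub>)"
    and "inj_on (\<lambda>s. hdim (fibre E s)) P"
    and "cuntz_algebra (G\<lparr>carrier := P\<rparr>) E OE iE"
  shows "simple_cstar OE \<and> (P \<noteq> {\<one>\<^bsub>G\<^esub>} \<longrightarrow> purely_infinite OE)"
proof -
  have OE: "cstar_algebra OE" "cuntz_representation (G\<lparr>carrier := P\<rparr>) E OE iE"
    "cstar_generated OE (iE ` total_space E) = carrier OE"
    using assms(8) by (simp_all add: cuntz_algebra_def)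
  \<comment> \<open>The universal property transfers nonvanishing: if \<open>iE\<close> were zero,
    the homomorphism to the algebra of a nonzero representation would make that representation zero
    as well.\<close>
  have "\<exists>x\<in>total_space E. iE x \<noteq> \<zero>\<^bsub>OE\<^esub>"
  proof (rule ccontr)
    assume zero: "\<not> ?thesis"
    obtain C :: "'a cstar" and \<phi> x where C: "cstar_algebra C" "cuntz_representation (G\<lparr>carrier := P\<rparr>) E C \<phi>"
      and x: "x \<in> total_space E" "\<phi> x \<noteq> \<zero>\<^bsub>C\<^esub>"
      using assms(6) by blast
    obtain h where h: "star_hom OE C h" "\<forall>x\<in>total_space E. h (iE x) = \<phi> x"
      using assms(8) C unfolding cuntz_algebra_def by blast
    interpret OE: cstar_algebra OE by (rule OE)
    interpret C: cstar_algebra C by (rule C)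
    have "h \<zero>\<^bsub>OE\<^esub> = h (0 \<odot>\<^bsub>OE\<^esub> \<zero>\<^bsub>OE\<^esub>)"
      by simp
    also have "\<dots> = 0 \<odot>\<^bsub>C\<^esub> h \<zero>\<^bsub>OE\<^esub>"
      using h(1) unfolding star_hom_def by blast
    also have "\<dots> = \<zero>\<^bsub>C\<^esub>"
      using h(1) by (intro C.scale_zero_left) (simp add: star_hom_def)
    finally show False
      using zero h(2) x by auto
  qed
  then have "cuntz_family OE (iE (punit E)) G P (\<lambda>t. iE ` (SOME S. orthonormal_basis (fibre E t) S))"
    using cuntz_family_of_representation[OF assms(1,3-5,7) OE(1,2) _ OE(3)] by blast
  then interpret cuntz_family OE "iE (punit E)" G P "\<lambda>t. iE ` (SOME S. orthonormal_basis (fibre E t) S)"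
    .
  show ?thesis
    using simple purely_infinite by blast
qed

end
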